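(* Let $K_n$ be the complete directed graph on $n$ vertices whose edge weights are independent and uniformly distributed on $[0,1]$. Perform a random edge update: choose an edge $e$ uniformly at random among the $n(n-1)$ edges and replace its weight by a new independent uniform $[0,1]$ weight. Then $\mathbb{E}[|\mathcal{LSP}^-|]=\mathbb{E}[|\mathcal{LSP}^+|]=O(\log^2 n)$.
   Context: Shortest paths are unique with probability 1. A path is a locally shortest path (LSP) if the path obtained by deleting its first edge and the path obtained by deleting its last edge are both shortest paths (empty paths count as shortest paths). Let $\mathcal{LSP}_0,\mathcal{LSP}_1$ be the sets of LSPs before and after the update, and $\mathcal{LSP}_0(e),\mathcal{LSP}_1(e)$ the sets of LSPs before and after the update that contain $e$. Then $\mathcal{LSP}^-=\mathcal{LSP}_0(e)\cup(\mathcal{LSP}_0\setminus\mathcal{LSP}_1)$ and $\mathcal{LSP}^+=\mathcal{LSP}_1(e)\cup(\mathcal{LSP}_1\setminus\mathcal{LSP}_0)$. *)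

theory Defs
  imports
    "HOL-Probability.Probability"
    "HOL-Library.Landau_Symbols"
    "Graph_Theory.Graph_Theory"
begin

section \<open>Locally shortest paths in a weighted digraph\<close>

text \<open>
  Paths are \<open>apath\<close>s, that is, lists of arcs along which no vertex is repeated.  The comparison
  ranges over the paths with the same end points, so the empty path at a vertex is always shortest.
\<close>

context wf_digraph
begin

definition shortest_path :: "'b weight_fun \<Rightarrow> 'b awalk \<Rightarrow> bool" where
  "shortest_path f p \<longleftrightarrow> (\<exists>u v. is_arg_min (awalk_cost f) (\<lambda>q. apath u q v) p)"

text \<open>
  Only paths with at least one arc are collected.  An empty arc list does not determine its vertex,
  so the empty paths of the different vertices could not be told apart here; they are locally
  shortest for all weights and contain no arc, so they are never created or destroyed by an update.
\<close>

definition locally_shortest_paths :: "'b weight_fun \<Rightarrow> 'b awalk set" where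
  "locally_shortest_paths f =
     {p. p \<noteq> [] \<and> (\<exists>u v. apath u p v) \<and> shortest_path f (tl p) \<and> shortest_path f (butlast p)}"

definition locally_shortest_paths_through :: "'b weight_fun \<Rightarrow> 'b \<Rightarrow> 'b awalk set" where
  "locally_shortest_paths_through f e = {p \<in> locally_shortest_paths f. e \<in> set p}"

text \<open>In the next two definitions the weight of the arc \<open>e\<close> is changed from \<open>f e\<close> to \<open>x\<close>.\<close>

definition lsp_minus :: "'b weight_fun \<Rightarrow> 'b \<Rightarrow> real \<Rightarrow> 'b awalk set" where
  "lsp_minus f e x = locally_shortest_paths_through f e \<union>
     (locally_shortest_paths f - locally_shortest_paths (f(e := x)))"

definition lsp_plus :: "'b weight_fun \<Rightarrow> 'b \<Rightarrow> real \<Rightarrow> 'b awalk set" where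
  "lsp_plus f e x = locally_shortest_paths_through (f(e := x)) e \<union>
     (locally_shortest_paths (f(e := x)) - locally_shortest_paths f)"

end

text \<open>For nonnegative weights this agrees with the distance \<open>\<mu>\<close> of the library.\<close>

lemma (in fin_digraph) shortest_path_iff_\<mu>:
  assumes "\<And>e. e \<in> arcs G \<Longrightarrow> 0 \<le> f e"
  shows "shortest_path f p \<longleftrightarrow> (\<exists>u v. apath u p v \<and> ereal (awalk_cost f p) = \<mu> f u v)"
proof -
  have "is_arg_min (awalk_cost f) (\<lambda>q. apath u q v) p \<longleftrightarrow>
      apath u p v \<and> ereal (awalk_cost f p) = \<mu> f u v" for u v
  proof (cases "apath u p v")
    case True
    then have walk: "awalk u p v" by (simp add: apath_def)
    then have "u \<rightarrow>\<^sup>* v" by (auto simp: reachable_awalk)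
    then obtain q where q: "apath u q v" "\<mu> f u v = awalk_cost f q"
      using min_cost_awalk assms by blast
    have le: "\<mu> f u v \<le> awalk_cost f r" if "apath u r v" for r
      using that by (simp add: min_cost_le_walk_cost apath_def)
    show ?thesis
    proof
      assume "is_arg_min (awalk_cost f) (\<lambda>q. apath u q v) p"
      then have "awalk_cost f p \<le> awalk_cost f q"
        using q(1) by (auto simp: is_arg_min_def not_less)
      then show "apath u p v \<and> ereal (awalk_cost f p) = \<mu> f u v"
        using True q le[OF True] by simp
    next
      assume "apath u p v \<and> ereal (awalk_cost f p) = \<mu> f u v"
      then show "is_arg_min (awalk_cost f) (\<lambda>q. apath u q v) p"
        using le by (metis ereal_less_eq(3) is_arg_min_linorder)
    qed
  qed (simp add: is_arg_min_def)
  then show ?thesis by (simp add: shortest_path_def)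
qed


section \<open>The random update\<close>

definition complete_nat_digraph :: "nat \<Rightarrow> (nat, nat \<times> nat) pre_digraph" where
  "complete_nat_digraph n = \<lparr>verts = {..<n}, arcs = {(u, v). u < n \<and> v < n \<and> u \<noteq> v}, tail = fst, head = snd\<rparr>"

lemma complete_nat_digraph_simps [simp]:
  "verts (complete_nat_digraph n) = {..<n}"
  "arcs (complete_nat_digraph n) = {(u, v). u < n \<and> v < n \<and> u \<noteq> v}"
  "tail (complete_nat_digraph n) = fst"
  "head (complete_nat_digraph n) = snd"
  by (simp_all add: complete_nat_digraph_def)

lemma finite_arcs_complete_nat_digraph: "finite {(u, v). u < n \<and> v < n \<and> u \<noteq> (v::nat)}"
  by (rule finite_subset[of _ "{..<n} \<times> {..<n}"]) auto

interpretation K: digraph "complete_nat_digraph n" for n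
  by unfold_locales (auto simp: arc_to_ends_def finite_arcs_complete_nat_digraph)

lemma complete_digraph_complete_nat_digraph: "complete_digraph n (complete_nat_digraph n)"
proof -
  have "graph (complete_nat_digraph n)"
    by unfold_locales
      (auto simp: symmetric_def sym_def arcs_ends_def arc_to_ends_def image_iff)
  then show ?thesis
    by (force simp: complete_digraph_def arcs_ends_def arc_to_ends_def)
qed

lemma card_arcs_complete_nat_digraph: "card (arcs (complete_nat_digraph n)) = n * (n - 1)"
proof -
  have "arcs (complete_nat_digraph n) = (SIGMA u:{..<n}. {..<n} - {u})"
    by auto
  then show ?thesis
    by (simp add: card_SigmaI)
qed

text \<open>
  A point is a triple of the initial weights, the updated edge and its new weight; the product
  measure makes them all independent.
\<close>

definition update_space :: "nat \<Rightarrow> (((nat \<times> nat) \<Rightarrow> real) \<times> (nat \<times> nat) \<times> real) measure" where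
  "update_space n =
     (\<Pi>\<^sub>M a\<in>arcs (complete_nat_digraph n). uniform_measure lborel {0..1}) \<Otimes>\<^sub>M
     uniform_count_measure (arcs (complete_nat_digraph n)) \<Otimes>\<^sub>M
     uniform_measure lborel {0..1}"

text \<open>The two random variables are integrable, so that their expectations are not mere defaults.\<close>

lemma prob_space_update_space:
  assumes "n \<ge> 2"
  shows "prob_space (update_space n)"
proof -
  have "(0, 1) \<in> arcs (complete_nat_digraph n)"
    using assms by simp
  then have ne: "arcs (complete_nat_digraph n) \<noteq> {}"
    by blast
  interpret U: prob_space "uniform_measure lborel {0..1::real}"
    by (rule prob_space_uniform_measure) auto
  interpret E: prob_space "uniform_count_measure (arcs (complete_nat_digraph n))"
    using ne by (intro prob_space_uniform_count_measure K.finite_arcs)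
  interpret W: prob_space "\<Pi>\<^sub>M a\<in>arcs (complete_nat_digraph n). uniform_measure lborel {0..1::real}"
    by (rule prob_space_PiM) (rule U.prob_space_axioms)
  interpret EU: pair_prob_space "uniform_count_measure (arcs (complete_nat_digraph n))"
    "uniform_measure lborel {0..1::real}" ..
  interpret WEU: pair_prob_space
    "\<Pi>\<^sub>M a\<in>arcs (complete_nat_digraph n). uniform_measure lborel {0..1::real}"
    "uniform_count_measure (arcs (complete_nat_digraph n)) \<Otimes>\<^sub>M uniform_measure lborel {0..1::real}" ..
  show ?thesis
    unfolding update_space_def by (rule WEU.prob_space_axioms)
qed

lemma (in fin_digraph) finite_apaths: "finite {p. \<exists>u v. apath u p v}"
proof (rule finite_subset)
  show "{p. \<exists>u v. apath u p v} \<subseteq> (\<Union>u\<in>verts G. \<Union>v\<in>verts G. {p. apath u p v})"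
    by (auto simp: apath_def intro: awalk_hd_in_verts awalk_last_in_verts)
  show "finite (\<Union>u\<in>verts G. \<Union>v\<in>verts G. {p. apath u p v})"
    using apaths_finite by auto
qed

lemma (in fin_digraph) pred_shortest_path:
  assumes F: "\<And>a. a \<in> arcs G \<Longrightarrow> (\<lambda>\<omega>. F \<omega> a) \<in> borel_measurable M"
  shows "Measurable.pred M (\<lambda>\<omega>. shortest_path (F \<omega>) p)"
proof -
  have cost: "(\<lambda>\<omega>. awalk_cost (F \<omega>) q) \<in> borel_measurable M" if "set q \<subseteq> arcs G" for q
    using that
  proof (induction q)
    case (Cons a q)
    then have [measurable]: "(\<lambda>\<omega>. F \<omega> a) \<in> borel_measurable M"
      "(\<lambda>\<omega>. awalk_cost (F \<omega>) q) \<in> borel_measurable M"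
      using F by auto
    show ?case by simp
  qed simp
  have "Measurable.pred M (\<lambda>\<omega>. \<exists>u\<in>verts G. \<exists>v\<in>verts G. apath u p v \<and>
    (\<forall>q\<in>{q. apath u q v}. awalk_cost (F \<omega>) p \<le> awalk_cost (F \<omega>) q))"
  proof (intro pred_intros_finite finite_verts apaths_finite)
    fix u v
    show "Measurable.pred M (\<lambda>\<omega>. apath u p v \<and>
      (\<forall>q\<in>{q. apath u q v}. awalk_cost (F \<omega>) p \<le> awalk_cost (F \<omega>) q))"
    proof (cases "apath u p v")
      case True
      have "Measurable.pred M (\<lambda>\<omega>. \<forall>q\<in>{q. apath u q v}. awalk_cost (F \<omega>) p \<le> awalk_cost (F \<omega>) q)"
      proof (intro pred_intros_finite apaths_finite)
        fix q assume "q \<in> {q. apath u q v}"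
        with True have [measurable]: "(\<lambda>\<omega>. awalk_cost (F \<omega>) p) \<in> borel_measurable M"
          "(\<lambda>\<omega>. awalk_cost (F \<omega>) q) \<in> borel_measurable M"
          by (auto intro!: cost simp: apath_def awalk_def)
        show "Measurable.pred M (\<lambda>\<omega>. awalk_cost (F \<omega>) p \<le> awalk_cost (F \<omega>) q)"
          by measurable
      qed
      with True show ?thesis by simp
    qed simp
  qed
  also have "(\<lambda>\<omega>. \<exists>u\<in>verts G. \<exists>v\<in>verts G. apath u p v \<and>
    (\<forall>q\<in>{q. apath u q v}. awalk_cost (F \<omega>) p \<le> awalk_cost (F \<omega>) q)) =
    (\<lambda>\<omega>. shortest_path (F \<omega>) p)"
  proof
    fix \<omega>
    have "u \<in> verts G \<and> v \<in> verts G" if "apath u p v" for u v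
      using that by (auto simp: apath_def intro: awalk_hd_in_verts awalk_last_in_verts)
    then show "(\<exists>u\<in>verts G. \<exists>v\<in>verts G. apath u p v \<and>
      (\<forall>q\<in>{q. apath u q v}. awalk_cost (F \<omega>) p \<le> awalk_cost (F \<omega>) q)) = shortest_path (F \<omega>) p"
      unfolding shortest_path_def is_arg_min_linorder mem_Collect_eq by blast
  qed
  finally show ?thesis .
qed

lemma (in fin_digraph) pred_locally_shortest:
  assumes F: "\<And>a. a \<in> arcs G \<Longrightarrow> (\<lambda>\<omega>. F \<omega> a) \<in> borel_measurable M"
  shows "Measurable.pred M (\<lambda>\<omega>. p \<in> locally_shortest_paths (F \<omega>))"
proof -
  note pred_shortest_path[where F = F, OF F, measurable]
  show ?thesis
    unfolding locally_shortest_paths_def mem_Collect_eq by measurable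
qed

lemma (in prob_space) integrable_card:
  assumes "finite P" and "\<And>\<omega>. S \<omega> \<subseteq> P"
    and "\<And>p. p \<in> P \<Longrightarrow> Measurable.pred M (\<lambda>\<omega>. p \<in> S \<omega>)"
  shows "integrable M (\<lambda>\<omega>. real (card (S \<omega>)))"
proof (rule integrable_const_bound[where B = "real (card P)"])
  show "AE \<omega> in M. norm (real (card (S \<omega>))) \<le> real (card P)"
    using assms by (simp add: card_mono)
  have "real (card (S \<omega>)) = (\<Sum>p\<in>P. if p \<in> S \<omega> then 1 else 0)" for \<omega>
    using assms(1,2) by (simp add: sum.If_cases Int_absorb1)
  moreover have "(\<lambda>\<omega>. \<Sum>p\<in>P. if p \<in> S \<omega> then 1 else (0::real)) \<in> borel_measurable M"
    using assms(3) by (intro borel_measurable_sum measurable_If) auto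
  ultimately show "(\<lambda>\<omega>. real (card (S \<omega>))) \<in> borel_measurable M"
    by simp
qed

lemma
  assumes "n \<ge> 2"
  shows integrable_lsp_minus:
      "integrable (update_space n) (\<lambda>(w, e, x). real (card (K.lsp_minus n w e x)))"
    and integrable_lsp_plus:
      "integrable (update_space n) (\<lambda>(w, e, x). real (card (K.lsp_plus n w e x)))"
proof -
  interpret prob_space "update_space n"
    using assms by (rule prob_space_update_space)
  let ?M = "update_space n"
  let ?w = "fst :: _ \<Rightarrow> (nat \<times> nat) \<Rightarrow> real"
  let ?w' = "\<lambda>\<omega> :: ((nat \<times> nat) \<Rightarrow> real) \<times> (nat \<times> nat) \<times> real.
    (fst \<omega>)(fst (snd \<omega>) := snd (snd \<omega>))"
  let ?A = "arcs (complete_nat_digraph n)"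
  have w: "(\<lambda>\<omega>. ?w \<omega> a) \<in> borel_measurable ?M" if "a \<in> ?A" for a
  proof -
    have "(\<lambda>\<omega>. fst \<omega> a) \<in> ?M \<rightarrow>\<^sub>M uniform_measure lborel {0..1::real}"
      unfolding update_space_def
      by (rule measurable_compose[OF measurable_fst measurable_component_singleton[OF that]])
    then show ?thesis
      by (simp cong: measurable_cong_sets)
  qed
  have e: "(\<lambda>\<omega>. fst (snd \<omega>)) \<in> ?M \<rightarrow>\<^sub>M count_space ?A"
    unfolding update_space_def
    by (rule measurable_compose[OF measurable_snd], rule measurable_compose[OF measurable_fst])
      (simp add: measurable_def uniform_count_measure_def space_point_measure)
  have x: "(\<lambda>\<omega>. snd (snd \<omega>)) \<in> borel_measurable ?M"
  proof -
    have "(\<lambda>\<omega>. snd (snd \<omega>)) \<in> ?M \<rightarrow>\<^sub>M uniform_measure lborel {0..1::real}"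
      unfolding update_space_def
      by (rule measurable_compose[OF measurable_snd measurable_snd])
    then show ?thesis
      by (simp cong: measurable_cong_sets)
  qed
  have e_pred: "Measurable.pred ?M (\<lambda>\<omega>. Q (fst (snd \<omega>)))" for Q
    by (rule measurable_compose[OF e]) simp
  have w': "(\<lambda>\<omega>. ?w' \<omega> a) \<in> borel_measurable ?M" if "a \<in> ?A" for a
  proof -
    have "(\<lambda>\<omega>. if a = fst (snd \<omega>) then snd (snd \<omega>) else fst \<omega> a) \<in> borel_measurable ?M"
      using e_pred[of "\<lambda>e. a = e"] x w[OF that] by (intro measurable_If) auto
    then show ?thesis by (simp add: fun_upd_def)
  qed
  note pred = K.pred_locally_shortest[of n ?w, OF w] K.pred_locally_shortest[of n ?w', OF w']
  note defs = K.lsp_minus_def K.lsp_plus_def K.locally_shortest_paths_through_def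
    Un_iff Diff_iff mem_Collect_eq
  show "integrable ?M (\<lambda>(w, e, x). real (card (K.lsp_minus n w e x)))"
    unfolding case_prod_unfold
  proof (rule integrable_card[OF K.finite_apaths])
    show "K.lsp_minus n (fst \<omega>) (fst (snd \<omega>)) (snd (snd \<omega>)) \<subseteq> {p. \<exists>u v. K.apath n u p v}" for \<omega>
      by (auto simp: defs K.locally_shortest_paths_def)
    show "Measurable.pred ?M (\<lambda>\<omega>. p \<in> K.lsp_minus n (fst \<omega>) (fst (snd \<omega>)) (snd (snd \<omega>)))" for p
      unfolding defs by (intro pred_intros_logic pred e_pred)
  qed
  show "integrable ?M (\<lambda>(w, e, x). real (card (K.lsp_plus n w e x)))"
    unfolding case_prod_unfold
  proof (rule integrable_card[OF K.finite_apaths])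
    show "K.lsp_plus n (fst \<omega>) (fst (snd \<omega>)) (snd (snd \<omega>)) \<subseteq> {p. \<exists>u v. K.apath n u p v}" for \<omega>
      by (auto simp: defs K.locally_shortest_paths_def)
    show "Measurable.pred ?M (\<lambda>\<omega>. p \<in> K.lsp_plus n (fst \<omega>) (fst (snd \<omega>)) (snd (snd \<omega>)))" for p
      unfolding defs by (intro pred_intros_logic pred e_pred)
  qed
qed

end

(*
  Call an arc light if its weight is at most c ln n / n.  Outside an event of probability at most
  n^-4, every distance is at most c ln n / n, so that all arcs of shortest paths are light, shortest
  paths have O(ln n) arcs, and every vertex is incident with O(ln n) light arcs.

  Shortest paths are almost surely unique, and a locally shortest path with at least two arcs is a
  shortest path extended by one light arc.  Hence there are O(n^2 ln n) locally shortest paths, each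
  with O(ln n) arcs, and a random arc lies on O((ln n)^2) of them on average.  If a locally shortest
  path avoiding e is destroyed, then it extends a shortest path whose replacement runs through e.
  The exchange of the old and the new weight of e preserves the measure, so on average there are as
  many such replacements as shortest paths through e, namely O(ln n), and each accounts for O(ln n)
  extensions.  The same exchange gives the equality of the two expectations.

  For the distances, the out-neighbourhood of u is explored in rounds.  The first round finds about
  ln n vertices, and then each round uses arcs of weight at most 200 / n from the last layer to the
  unexplored vertices and doubles the layer until more than n / 2 vertices are reached.  The
  in-neighbourhood of v grows in the same way, and the two sets meet.  The arcs used in a round are
  independent of those that determine the previous layers.
*)
theory Submission
  imports Defs "HOL-Real_Asymp.Real_Asymp"
begin

text \<open>Uniform weights have no memoryless property that would renew an arc once it has been
  inspected. The exploration therefore never inspects an arc twice: a round queries only arcs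
  between the newest layer and undiscovered vertices. The event that the earlier rounds end in a
  given pair of sets depends on other coordinates, so conditioning on it becomes a product of
  integrals. The first round differs because a single vertex has on average only boundedly many arcs
  of weight O(1/n), too few for a failure probability that is polynomially small. All tail bounds
  are exponential moments, computed as products over distinct arcs.

  Only the old weights are required to be typical. In the bound for destroyed paths the number of
  extensions is a constant for typical old weights, while the number of new shortest paths through
  \<open>e\<close> stays random and is averaged only after the exchange has made it a function of
  the old weights. On atypical weights there are almost surely at most of order n^3 locally shortest
  paths, which a probability of n^-4 absorbs.\<close>

section \<open>Independence as factorisation of integrals over product measures\<close>

text \<open>Fubini with coordinate \<open>i\<close> split off: since \<open>h\<close> ignores that
  coordinate, it may be evaluated at an arbitrary fixed value \<open>c\<close> there and leaves the
  inner integral as a constant.\<close>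

lemma (in product_prob_space) nn_integral_PiM_mult_coordinate:
  assumes A: "finite A" "i \<in> A"
    and h: "h \<in> borel_measurable (Pi\<^sub>M A M)" and g: "g \<in> borel_measurable (M i)"
    and indep: "\<And>x y. x \<in> space (Pi\<^sub>M A M) \<Longrightarrow> y \<in> space (M i) \<Longrightarrow> h (x(i := y)) = h x"
  shows "(\<integral>\<^sup>+x. h x * g (x i) \<partial>Pi\<^sub>M A M) = (\<integral>\<^sup>+x. h x \<partial>Pi\<^sub>M A M) * (\<integral>\<^sup>+y. g y \<partial>M i)"
proof -
  obtain c where c: "c \<in> space (M i)"
    using prob_space.not_empty[OF prob_space] by blast
  define B where "B = A - {i}"
  have B: "finite B" "i \<notin> B" "A = insert i B"
    using A by (auto simp: B_def)
  have [measurable]: "h \<in> borel_measurable (Pi\<^sub>M (insert i B) M)" "g \<in> borel_measurable (M i)"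
    using h g B by auto
  have const: "h (x(i := y)) = h (x(i := c))" if "x \<in> space (Pi\<^sub>M B M)" "y \<in> space (M i)" for x y
  proof -
    have "x(i := c) \<in> space (Pi\<^sub>M A M)"
      using that(1) c B by (auto simp: space_PiM PiE_def extensional_def)
    from indep[OF this that(2)] show ?thesis by simp
  qed
  have "(\<lambda>x. x(i := c)) \<in> Pi\<^sub>M B M \<rightarrow>\<^sub>M Pi\<^sub>M (insert i B) M"
    using c by (intro measurable_fun_upd[where J = B]) auto
  then have [measurable]: "(\<lambda>x. h (x(i := c))) \<in> borel_measurable (Pi\<^sub>M B M)"
    by (rule measurable_compose) measurable
  have mass: "emeasure (M i) (space (M i)) = 1"
    by (rule prob_space.emeasure_space_1[OF prob_space])
  have "(\<integral>\<^sup>+x. h x * g (x i) \<partial>Pi\<^sub>M A M) =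
      (\<integral>\<^sup>+x. (\<integral>\<^sup>+y. h (x(i := y)) * g y \<partial>M i) \<partial>Pi\<^sub>M B M)"
    unfolding B(3) by (subst product_nn_integral_insert[OF B(1,2)]) auto
  also have "\<dots> = (\<integral>\<^sup>+x. h (x(i := c)) * (\<integral>\<^sup>+y. g y \<partial>M i) \<partial>Pi\<^sub>M B M)"
    by (intro nn_integral_cong) (auto simp: const nn_integral_cmult cong: nn_integral_cong)
  also have "\<dots> = (\<integral>\<^sup>+x. h (x(i := c)) \<partial>Pi\<^sub>M B M) * (\<integral>\<^sup>+y. g y \<partial>M i)"
    by (intro nn_integral_multc) auto
  also have "(\<integral>\<^sup>+x. h (x(i := c)) \<partial>Pi\<^sub>M B M) = (\<integral>\<^sup>+x. h x \<partial>Pi\<^sub>M A M)"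
    unfolding B(3) using mass by (subst product_nn_integral_insert[OF B(1,2)])
      (auto simp: const cong: nn_integral_cong)
  finally show ?thesis .
qed

text \<open>One coordinate is peeled off at a time; the factors still to be treated join
  \<open>h\<close>, as they do not depend on the coordinate being removed.\<close>

lemma (in product_prob_space) nn_integral_PiM_mult_prod:
  assumes A: "finite A" "J \<subseteq> A"
    and h: "h \<in> borel_measurable (Pi\<^sub>M A M)"
    and g: "\<And>j. j \<in> J \<Longrightarrow> g j \<in> borel_measurable (M j)"
    and indep: "\<And>j x y. j \<in> J \<Longrightarrow> x \<in> space (Pi\<^sub>M A M) \<Longrightarrow> y \<in> space (M j) \<Longrightarrow> h (x(j := y)) = h x"
  shows "(\<integral>\<^sup>+x. h x * (\<Prod>j\<in>J. g j (x j)) \<partial>Pi\<^sub>M A M) =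
    (\<integral>\<^sup>+x. h x \<partial>Pi\<^sub>M A M) * (\<Prod>j\<in>J. \<integral>\<^sup>+y. g j y \<partial>M j)"
proof -
  have "finite J" using A finite_subset by blast
  then show ?thesis using A(2) g indep
  proof (induction J)
    case (insert j J)
    have [measurable]: "h \<in> borel_measurable (Pi\<^sub>M A M)" by fact
    have [measurable]: "(\<lambda>x. g k (x k)) \<in> borel_measurable (Pi\<^sub>M A M)" if "k \<in> J" for k
      using insert.prems that
      by (intro measurable_compose[OF measurable_component_singleton]) auto
    have "(\<integral>\<^sup>+x. h x * (\<Prod>j\<in>insert j J. g j (x j)) \<partial>Pi\<^sub>M A M) =
       (\<integral>\<^sup>+x. (h x * (\<Prod>j\<in>J. g j (x j))) * g j (x j) \<partial>Pi\<^sub>M A M)"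
      using insert.hyps by (simp add: mult_ac)
    also have "\<dots> = (\<integral>\<^sup>+x. h x * (\<Prod>j\<in>J. g j (x j)) \<partial>Pi\<^sub>M A M) * (\<integral>\<^sup>+y. g j y \<partial>M j)"
    proof (rule nn_integral_PiM_mult_coordinate[OF A(1)])
      fix x y assume xy: "x \<in> space (Pi\<^sub>M A M)" "y \<in> space (M j)"
      have "(\<Prod>k\<in>J. g k ((x(j := y)) k)) = (\<Prod>k\<in>J. g k (x k))"
        using insert.hyps by (intro prod.cong) auto
      then show "h (x(j := y)) * (\<Prod>k\<in>J. g k ((x(j := y)) k)) = h x * (\<Prod>k\<in>J. g k (x k))"
        using insert.prems(3)[OF _ xy] by (simp only: insertI1)
    qed (use insert.prems in auto)
    also have "(\<integral>\<^sup>+x. h x * (\<Prod>j\<in>J. g j (x j)) \<partial>Pi\<^sub>M A M) =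
        (\<integral>\<^sup>+x. h x \<partial>Pi\<^sub>M A M) * (\<Prod>j\<in>J. \<integral>\<^sup>+y. g j y \<partial>M j)"
      using insert.prems by (intro insert.IH) auto
    finally show ?case
      using insert.hyps by (simp add: mult_ac)
  qed simp
qed

text \<open>The number of blocks with a success is binomial and independent of \<open>h\<close>. A
  block fails with probability \<open>q\<close>, so it contributes \<open>a * (1 - q) + q\<close> to
  the generating function. Pointwise its factor is \<open>a\<close> plus \<open>1 - a\<close> times
  the indicator of failure, and that indicator is a product over single coordinates.\<close>

lemma (in product_prob_space) nn_integral_PiM_mult_blocks:
  fixes a :: real and P :: "'i \<Rightarrow> 'a \<Rightarrow> bool"
  assumes A: "finite A" and Z: "finite Z" and B: "\<And>z. z \<in> Z \<Longrightarrow> B z \<subseteq> A"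
    and disj: "disjoint_family_on B Z"
    and h: "h \<in> borel_measurable (Pi\<^sub>M A M)"
    and P: "\<And>j. j \<in> (\<Union>z\<in>Z. B z) \<Longrightarrow> Measurable.pred (M j) (P j)"
    and indep: "\<And>j x y. j \<in> (\<Union>z\<in>Z. B z) \<Longrightarrow> x \<in> space (Pi\<^sub>M A M) \<Longrightarrow> y \<in> space (M j) \<Longrightarrow>
      h (x(j := y)) = h x"
    and a: "0 \<le> a" "a \<le> 1"
    and q: "\<And>z. z \<in> Z \<Longrightarrow> (\<Prod>j\<in>B z. \<P>(y in M j. \<not> P j y)) = q"
  shows "(\<integral>\<^sup>+x. h x * ennreal (a ^ card {z \<in> Z. \<exists>j\<in>B z. P j (x j)}) \<partial>Pi\<^sub>M A M) =
    (\<integral>\<^sup>+x. h x \<partial>Pi\<^sub>M A M) * ennreal ((a + (1 - a) * q) ^ card Z)"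
proof -
  have finB: "finite (B z)" if "z \<in> Z" for z
    using B[OF that] A finite_subset by blast
  let ?u = "\<lambda>x z. (\<Prod>j\<in>B z. if P j (x j) then 0 else 1 :: real)"
  have u: "?u x z = (if \<exists>j\<in>B z. P j (x j) then 0 else 1)" if "z \<in> Z" for x z
    using finB[OF that] by (auto intro!: prod.neutral)
  \<comment> \<open>Expanding the product over the blocks makes every summand a product over single coordinates.\<close>
  have sets: "a ^ card {z \<in> Z. \<exists>j\<in>B z. P j (x j)} =
      (\<Sum>S\<in>Pow Z. a ^ card (Z - S) * (1 - a) ^ card S * (\<Prod>j\<in>(\<Union>z\<in>S. B z). if P j (x j) then 0 else 1))"
    for x
  proof -
    have "a ^ card {z \<in> Z. \<exists>j\<in>B z. P j (x j)} = (\<Prod>z\<in>Z. (1 - a) * ?u x z + a)"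
    proof -
      have "(\<Prod>z\<in>Z. (1 - a) * ?u x z + a) = (\<Prod>z\<in>Z. if \<exists>j\<in>B z. P j (x j) then a else 1)"
        using u by (intro prod.cong) auto
      also have "\<dots> = a ^ card {z \<in> Z. \<exists>j\<in>B z. P j (x j)}"
        using Z by (simp add: prod.If_cases Int_def)
      finally show ?thesis by simp
    qed
    also have "\<dots> = (\<Sum>S\<in>Pow Z. (\<Prod>z\<in>S. (1 - a) * ?u x z) * (\<Prod>z\<in>Z - S. a))"
      using Z by (rule prod_add)
    also have "\<dots> = (\<Sum>S\<in>Pow Z. a ^ card (Z - S) * (1 - a) ^ card S * (\<Prod>j\<in>(\<Union>z\<in>S. B z). if P j (x j) then 0 else 1))"
    proof (intro sum.cong refl)
      fix S assume S: "S \<in> Pow Z"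
      have "(\<Prod>z\<in>S. ?u x z) = (\<Prod>j\<in>(\<Union>z\<in>S. B z). if P j (x j) then 0 else 1)"
      proof (rule prod.UNION_disjoint[symmetric])
        show "finite S" using S Z finite_subset by blast
        show "\<forall>i\<in>S. finite (B i)" using S finB by blast
        show "\<forall>i\<in>S. \<forall>j\<in>S. i \<noteq> j \<longrightarrow> B i \<inter> B j = {}"
          using disj S by (auto simp: disjoint_family_on_def)
      qed
      then show "(\<Prod>z\<in>S. (1 - a) * ?u x z) * (\<Prod>z\<in>Z - S. a) =
         a ^ card (Z - S) * (1 - a) ^ card S * (\<Prod>j\<in>(\<Union>z\<in>S. B z). if P j (x j) then 0 else 1)"
        by (simp add: prod.distrib)
    qed
    finally show ?thesis .
  qed
  have single: "(\<integral>\<^sup>+x. h x * ennreal (\<Prod>j\<in>(\<Union>z\<in>S. B z). if P j (x j) then 0 else 1) \<partial>Pi\<^sub>M A M) =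
     (\<integral>\<^sup>+x. h x \<partial>Pi\<^sub>M A M) * ennreal (q ^ card S)" if S: "S \<subseteq> Z" for S
  proof -
    have finS: "finite S" using S Z finite_subset by blast
    have "(\<integral>\<^sup>+x. h x * ennreal (\<Prod>j\<in>(\<Union>z\<in>S. B z). if P j (x j) then 0 else 1) \<partial>Pi\<^sub>M A M) =
       (\<integral>\<^sup>+x. h x * (\<Prod>j\<in>(\<Union>z\<in>S. B z). (\<lambda>y. if P j y then 0 else 1) (x j)) \<partial>Pi\<^sub>M A M)"
    proof (intro nn_integral_cong arg_cong2[where f = "(*)"] refl)
      fix x
      have "ennreal (\<Prod>j\<in>(\<Union>z\<in>S. B z). if P j (x j) then 0 else 1) =
          (\<Prod>j\<in>(\<Union>z\<in>S. B z). ennreal (if P j (x j) then 0 else 1))"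
        by (rule prod_ennreal[symmetric]) simp
      also have "\<dots> = (\<Prod>j\<in>(\<Union>z\<in>S. B z). (\<lambda>y. if P j y then 0 else 1) (x j))"
        by (intro prod.cong) auto
      finally show "ennreal (\<Prod>j\<in>(\<Union>z\<in>S. B z). if P j (x j) then 0 else 1) =
          (\<Prod>j\<in>(\<Union>z\<in>S. B z). (\<lambda>y. if P j y then 0 else 1) (x j))" .
    qed
    also have "\<dots> = (\<integral>\<^sup>+x. h x \<partial>Pi\<^sub>M A M) * (\<Prod>j\<in>(\<Union>z\<in>S. B z). \<integral>\<^sup>+y. (if P j y then 0 else 1) \<partial>M j)"
    proof (rule nn_integral_PiM_mult_prod[where g = "\<lambda>j y. if P j y then 0 else 1", OF A _ h])
      show "(\<Union>z\<in>S. B z) \<subseteq> A" using S B by blast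
    next
      fix j assume "j \<in> (\<Union>z\<in>S. B z)"
      with S have [measurable]: "Measurable.pred (M j) (P j)" by (intro P) auto
      show "(\<lambda>y. if P j y then 0 else 1 :: ennreal) \<in> borel_measurable (M j)" by measurable
    next
      fix j x y assume *: "j \<in> (\<Union>z\<in>S. B z)" "x \<in> space (Pi\<^sub>M A M)" "y \<in> space (M j)"
      show "h (x(j := y)) = h x" using S *(1) by (intro indep *(2,3)) auto
    qed
    also have "(\<Prod>j\<in>(\<Union>z\<in>S. B z). \<integral>\<^sup>+y. (if P j y then 0 else 1) \<partial>M j) =
       (\<Prod>j\<in>(\<Union>z\<in>S. B z). ennreal (\<P>(y in M j. \<not> P j y)))"
    proof (intro prod.cong refl)
      fix j assume j: "j \<in> (\<Union>z\<in>S. B z)"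
      then have [measurable]: "Measurable.pred (M j) (P j)" using S by (intro P) auto
      interpret M: prob_space "M j" by (rule prob_space)
      have "(\<integral>\<^sup>+y. (if P j y then 0 else 1) \<partial>M j) = (\<integral>\<^sup>+y. indicator {y\<in>space (M j). \<not> P j y} y \<partial>M j)"
        by (intro nn_integral_cong) (auto simp: indicator_def)
      also have "\<dots> = emeasure (M j) {y\<in>space (M j). \<not> P j y}"
        by (intro nn_integral_indicator) measurable
      finally show "(\<integral>\<^sup>+y. (if P j y then 0 else 1) \<partial>M j) = ennreal (\<P>(y in M j. \<not> P j y))"
        by (simp add: M.emeasure_eq_measure)
    qed
    also have "\<dots> = ennreal (\<Prod>j\<in>(\<Union>z\<in>S. B z). \<P>(y in M j. \<not> P j y))"
      by (simp add: prod_ennreal)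
    also have "(\<Prod>j\<in>(\<Union>z\<in>S. B z). \<P>(y in M j. \<not> P j y)) = (\<Prod>z\<in>S. \<Prod>j\<in>B z. \<P>(y in M j. \<not> P j y))"
      using disj S finB finS by (intro prod.UNION_disjoint) (auto simp: disjoint_family_on_def)
    also have "\<dots> = (\<Prod>z\<in>S. q)"
      using S q by (intro prod.cong) auto
    finally show ?thesis by (simp only: prod_constant)
  qed
  have meas: "(\<lambda>x. h x * ennreal (\<Prod>j\<in>(\<Union>z\<in>S. B z). if P j (x j) then 0 else 1))
      \<in> borel_measurable (Pi\<^sub>M A M)" if S: "S \<subseteq> Z" for S
  proof (intro borel_measurable_times_ennreal h measurable_compose[OF _ measurable_ennreal]
      borel_measurable_prod)
    fix j assume j: "j \<in> (\<Union>z\<in>S. B z)"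
    have [measurable]: "Measurable.pred (M j) (P j)" using j S by (intro P) auto
    have "(\<lambda>y. if P j y then 0 else 1 :: real) \<in> borel_measurable (M j)" by measurable
    then show "(\<lambda>x. if P j (x j) then 0 else 1 :: real) \<in> borel_measurable (Pi\<^sub>M A M)"
      using j S B by (intro measurable_compose[OF measurable_component_singleton[of j A M]]) auto
  qed
  \<comment> \<open>For empty \<open>Z\<close> nothing restricts \<open>q\<close>, but then only
    \<open>q ^ 0\<close> occurs.\<close>
  have q0: "0 \<le> q" if ne: "Z \<noteq> {}"
  proof -
    obtain z where "z \<in> Z" using ne by blast
    from q[OF this] show ?thesis by (auto intro: prod_nonneg)
  qed
  have "(\<integral>\<^sup>+x. h x * ennreal (a ^ card {z \<in> Z. \<exists>j\<in>B z. P j (x j)}) \<partial>Pi\<^sub>M A M) =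
     (\<integral>\<^sup>+x. (\<Sum>S\<in>Pow Z. ennreal (a ^ card (Z - S) * (1 - a) ^ card S) *
        (h x * ennreal (\<Prod>j\<in>(\<Union>z\<in>S. B z). if P j (x j) then 0 else 1))) \<partial>Pi\<^sub>M A M)"
  proof (intro nn_integral_cong)
    fix x
    have "h x * ennreal (a ^ card {z \<in> Z. \<exists>j\<in>B z. P j (x j)}) =
      h x * (\<Sum>S\<in>Pow Z. ennreal (a ^ card (Z - S) * (1 - a) ^ card S *
        (\<Prod>j\<in>(\<Union>z\<in>S. B z). if P j (x j) then 0 else 1)))"
      unfolding sets using a
      by (intro arg_cong2[where f = "(*)"] refl sum_ennreal[symmetric] mult_nonneg_nonneg prod_nonneg)
        auto
    also have "\<dots> = (\<Sum>S\<in>Pow Z. ennreal (a ^ card (Z - S) * (1 - a) ^ card S) *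
        (h x * ennreal (\<Prod>j\<in>(\<Union>z\<in>S. B z). if P j (x j) then 0 else 1)))"
      unfolding sum_distrib_left
    proof (intro sum.cong refl)
      fix S
      show "h x * ennreal (a ^ card (Z - S) * (1 - a) ^ card S *
          (\<Prod>j\<in>(\<Union>z\<in>S. B z). if P j (x j) then 0 else 1)) =
        ennreal (a ^ card (Z - S) * (1 - a) ^ card S) *
          (h x * ennreal (\<Prod>j\<in>(\<Union>z\<in>S. B z). if P j (x j) then 0 else 1))"
        using a by (subst ennreal_mult'[of "a ^ card (Z - S) * (1 - a) ^ card S"])
          (simp_all only: mult.left_commute zero_le_mult_iff zero_le_power diff_ge_0_iff_ge simp_thms)
    qed
    finally show "h x * ennreal (a ^ card {z \<in> Z. \<exists>j\<in>B z. P j (x j)}) =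
      (\<Sum>S\<in>Pow Z. ennreal (a ^ card (Z - S) * (1 - a) ^ card S) *
        (h x * ennreal (\<Prod>j\<in>(\<Union>z\<in>S. B z). if P j (x j) then 0 else 1)))" .
  qed
  also have "\<dots> = (\<Sum>S\<in>Pow Z. (\<integral>\<^sup>+x. ennreal (a ^ card (Z - S) * (1 - a) ^ card S) *
        (h x * ennreal (\<Prod>j\<in>(\<Union>z\<in>S. B z). if P j (x j) then 0 else 1)) \<partial>Pi\<^sub>M A M))"
    using meas by (intro nn_integral_sum borel_measurable_times_ennreal[OF measurable_const]) auto
  also have "\<dots> = (\<Sum>S\<in>Pow Z. ennreal (a ^ card (Z - S) * (1 - a) ^ card S) *
        ((\<integral>\<^sup>+x. h x \<partial>Pi\<^sub>M A M) * ennreal (q ^ card S)))"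
  proof (intro sum.cong refl)
    fix S assume S: "S \<in> Pow Z"
    show "(\<integral>\<^sup>+x. ennreal (a ^ card (Z - S) * (1 - a) ^ card S) *
        (h x * ennreal (\<Prod>j\<in>(\<Union>z\<in>S. B z). if P j (x j) then 0 else 1)) \<partial>Pi\<^sub>M A M) =
      ennreal (a ^ card (Z - S) * (1 - a) ^ card S) * ((\<integral>\<^sup>+x. h x \<partial>Pi\<^sub>M A M) * ennreal (q ^ card S))"
      using S by (subst nn_integral_cmult) (simp_all only: meas single Pow_iff)
  qed
  also have "\<dots> = (\<integral>\<^sup>+x. h x \<partial>Pi\<^sub>M A M) * (\<Sum>S\<in>Pow Z. ennreal (a ^ card (Z - S) * (1 - a) ^ card S * q ^ card S))"
    unfolding sum_distrib_left
  proof (intro sum.cong refl)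
    fix S assume "S \<in> Pow Z"
    then have "0 \<le> q ^ card S" by (cases "Z = {}") (auto simp: q0)
    then have "ennreal (a ^ card (Z - S) * (1 - a) ^ card S * q ^ card S) =
        ennreal (a ^ card (Z - S) * (1 - a) ^ card S) * ennreal (q ^ card S)"
      using a by (intro ennreal_mult) auto
    then show "ennreal (a ^ card (Z - S) * (1 - a) ^ card S) * ((\<integral>\<^sup>+x. h x \<partial>Pi\<^sub>M A M) * ennreal (q ^ card S)) =
      (\<integral>\<^sup>+x. h x \<partial>Pi\<^sub>M A M) * ennreal (a ^ card (Z - S) * (1 - a) ^ card S * q ^ card S)"
      by (simp only: mult.left_commute)
  qed
  also have "(\<Sum>S\<in>Pow Z. ennreal (a ^ card (Z - S) * (1 - a) ^ card S * q ^ card S)) =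
      ennreal (\<Sum>S\<in>Pow Z. a ^ card (Z - S) * (1 - a) ^ card S * q ^ card S)"
    using a q0 by (intro sum_ennreal) (cases "Z = {}", auto)
  also have "(\<Sum>S\<in>Pow Z. a ^ card (Z - S) * (1 - a) ^ card S * q ^ card S) =
     (\<Sum>S\<in>Pow Z. (\<Prod>z\<in>S. (1 - a) * q) * (\<Prod>z\<in>Z - S. a))"
    by (intro sum.cong) (auto simp: power_mult_distrib)
  also have "\<dots> = (\<Prod>z\<in>Z. (1 - a) * q + a)"
    using Z by (rule prod_add[symmetric])
  finally show ?thesis by (simp add: add.commute)
qed

section \<open>Uniform weights on the arcs\<close>

abbreviation uniform01 :: "real measure" where
  "uniform01 \<equiv> uniform_measure lborel {0..1}"

interpretation U: prob_space uniform01
  by (rule prob_space_uniform_measure) auto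

interpretation UP: product_prob_space "\<lambda>_ :: nat \<times> nat. uniform01" UNIV
  by unfold_locales

lemma prob_uniform01_greater:
  assumes "0 \<le> d" "d \<le> 1"
  shows "\<P>(y in uniform01. \<not> y \<le> d) = 1 - d"
proof -
  have "{0..1} \<inter> {y. \<not> y \<le> d} = {d<..1}" using assms by auto
  then show ?thesis
    using assms by (simp add: measure_uniform_measure)
qed

lemma emeasure_uniform01_singleton: "emeasure uniform01 {c} = 0"
proof -
  have "emeasure lborel ({0..1} \<inter> {c}) \<le> emeasure lborel {c}"
    by (intro emeasure_mono) auto
  then show ?thesis
    by simp
qed

lemma AE_uniform01: "AE y in uniform01. 0 \<le> y \<and> y \<le> 1"
  by (rule AE_uniform_measureI) auto

text \<open>The exact value is \<open>(1 - exp (- t)) / t\<close>. The bound is the factor that each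
  arc contributes to the exponential moment of a path cost.\<close>

lemma nn_integral_exp_uniform01_le:
  assumes "t > 0"
  shows "(\<integral>\<^sup>+y. ennreal (exp (- t * y)) \<partial>uniform01) \<le> ennreal (1 / t)"
proof -
  have "(\<integral>\<^sup>+y. ennreal (exp (- t * y)) \<partial>uniform01) =
      (\<integral>\<^sup>+y. ennreal (exp (- t * y)) * indicator {0..1} y \<partial>lborel)"
    by (subst nn_integral_uniform_measure) (auto simp: divide_ennreal_def)
  also have "\<dots> = ennreal ((- exp (- t * 1) / t) - (- exp (- t * 0) / t))"
    using assms
    by (intro nn_integral_FTC_Icc) (auto intro!: derivative_eq_intros simp: has_real_derivative_iff_has_vector_derivative[symmetric])
  also have "\<dots> \<le> ennreal (1 / t)"
    using assms by (intro ennreal_leI) simp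
  finally show ?thesis .
qed

definition weight_space :: "nat \<Rightarrow> (nat \<times> nat \<Rightarrow> real) measure" where
  "weight_space n = Pi\<^sub>M (arcs (complete_nat_digraph n)) (\<lambda>_. uniform01)"

interpretation W: prob_space "weight_space n" for n
  unfolding weight_space_def by (rule prob_space_PiM) (rule U.prob_space_axioms)

lemma measurable_weight:
  assumes "a \<in> arcs (complete_nat_digraph n)"
  shows "(\<lambda>w. w a) \<in> borel_measurable (weight_space n)"
proof -
  have "(\<lambda>w. w a) \<in> weight_space n \<rightarrow>\<^sub>M uniform01"
    unfolding weight_space_def by (rule measurable_component_singleton[OF assms])
  then show ?thesis by (simp cong: measurable_cong_sets)
qed

lemma AE_weight_space:
  "AE w in weight_space n. \<forall>a\<in>arcs (complete_nat_digraph n). 0 \<le> w a \<and> w a \<le> 1"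
proof (subst AE_ball_countable)
  show "countable (arcs (complete_nat_digraph n))"
    by (rule countable_finite[OF K.finite_arcs])
  show "\<forall>a\<in>arcs (complete_nat_digraph n). AE w in weight_space n. 0 \<le> w a \<and> w a \<le> 1"
    unfolding weight_space_def
    by (intro ballI AE_PiM_component[where M = "\<lambda>_. uniform01", OF U.prob_space_axioms _ AE_uniform01])
qed

section \<open>Exploring the neighbourhood of a vertex\<close>

text \<open>\<open>S\<close> is meant to consist of \<open>Y\<close> and all older layers. Arcs from
  older layers to the outside were inspected in their own round; leaving them out makes the arcs
  queried in different rounds disjoint.\<close>

definition light_nbrs :: "nat \<Rightarrow> (nat \<times> nat \<Rightarrow> nat \<times> nat) \<Rightarrow> real \<Rightarrow> nat set \<Rightarrow> nat set \<Rightarrow> (nat \<times> nat \<Rightarrow> real) \<Rightarrow> nat set"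
  where "light_nbrs n T d S Y w = {z \<in> {..<n} - S. \<exists>y\<in>Y. w (T (y, z)) \<le> d}"

text \<open>
  The pair consists of the vertices discovered before the last round and those discovered in it.
  Round \<open>i\<close> uses the arcs of weight at most \<open>d i\<close>; with \<open>T = id\<close> they are followed
  forwards, with \<open>T = prod.swap\<close> backwards.
\<close>

primrec layers :: "nat \<Rightarrow> (nat \<times> nat \<Rightarrow> nat \<times> nat) \<Rightarrow> (nat \<Rightarrow> real) \<Rightarrow> nat \<Rightarrow> (nat \<times> nat \<Rightarrow> real) \<Rightarrow> nat \<Rightarrow> nat set \<times> nat set"
  where
    "layers n T d u w 0 = ({}, {u})"
  | "layers n T d u w (Suc i) =
      (case layers n T d u w i of (X, Y) \<Rightarrow> (X \<union> Y, light_nbrs n T (d i) (X \<union> Y) Y w))"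

lemma light_nbrs_subset: "light_nbrs n T d S Y w \<subseteq> {..<n} - S"
  by (auto simp: light_nbrs_def)

lemma layers_subset:
  assumes "u < n" "layers n T d u w i = (X, Y)"
  shows "X \<subseteq> {..<n}" "Y \<subseteq> {..<n}" "X \<inter> Y = {}"
  using assms
proof (atomize (full), induction i arbitrary: X Y)
  case (Suc i)
  obtain X' Y' where "layers n T d u w i = (X', Y')" by fastforce
  with Suc light_nbrs_subset[of n T "d i" "X' \<union> Y'" Y' w] show ?case by auto
qed auto

text \<open>The rounds that produced \<open>(X, Y)\<close> read only weights of arcs
  \<open>T (y', z')\<close> with \<open>y'\<close> in \<open>X\<close>, the union of all layers but
  the last. By injectivity of \<open>T\<close>, the weight at \<open>T (y, z)\<close> with
  \<open>y\<close> outside \<open>X\<close> was not read.\<close>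

lemma layers_update:
  assumes T: "inj_on T (arcs (complete_nat_digraph n))" and "u < n"
    and "layers n T d u w i = (X, Y)" "y \<notin> X" "(y, z) \<in> arcs (complete_nat_digraph n)"
  shows "layers n T d u (w(T (y, z) := c)) i = (X, Y)"
  using assms(3-4)
proof (induction i arbitrary: X Y)
  case (Suc i)
  obtain X' Y' where *: "layers n T d u w i = (X', Y')" by fastforce
  with Suc.prems have X: "X = X' \<union> Y'" and Y: "Y = light_nbrs n T (d i) (X' \<union> Y') Y' w"
    and y: "y \<notin> X'" "y \<notin> Y'"
    by auto
  have "light_nbrs n T (d i) (X' \<union> Y') Y' (w(T (y, z) := c)) = light_nbrs n T (d i) (X' \<union> Y') Y' w"
    unfolding light_nbrs_def
  proof (intro Collect_cong conj_cong refl bex_cong)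
    fix z' y' assume z': "z' \<in> {..<n} - (X' \<union> Y')" and y': "y' \<in> Y'"
    with layers_subset[OF \<open>u < n\<close> *] have "(y', z') \<in> arcs (complete_nat_digraph n)"
      by auto
    then have "T (y', z') \<noteq> T (y, z)"
      using assms(5) y y' inj_onD[OF T, of "(y', z')" "(y, z)"] by blast
    then show "((w(T (y, z) := c)) (T (y', z')) \<le> d i) = (w (T (y', z')) \<le> d i)"
      by simp
  qed
  with Suc.IH[OF * y(1)] X Y show ?case by (simp del: fun_upd_apply)
qed simp

lemma layers_update_iff:
  assumes T: "inj_on T (arcs (complete_nat_digraph n))" and "u < n"
    and "y \<notin> X" "(y, z) \<in> arcs (complete_nat_digraph n)"
  shows "layers n T d u (w(T (y, z) := c)) i = (X, Y) \<longleftrightarrow> layers n T d u w i = (X, Y)"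
proof
  assume "layers n T d u (w(T (y, z) := c)) i = (X, Y)"
  \<comment> \<open>Writing back the old weight turns one implication into the other.\<close>
  from layers_update[OF T assms(2) this assms(3,4), of "w (T (y, z))"]
  show "layers n T d u w i = (X, Y)" by (simp only: fun_upd_upd fun_upd_triv)
qed (rule layers_update[OF T assms(2) _ assms(3,4)])

text \<open>Only finitely many neighbourhoods \<open>R\<close> are possible, so for arbitrary
  \<open>Q\<close> the event is a finite union of events \<open>light_nbrs n T d S Y w = R\<close>.
  The inclusion of \<open>Y\<close> in \<open>S\<close> makes every queried pair an arc, that is, a
  coordinate of the product.\<close>

lemma pred_light_nbrs:
  assumes T: "T ` arcs (complete_nat_digraph n) \<subseteq> arcs (complete_nat_digraph n)"
    and S: "Y \<subseteq> S" "S \<subseteq> {..<n}"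
  shows "Measurable.pred (weight_space n) (\<lambda>w. Q (light_nbrs n T d S Y w))"
proof -
  have const: "Measurable.pred (weight_space n) (\<lambda>_. c)" for c
    by (rule measurable_const) (simp only: space_count_space UNIV_I)
  have single: "Measurable.pred (weight_space n) (\<lambda>w. light_nbrs n T d S Y w = R)" for R
  proof -
    have "Measurable.pred (weight_space n)
      (\<lambda>w. R \<subseteq> {..<n} - S \<and> (\<forall>z\<in>{..<n} - S. z \<in> R \<longleftrightarrow> (\<exists>y\<in>Y. w (T (y, z)) \<le> d)))"
    proof (rule pred_intros_logic(3))
      show "Measurable.pred (weight_space n) (\<lambda>w. \<forall>z\<in>{..<n} - S. z \<in> R \<longleftrightarrow> (\<exists>y\<in>Y. w (T (y, z)) \<le> d))"
      proof (rule pred_intros_finite(3))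
        fix z assume z: "z \<in> {..<n} - S"
        show "Measurable.pred (weight_space n) (\<lambda>w. (z \<in> R) = (\<exists>y\<in>Y. w (T (y, z)) \<le> d))"
        proof (rule pred_intros_logic(6))
          show "Measurable.pred (weight_space n) (\<lambda>w. \<exists>y\<in>Y. w (T (y, z)) \<le> d)"
          proof (rule pred_intros_finite(4))
            show "finite Y" by (rule finite_subset[OF subset_trans[OF S] finite_lessThan])
            fix y assume "y \<in> Y"
            then have "(y, z) \<in> arcs (complete_nat_digraph n)" using S z by auto
            then have "T (y, z) \<in> arcs (complete_nat_digraph n)" using T by blast
            then show "Measurable.pred (weight_space n) (\<lambda>w. w (T (y, z)) \<le> d)"
              by (rule measurable_compose[OF measurable_weight]) simp
          qed
        qed (rule const)
      qed simp
    qed (rule const)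
    also have "(\<lambda>w. R \<subseteq> {..<n} - S \<and> (\<forall>z\<in>{..<n} - S. z \<in> R \<longleftrightarrow> (\<exists>y\<in>Y. w (T (y, z)) \<le> d))) =
        (\<lambda>w. light_nbrs n T d S Y w = R)"
    proof
      fix w
      define D where "D = {..<n} - S"
      show "(R \<subseteq> {..<n} - S \<and> (\<forall>z\<in>{..<n} - S. z \<in> R \<longleftrightarrow> (\<exists>y\<in>Y. w (T (y, z)) \<le> d))) =
          (light_nbrs n T d S Y w = R)"
        unfolding light_nbrs_def D_def[symmetric] by blast
    qed
    finally show ?thesis .
  qed
  have "Measurable.pred (weight_space n) (\<lambda>w. \<exists>R\<in>{R \<in> Pow {..<n}. Q R}. light_nbrs n T d S Y w = R)"
    by (rule pred_intros_finite(4)[OF _ single]) simp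
  also have "(\<lambda>w. \<exists>R\<in>{R \<in> Pow {..<n}. Q R}. light_nbrs n T d S Y w = R) = (\<lambda>w. Q (light_nbrs n T d S Y w))"
  proof
    fix w
    have "light_nbrs n T d S Y w \<in> Pow {..<n}"
      using light_nbrs_subset[of n T d S Y w] by blast
    then show "(\<exists>R\<in>{R \<in> Pow {..<n}. Q R}. light_nbrs n T d S Y w = R) = Q (light_nbrs n T d S Y w)"
      by simp
  qed
  finally show ?thesis .
qed

lemma pred_layers:
  assumes T: "T ` arcs (complete_nat_digraph n) \<subseteq> arcs (complete_nat_digraph n)" and "u < n"
  shows "Measurable.pred (weight_space n) (\<lambda>w. layers n T d u w i = R)"
proof (induction i arbitrary: R)
  case (Suc i)
  have "Measurable.pred (weight_space n)
    (\<lambda>w. \<exists>X\<in>Pow {..<n}. \<exists>Y\<in>Pow {..<n}. layers n T d u w i = (X, Y) \<and>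
       (X \<union> Y, light_nbrs n T (d i) (X \<union> Y) Y w) = R)"
  proof (intro pred_intros_finite(4))
    fix X Y assume "X \<in> Pow {..<n}" "Y \<in> Pow {..<n}"
    then have "Measurable.pred (weight_space n)
        (\<lambda>w. (X \<union> Y, light_nbrs n T (d i) (X \<union> Y) Y w) = R)"
      by (intro pred_light_nbrs[OF T, where Q = "\<lambda>Z. (X \<union> Y, Z) = R"]) auto
    then show "Measurable.pred (weight_space n) (\<lambda>w. layers n T d u w i = (X, Y) \<and>
        (X \<union> Y, light_nbrs n T (d i) (X \<union> Y) Y w) = R)"
      by (intro pred_intros_logic(3) Suc.IH)
  qed (rule finite_Pow_iff[THEN iffD2, OF finite_lessThan])+
  also have "(\<lambda>w. \<exists>X\<in>Pow {..<n}. \<exists>Y\<in>Pow {..<n}. layers n T d u w i = (X, Y) \<and>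
       (X \<union> Y, light_nbrs n T (d i) (X \<union> Y) Y w) = R) = (\<lambda>w. layers n T d u w (Suc i) = R)"
  proof
    fix w
    obtain X Y where *: "layers n T d u w i = (X, Y)" by fastforce
    have "X \<in> Pow {..<n}" "Y \<in> Pow {..<n}"
      using layers_subset[OF \<open>u < n\<close> *] by simp_all
    with * show "(\<exists>X\<in>Pow {..<n}. \<exists>Y\<in>Pow {..<n}. layers n T d u w i = (X, Y) \<and>
       (X \<union> Y, light_nbrs n T (d i) (X \<union> Y) Y w) = R) = (layers n T d u w (Suc i) = R)"
      by (simp add: Bex_def)
  qed
  finally show ?case .
qed simp

section \<open>Tail bound for one round of the exploration\<close>

text \<open>An exponential Markov inequality for the number of newly found vertices, with the
  conditioning written as a product: the indicator of \<open>layers n T d u w i = (X, Y)\<close> is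
  the \<open>h\<close> of \<open>UP.nn_integral_PiM_mult_blocks\<close>. The block of an
  undiscovered vertex \<open>z\<close> consists of the arcs joining \<open>Y\<close> and
  \<open>z\<close>, and \<open>z\<close> is missed with probability
  \<open>(1 - d i) ^ card Y\<close>.\<close>

lemma emeasure_small_layer_cond:
  assumes T: "T ` arcs (complete_nat_digraph n) \<subseteq> arcs (complete_nat_digraph n)"
      "inj_on T (arcs (complete_nat_digraph n))"
    and u: "u < n" and XY: "X \<subseteq> {..<n}" "Y \<subseteq> {..<n}" "X \<inter> Y = {}" and d: "0 \<le> d i" "d i \<le> 1"
  shows "emeasure (weight_space n) {w \<in> space (weight_space n). layers n T d u w i = (X, Y) \<and>
      real (card (light_nbrs n T (d i) (X \<union> Y) Y w)) < m}
    \<le> emeasure (weight_space n) {w \<in> space (weight_space n). layers n T d u w i = (X, Y)} *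
      ennreal (exp m * (exp (-1) + (1 - exp (-1)) * (1 - d i) ^ card Y) ^ card ({..<n} - (X \<union> Y)))"
proof -
  let ?A = "arcs (complete_nat_digraph n)" and ?M = "weight_space n"
  let ?Z = "{..<n} - (X \<union> Y)" and ?B = "\<lambda>z. (\<lambda>y. T (y, z)) ` Y"
  let ?L = "\<lambda>w. layers n T d u w i = (X, Y)"
  let ?h = "\<lambda>w. indicator {w. ?L w} w :: ennreal"
  have [measurable]: "Measurable.pred ?M ?L" by (rule pred_layers[OF T(1) u])
  have [measurable]: "Measurable.pred ?M (\<lambda>w. real (card (light_nbrs n T (d i) (X \<union> Y) Y w)) < m)"
    using XY by (intro pred_light_nbrs[OF T(1)]) auto
  have arc: "(y, z) \<in> ?A" if "y \<in> Y" "z \<in> ?Z" for y z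
    using that XY by auto
  have injy: "inj_on (\<lambda>y. T (y, z)) Y" if "z \<in> ?Z" for z
    using inj_onD[OF T(2)] arc[OF _ that] by (intro inj_onI) blast
  have h: "?h \<in> borel_measurable ?M" by measurable
  have "emeasure ?M {w \<in> space ?M. ?L w \<and> real (card (light_nbrs n T (d i) (X \<union> Y) Y w)) < m} =
    (\<integral>\<^sup>+w. indicator {w \<in> space ?M. ?L w \<and> real (card (light_nbrs n T (d i) (X \<union> Y) Y w)) < m} w \<partial>?M)"
    by (intro nn_integral_indicator[symmetric]) measurable
  also have "\<dots> \<le> (\<integral>\<^sup>+w. ennreal (exp m) *
      (?h w * ennreal (exp (-1) ^ card {z \<in> ?Z. \<exists>j\<in>?B z. w j \<le> d i})) \<partial>?M)"
  proof (intro nn_integral_mono)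
    fix w
    have eq: "{z \<in> ?Z. \<exists>j\<in>?B z. w j \<le> d i} = light_nbrs n T (d i) (X \<union> Y) Y w"
      by (auto simp: light_nbrs_def)
    have "1 \<le> ennreal (exp m) * ennreal (exp (-1) ^ k)" if "real k < m" for k
    proof -
      have "exp m * exp (-1) ^ k = exp (m - real k)"
        by (simp add: exp_diff exp_minus exp_of_nat_mult[symmetric] power_inverse field_simps)
      with that have "1 \<le> exp m * exp (-1) ^ k" by simp
      then show ?thesis by (subst ennreal_mult[symmetric]) auto
    qed
    then show "indicator {w \<in> space ?M. ?L w \<and> real (card (light_nbrs n T (d i) (X \<union> Y) Y w)) < m} w
      \<le> ennreal (exp m) * (?h w * ennreal (exp (-1) ^ card {z \<in> ?Z. \<exists>j\<in>?B z. w j \<le> d i}))"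
      unfolding eq by (auto simp: indicator_def)
  qed
  also have "\<dots> = ennreal (exp m) * (\<integral>\<^sup>+w. ?h w * ennreal (exp (-1) ^ card {z \<in> ?Z. \<exists>j\<in>?B z. w j \<le> d i}) \<partial>?M)"
  proof (rule nn_integral_cmult)
    have "Measurable.pred ?M (\<lambda>w. card (light_nbrs n T (d i) (X \<union> Y) Y w) = k)" for k
      using XY by (intro pred_light_nbrs[OF T(1)]) auto
    then have card: "{w \<in> space ?M. card (light_nbrs n T (d i) (X \<union> Y) Y w) = k} \<in> sets ?M" for k
      by (simp add: pred_def)
    have "(\<lambda>w. card (light_nbrs n T (d i) (X \<union> Y) Y w)) \<in> ?M \<rightarrow>\<^sub>M count_space UNIV"
      by (subst measurable_count_space_eq2_countable) (use card in \<open>auto simp: vimage_def Int_def conj_commute\<close>)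
    then have "(\<lambda>w. ennreal (exp (-1) ^ card (light_nbrs n T (d i) (X \<union> Y) Y w))) \<in> borel_measurable ?M"
      by (rule measurable_compose[where g = "\<lambda>k. ennreal (exp (-1) ^ k)"]) simp
    also have "(\<lambda>w. ennreal (exp (-1) ^ card (light_nbrs n T (d i) (X \<union> Y) Y w))) =
        (\<lambda>w. ennreal (exp (-1) ^ card {z \<in> ?Z. \<exists>j\<in>?B z. w j \<le> d i}))"
      by (intro ext arg_cong[where f = "\<lambda>S. ennreal (exp (-1) ^ card S)"]) (auto simp: light_nbrs_def)
    finally show "(\<lambda>w. ?h w * ennreal (exp (-1) ^ card {z \<in> ?Z. \<exists>j\<in>?B z. w j \<le> d i})) \<in> borel_measurable ?M"
      by (intro borel_measurable_times_ennreal h)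
  qed
  finally have le: "emeasure ?M {w \<in> space ?M. ?L w \<and> real (card (light_nbrs n T (d i) (X \<union> Y) Y w)) < m} \<le>
    ennreal (exp m) * (\<integral>\<^sup>+w. ?h w * ennreal (exp (-1) ^ card {z \<in> ?Z. \<exists>j\<in>?B z. w j \<le> d i}) \<partial>?M)" .
  have blocks: "(\<integral>\<^sup>+w. ?h w * ennreal (exp (-1) ^ card {z \<in> ?Z. \<exists>j\<in>?B z. w j \<le> d i}) \<partial>?M) =
      (\<integral>\<^sup>+w. ?h w \<partial>?M) * ennreal ((exp (-1) + (1 - exp (-1)) * (1 - d i) ^ card Y) ^ card ?Z)"
    unfolding weight_space_def
  proof (rule UP.nn_integral_PiM_mult_blocks[where P = "\<lambda>_ y. y \<le> d i" and A = ?A and Z = ?Z and B = ?B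
        and h = ?h and a = "exp (-1)" and q = "(1 - d i) ^ card Y"])
    show "finite ?A" by (rule K.finite_arcs)
    show "?B z \<subseteq> ?A" if "z \<in> ?Z" for z
      using T(1) arc[OF _ that] by blast
    show "disjoint_family_on ?B ?Z"
      unfolding disjoint_family_on_def
    proof (intro ballI impI equals0I)
      fix z z' j assume *: "z \<in> ?Z" "z' \<in> ?Z" "z \<noteq> z'" "j \<in> ?B z \<inter> ?B z'"
      then obtain y y' where "y \<in> Y" "y' \<in> Y" "j = T (y, z)" "j = T (y', z')" by auto
      then show False
        using inj_onD[OF T(2), of "(y, z)" "(y', z')"] arc *(1-3) by (metis prod.inject)
    qed
    show "?h \<in> borel_measurable (Pi\<^sub>M ?A (\<lambda>_. uniform01))"
      using h by (simp add: weight_space_def)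
    \<comment> \<open>A queried arc starts in \<open>Y\<close>, hence outside \<open>X\<close>, so
      it was not read when the layers up to \<open>Y\<close> were formed.\<close>
    show "?h (w(j := y)) = ?h w" if j: "j \<in> (\<Union>z\<in>?Z. ?B z)" for j w y
    proof -
      obtain y0 z where *: "y0 \<in> Y" "z \<in> ?Z" "j = T (y0, z)" using j by blast
      then have "y0 \<notin> X" "(y0, z) \<in> ?A" using XY arc by blast+
      from layers_update_iff[OF T(2) u this] show ?thesis
        unfolding *(3) indicator_def mem_Collect_eq by (simp only:)
    qed
    show "(\<Prod>j\<in>?B z. \<P>(y in uniform01. \<not> y \<le> d i)) = (1 - d i) ^ card Y" if z: "z \<in> ?Z" for z
      unfolding prob_uniform01_greater[OF d] by (simp add: card_image[OF injy[OF z]])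
    show "Measurable.pred uniform01 (\<lambda>y. y \<le> d i)" by (simp add: pred_def)
  qed (simp_all only: exp_ge_zero exp_le_one_iff finite_Diff finite_lessThan neg_le_0_iff_le zero_le_one)
  have "(\<integral>\<^sup>+w. ?h w \<partial>?M) = (\<integral>\<^sup>+w. indicator {w \<in> space ?M. ?L w} w \<partial>?M)"
    by (intro nn_integral_cong) (auto simp: indicator_def)
  also have "\<dots> = emeasure ?M {w \<in> space ?M. ?L w}"
    by (intro nn_integral_indicator) measurable
  finally have h_eq: "(\<integral>\<^sup>+w. ?h w \<partial>?M) = emeasure ?M {w \<in> space ?M. ?L w}" .
  have "ennreal (exp m * (exp (-1) + (1 - exp (-1)) * (1 - d i) ^ card Y) ^ card ?Z) =
      ennreal (exp m) * ennreal ((exp (-1) + (1 - exp (-1)) * (1 - d i) ^ card Y) ^ card ?Z)"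
    using d by (intro ennreal_mult zero_le_power add_nonneg_nonneg mult_nonneg_nonneg) auto
  with le show ?thesis
    unfolding blocks h_eq by (simp only: mult.left_commute)
qed

text \<open>Total probability: the possible values of the layers give finitely many disjoint events
  of total mass at most 1, so a conditional bound \<open>\<epsilon>\<close> that is uniform over the
  pairs satisfying \<open>C\<close> survives the summation. The required size \<open>m\<close> may
  vary with the pair.\<close>

lemma emeasure_small_layer:
  assumes T: "T ` arcs (complete_nat_digraph n) \<subseteq> arcs (complete_nat_digraph n)"
      "inj_on T (arcs (complete_nat_digraph n))"
    and u: "u < n" and d: "0 \<le> d i" "d i \<le> 1"
    and eps: "\<And>X Y. X \<subseteq> {..<n} \<Longrightarrow> Y \<subseteq> {..<n} \<Longrightarrow> X \<inter> Y = {} \<Longrightarrow> C X Y \<Longrightarrow>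
      exp (m X Y) * (exp (-1) + (1 - exp (-1)) * (1 - d i) ^ card Y) ^ card ({..<n} - (X \<union> Y)) \<le> \<epsilon>"
  shows "{w \<in> space (weight_space n). \<exists>X Y. layers n T d u w i = (X, Y) \<and> C X Y \<and>
      real (card (light_nbrs n T (d i) (X \<union> Y) Y w)) < m X Y} \<in> sets (weight_space n)" (is "?bad \<in> _")
    and "emeasure (weight_space n) {w \<in> space (weight_space n). \<exists>X Y. layers n T d u w i = (X, Y) \<and> C X Y \<and>
      real (card (light_nbrs n T (d i) (X \<union> Y) Y w)) < m X Y} \<le> ennreal \<epsilon>"
proof -
  let ?M = "weight_space n"
  define \<S> where "\<S> = {(X, Y). X \<subseteq> {..<n} \<and> Y \<subseteq> {..<n} \<and> X \<inter> Y = {} \<and> C X Y}"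
  have fin: "finite \<S>"
    by (rule finite_subset[of _ "Pow {..<n} \<times> Pow {..<n}"]) (auto simp: \<S>_def)
  define E where "E = (\<lambda>(X, Y). {w \<in> space ?M. layers n T d u w i = (X, Y) \<and>
      real (card (light_nbrs n T (d i) (X \<union> Y) Y w)) < m X Y})"
  define H where "H = (\<lambda>R. {w \<in> space ?M. layers n T d u w i = R})"
  have H: "H R \<in> sets ?M" for R
    unfolding H_def using pred_layers[OF T(1) u] by (simp add: pred_def)
  have E: "E R \<in> sets ?M" if R: "R \<in> \<S>" for R
  proof -
    obtain X Y where XY: "R = (X, Y)" "X \<subseteq> {..<n}" "Y \<subseteq> {..<n}" using R by (auto simp: \<S>_def)
    have [measurable]: "Measurable.pred ?M (\<lambda>w. layers n T d u w i = (X, Y))"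
      by (rule pred_layers[OF T(1) u])
    have [measurable]: "Measurable.pred ?M (\<lambda>w. real (card (light_nbrs n T (d i) (X \<union> Y) Y w)) < m X Y)"
      using XY by (intro pred_light_nbrs[OF T(1)]) auto
    show ?thesis unfolding E_def XY(1) prod.case by measurable
  qed
  have eq: "?bad = (\<Union>R\<in>\<S>. E R)"
    using layers_subset[OF u] by (fastforce simp: E_def \<S>_def)
  show "?bad \<in> sets ?M"
    unfolding eq using fin E by auto
  have "emeasure ?M ?bad \<le> (\<Sum>R\<in>\<S>. emeasure ?M (E R))"
    unfolding eq using fin E by (intro emeasure_subadditive_finite) auto
  also have "\<dots> \<le> (\<Sum>R\<in>\<S>. emeasure ?M (H R) * ennreal \<epsilon>)"
  proof (intro sum_mono)
    fix R assume R: "R \<in> \<S>"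
    then obtain X Y where XY: "R = (X, Y)" "X \<subseteq> {..<n}" "Y \<subseteq> {..<n}" "X \<inter> Y = {}" "C X Y"
      by (auto simp: \<S>_def)
    have "emeasure ?M (E R) \<le> emeasure ?M (H R) *
        ennreal (exp (m X Y) * (exp (-1) + (1 - exp (-1)) * (1 - d i) ^ card Y) ^ card ({..<n} - (X \<union> Y)))"
      unfolding E_def H_def XY(1) prod.case
      by (rule emeasure_small_layer_cond[where m = "m X Y", OF T u XY(2-4), of d i, OF d])
    also have "\<dots> \<le> emeasure ?M (H R) * ennreal \<epsilon>"
      using eps[OF XY(2-5)] by (intro mult_left_mono ennreal_leI) auto
    finally show "emeasure ?M (E R) \<le> emeasure ?M (H R) * ennreal \<epsilon>" .
  qed
  also have "\<dots> = (\<Sum>R\<in>\<S>. emeasure ?M (H R)) * ennreal \<epsilon>"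
    by (rule sum_distrib_right[symmetric])
  also have "(\<Sum>R\<in>\<S>. emeasure ?M (H R)) = emeasure ?M (\<Union>R\<in>\<S>. H R)"
    using fin H by (intro sum_emeasure) (auto simp: disjoint_family_on_def H_def)
  also have "\<dots> * ennreal \<epsilon> \<le> 1 * ennreal \<epsilon>"
    by (intro mult_right_mono W.emeasure_le_1) auto
  finally show "emeasure ?M ?bad \<le> ennreal \<epsilon>" by simp
qed

section \<open>Doubling of the layers\<close>

text \<open>A single vertex has about 200 arcs of weight at most \<open>200 / real n\<close>, and
  falls short of that with probability bounded away from 0 polynomially. The first round is
  therefore allowed weights larger by a logarithmic factor and finds about
  \<open>800 * ln (real n)\<close> vertices, of which \<open>growth_target\<close> asks for a
  quarter.\<close>

definition threshold :: "nat \<Rightarrow> nat \<Rightarrow> real" where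
  "threshold n i = (if i = 0 then 800 * ln (real n) / real n else 200 / real n)"

text \<open>
  If a round adds \<open>(n - card (X \<union> Y)) / 2\<close> vertices to the nonempty set \<open>X \<union> Y\<close>, then more than half
  of the vertices have been found.
\<close>

definition growth_target :: "nat \<Rightarrow> nat \<Rightarrow> nat set \<Rightarrow> nat set \<Rightarrow> real" where
  "growth_target n i X Y = (if i = 0 then 200 * ln (real n)
     else min (2 * real (card Y)) ((real n - real (card (X \<union> Y))) / 2))"

definition growing :: "nat \<Rightarrow> nat \<Rightarrow> nat set \<Rightarrow> nat set \<Rightarrow> bool" where
  "growing n i X Y \<longleftrightarrow> (if i = 0 then X = {} \<and> card Y = 1
     else 200 * ln (real n) \<le> real (card Y) \<and> 2 * card (X \<union> Y) \<le> n)"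

text \<open>A round counts as stalled only if it starts from a state that satisfies
  \<open>growing\<close>. Each such event is bounded by conditioning on that state alone, and the
  first failure of an exploration lies in one of them.\<close>

definition stalled :: "nat \<Rightarrow> (nat \<times> nat \<Rightarrow> nat \<times> nat) \<Rightarrow> nat \<Rightarrow> nat \<Rightarrow> (nat \<times> nat \<Rightarrow> real) set" where
  "stalled n T u i = {w \<in> space (weight_space n). \<exists>X Y. layers n T (threshold n) u w i = (X, Y) \<and>
     growing n i X Y \<and>
     real (card (light_nbrs n T (threshold n i) (X \<union> Y) Y w)) < growth_target n i X Y}"

text \<open>With \<open>x = real s * d\<close>, a vertex is reached with probability at least
  \<open>1 - exp (- x)\<close>, which is at least \<open>x / (1 + x)\<close>. Moreover
  \<open>1 - exp (-1)\<close> is at least 0.6, and \<open>1 - y <= exp (- y)\<close> finishes. The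
  rational function keeps the later case distinction elementary.\<close>

lemma growth_base_le:
  fixes d :: real
  assumes d: "0 \<le> d" "d \<le> 1"
  shows "exp (-1) + (1 - exp (-1)) * (1 - d) ^ s \<le> exp (- (0.6 * (real s * d / (1 + real s * d))))"
proof -
  have e: "exp (-1 :: real) \<le> 0.4"
  proof -
    have "exp (1 :: real) \<ge> 2.5"
    proof -
      have "(1 + 1 / 8 :: real) ^ 8 \<le> exp (1 / 8) ^ 8"
        using exp_ge_add_one_self[of "1 / 8 :: real"] by (intro power_mono) auto
      also have "\<dots> = exp (1 :: real)"
        by (simp add: exp_of_nat_mult[symmetric])
      finally show ?thesis by (simp add: eval_nat_numeral)
    qed
    then show ?thesis by (simp add: exp_minus field_simps)
  qed
  define x where "x = real s * d"
  have x: "0 \<le> x" using d by (simp add: x_def)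
  have "(1 - d) ^ s \<le> exp (- d) ^ s"
    using d exp_ge_add_one_self[of "- d"] by (intro power_mono) auto
  also have "\<dots> = inverse (exp x)"
    by (simp add: x_def exp_of_nat_mult[symmetric] exp_minus[symmetric])
  also have "\<dots> \<le> inverse (1 + x)"
    using exp_ge_add_one_self[of x] x by (intro le_imp_inverse_le) auto
  finally have "(1 - d) ^ s \<le> inverse (1 + x)" .
  also have "inverse (1 + x) = 1 - x / (1 + x)"
    using x by (simp add: field_simps)
  finally have q: "x / (1 + x) \<le> 1 - (1 - d) ^ s" by simp
  have "0.6 * (x / (1 + x)) \<le> (1 - exp (-1)) * (1 - (1 - d) ^ s)"
    using e x q by (intro mult_mono) auto
  then have "exp (-1) + (1 - exp (-1)) * (1 - d) ^ s \<le> 1 + - (0.6 * (x / (1 + x)))"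
    by (simp add: algebra_simps)
  also have "\<dots> \<le> exp (- (0.6 * (x / (1 + x))))"
    by (rule exp_ge_add_one_self)
  finally show ?thesis by (simp add: x_def)
qed

text \<open>The exponent, the growth target minus \<open>0.6 * N * x / (1 + x)\<close>, has to fall
  below \<open>- 8 * ln (real n)\<close>; here \<open>N\<close> vertices are undiscovered and
  \<open>x\<close> is the expected number of light arcs joining the last layer to one of them. The
  power 8 leaves room for a union bound over directions, start vertices and rounds.\<close>

lemma emeasure_stalled:
  assumes n: "n \<ge> 3" "800 * ln (real n) \<le> real n" and u: "u < n"
    and T: "T ` arcs (complete_nat_digraph n) \<subseteq> arcs (complete_nat_digraph n)"
      "inj_on T (arcs (complete_nat_digraph n))"
  shows "stalled n T u i \<in> sets (weight_space n)"
    and "emeasure (weight_space n) (stalled n T u i) \<le> ennreal ((1 / real n) ^ 8)"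
proof -
  have "exp (1::real) \<le> real n"
    using exp_le n(1) by linarith
  then have ln1: "1 \<le> ln (real n)"
    using n(1) by (subst ln_ge_iff) auto
  have n800: "800 \<le> real n" using ln1 n(2) by linarith
  have thr: "0 \<le> threshold n i" "threshold n i \<le> 1"
    using n(2) ln1 n800 by (auto simp: threshold_def)
  have pow: "(1 / real n) ^ 8 = exp (- 8 * ln (real n))"
    using n(1) exp_of_nat_mult[of 8 "- ln (real n)"] by (simp add: exp_minus field_simps)
  have bound: "exp (growth_target n i X Y) *
      (exp (-1) + (1 - exp (-1)) * (1 - threshold n i) ^ card Y) ^ card ({..<n} - (X \<union> Y))
    \<le> (1 / real n) ^ 8"
    if XY: "X \<subseteq> {..<n}" "Y \<subseteq> {..<n}" "X \<inter> Y = {}" and g: "growing n i X Y" for X Y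
  proof -
    define s where "s = real (card Y)"
    define x where "x = s * threshold n i"
    define N where "N = card ({..<n} - (X \<union> Y))"
    have x: "0 \<le> x" using thr by (simp add: x_def s_def)
    have fin: "finite X" "finite Y" using XY finite_subset[OF _ finite_lessThan] by auto
    have sub: "X \<union> Y \<subseteq> {..<n}" using XY by auto
    have cXY: "card (X \<union> Y) \<le> n" using card_mono[OF _ sub] by simp
    have N: "real N = real n - real (card (X \<union> Y))"
      unfolding N_def using sub fin cXY by (simp add: card_Diff_subset of_nat_diff)
    have key: "growth_target n i X Y - real N * (0.6 * (x / (1 + x))) \<le> - 8 * ln (real n)"
    proof (cases "i = 0")
      case True
      with g have "X = {}" "card Y = 1" by (auto simp: growing_def)
      with True have x_eq: "x = 800 * ln (real n) / real n" and N_eq: "real N = real n - 1"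
        using N by (auto simp: x_def s_def threshold_def)
      \<comment> \<open>In the first round \<open>x / (1 + x)\<close> is at least
        \<open>x / 2\<close>, and 240 * 9 / 10 = 216 exceeds 200 + 8.\<close>
      have "x \<le> 1" using n(2) n800 by (simp add: x_eq)
      then have "x / 2 \<le> x / (1 + x)" using x by (intro divide_left_mono) auto
      then have "real N * (0.6 * (x / 2)) \<le> real N * (0.6 * (x / (1 + x)))"
        by (intro mult_left_mono) auto
      moreover have "real N * (0.6 * (x / 2)) = 240 * ln (real n) * ((real n - 1) / real n)"
        using n800 by (simp add: N_eq x_eq field_simps)
      moreover have "240 * ln (real n) * ((real n - 1) / real n) \<ge> 240 * ln (real n) * (9 / 10)"
        using n800 ln1 by (intro mult_left_mono) (auto simp: field_simps)
      moreover have "growth_target n i X Y = 200 * ln (real n)"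
        using True by (simp add: growth_target_def)
      ultimately show ?thesis
        using ln1 by linarith
    next
      case False
      with g have s: "200 * ln (real n) \<le> s" and c: "2 * real (card (X \<union> Y)) \<le> real n"
        by (auto simp: growing_def s_def)
      have s_le: "s \<le> real (card (X \<union> Y))"
        unfolding s_def using fin by (intro of_nat_mono card_mono) auto
      have x_eq: "x = 200 * s / real n" using False by (simp add: x_def threshold_def)
      have target: "growth_target n i X Y = min (2 * s) (real N / 2)"
        using False N by (simp add: growth_target_def s_def)
      have t: "growth_target n i X Y \<le> 2 * s" "growth_target n i X Y \<le> real N / 2"
        unfolding target by (rule min.cobounded1 min.cobounded2)+
      \<comment> \<open>As \<open>s\<close> is at least \<open>200 * ln (real n)\<close>, the factor
        1 / 25 yields the 8. For \<open>x\<close> up to 9 the subtracted term is at least 6 s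
        against a target of at most 2 s. For larger \<open>x\<close> it is at least 0.54 N against N
        / 2, and the surplus 0.04 N is at least 0.04 s, since at most half of the vertices are
        discovered.\<close>
      have "growth_target n i X Y - real N * (0.6 * (x / (1 + x))) \<le> - (1 / 25 * s)"
      proof (cases "x \<le> 9")
        case True
        then have "x / 10 \<le> x / (1 + x)" using x by (intro divide_left_mono) auto
        then have "real N * (0.6 * (x / 10)) \<le> real N * (0.6 * (x / (1 + x)))"
          by (intro mult_left_mono) auto
        moreover have "(real n / 2) * (0.6 * (x / 10)) \<le> real N * (0.6 * (x / 10))"
          using x N c by (intro mult_right_mono) auto
        moreover have "(real n / 2) * (0.6 * (x / 10)) = 6 * s"
          using n800 by (simp add: x_eq)
        ultimately have "6 * s \<le> real N * (0.6 * (x / (1 + x)))"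
          by (metis order_trans)
        moreover have "0 \<le> s" by (simp add: s_def)
        moreover have "a - b \<le> - (1 / 25 * s)" if "6 * s \<le> b" "0 \<le> s" "a \<le> 2 * s" for a b
          using that by linarith
        ultimately show ?thesis using t(1) by blast
      next
        case False
        then have "9 / 10 \<le> x / (1 + x)" by (simp add: field_simps)
        then have "real N * (0.6 * (9 / 10)) \<le> real N * (0.6 * (x / (1 + x)))"
          by (intro mult_left_mono) auto
        then show ?thesis using t(2) s_le c N by simp
      qed
      with s show ?thesis by simp
    qed
    have "exp (growth_target n i X Y) *
        (exp (-1) + (1 - exp (-1)) * (1 - threshold n i) ^ card Y) ^ N
      \<le> exp (growth_target n i X Y) * exp (- (0.6 * (x / (1 + x)))) ^ N"
      using growth_base_le[OF thr, of "card Y"] thr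
      by (intro mult_left_mono power_mono add_nonneg_nonneg mult_nonneg_nonneg)
        (auto simp: x_def s_def)
    also have "\<dots> = exp (growth_target n i X Y - real N * (0.6 * (x / (1 + x))))"
      by (simp add: exp_of_nat_mult[symmetric] exp_add[symmetric])
    also have "\<dots> \<le> (1 / real n) ^ 8"
      unfolding pow using key by simp
    finally show ?thesis by (simp add: N_def)
  qed
  show "stalled n T u i \<in> sets (weight_space n)"
    unfolding stalled_def
    by (rule emeasure_small_layer(1)[where C = "growing n i" and m = "growth_target n i" and d = "threshold n" and i = i, OF T u thr bound])
  show "emeasure (weight_space n) (stalled n T u i) \<le> ennreal ((1 / real n) ^ 8)"
    unfolding stalled_def
    by (rule emeasure_small_layer(2)[where C = "growing n i" and m = "growth_target n i" and d = "threshold n" and i = i, OF T u thr bound])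
qed

text \<open>If no stage passed half, every round would start in a \<open>growing\<close> state
  without stalling. The second alternative in the minimum of \<open>growth_target\<close> leads past
  half, so each layer would have to double, until it had more than \<open>n\<close>
  vertices.\<close>

lemma layers_exceed_half:
  assumes n: "n \<ge> 3" and u: "u < n" and w: "w \<in> space (weight_space n)"
    and M: "n < 2 ^ M" and ok: "\<And>i. i \<le> M \<Longrightarrow> w \<notin> stalled n T u i"
  shows "\<exists>i\<le>Suc M. \<exists>X Y. layers n T (threshold n) u w i = (X, Y) \<and> n < 2 * card (X \<union> Y)"
proof (rule ccontr)
  assume not: "\<not> ?thesis"
  have small: "2 * card (X \<union> Y) \<le> n"
    if l: "i \<le> Suc M" "layers n T (threshold n) u w i = (X, Y)" for i X Y
  proof (rule ccontr)
    assume "\<not> 2 * card (X \<union> Y) \<le> n"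
    with l have "\<exists>X Y. layers n T (threshold n) u w i = (X, Y) \<and> n < 2 * card (X \<union> Y)"
      by (intro exI[of _ X] exI[of _ Y]) simp
    with l(1) not show False by blast
  qed
  \<comment> \<open>Round \<open>i\<close> produces layer \<open>Suc i\<close>. Round 0 is only
    known to yield a nonempty layer as far as powers of two are concerned, hence the exponent
    \<open>i\<close>.\<close>
  have "2 ^ i \<le> card Y \<and> 200 * ln (real n) \<le> real (card Y)"
    if "i \<le> M" "layers n T (threshold n) u w (Suc i) = (X, Y)" for i X Y
    using that
  proof (induction i arbitrary: X Y)
    case 0
    then have XY: "X = {u}" and Y: "Y = light_nbrs n T (threshold n 0) ({} \<union> {u}) {u} w" by auto
    have "\<not> real (card Y) < 200 * ln (real n)"
    proof
      assume "real (card Y) < 200 * ln (real n)"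
      then have "layers n T (threshold n) u w 0 = ({}, {u}) \<and> growing n 0 {} {u} \<and>
          real (card (light_nbrs n T (threshold n 0) ({} \<union> {u}) {u} w)) < growth_target n 0 {} {u}"
        unfolding Y[symmetric] by (simp add: growing_def growth_target_def)
      with w have "w \<in> stalled n T u 0"
        unfolding stalled_def mem_Collect_eq by blast
      with ok[OF 0(1)] show False by blast
    qed
    moreover have "0 < ln (real n)" using n by simp
    ultimately have "0 < real (card Y)" by linarith
    with \<open>\<not> real (card Y) < _\<close> show ?case by simp
  next
    case (Suc i)
    obtain X' Y' where *: "layers n T (threshold n) u w (Suc i) = (X', Y')" by fastforce
    have "(X' \<union> Y', light_nbrs n T (threshold n (Suc i)) (X' \<union> Y') Y' w) = (X, Y)"
      using Suc.prems(2) unfolding layers.simps(2)[of n T _ u w "Suc i"] * by auto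
    then have XY: "X = X' \<union> Y'" "Y = light_nbrs n T (threshold n (Suc i)) (X' \<union> Y') Y' w"
      by auto
    have IH: "2 ^ i \<le> card Y'" "200 * ln (real n) \<le> real (card Y')"
      using Suc.IH[OF _ *] Suc.prems by auto
    have half: "2 * card (X' \<union> Y') \<le> n"
      using small[OF _ *] Suc.prems by simp
    have "growth_target n (Suc i) X' Y' \<le> real (card Y)"
    proof (rule ccontr)
      assume "\<not> growth_target n (Suc i) X' Y' \<le> real (card Y)"
      then have "real (card Y) < growth_target n (Suc i) X' Y'" by simp
      moreover have "growing n (Suc i) X' Y'" using IH(2) half by (simp add: growing_def)
      ultimately have "w \<in> stalled n T u (Suc i)"
        unfolding stalled_def XY mem_Collect_eq using w * by blast
      with ok[OF Suc.prems(1)] show False by blast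
    qed
    then have "2 * real (card Y') \<le> real (card Y) \<or> (real n - real (card (X' \<union> Y'))) / 2 \<le> real (card Y)"
      by (simp only: growth_target_def nat.simps if_False min_le_iff_disj)
    then consider "2 * card Y' \<le> card Y" | "real n - real (card (X' \<union> Y')) \<le> 2 * real (card Y)"
      by fastforce
    then show ?case
    proof cases
      case 1
      with IH show ?thesis by auto
    next
      case 2
      have sub: "X' \<subseteq> {..<n}" "Y' \<subseteq> {..<n}" using layers_subset[OF u *] by auto
      have finXY: "finite (X' \<union> Y')"
        using finite_subset[OF sub(1)] finite_subset[OF sub(2)] by simp
      have disj: "(X' \<union> Y') \<inter> Y = {}" and finY: "finite Y"
        unfolding XY by (auto simp: light_nbrs_def)
      have "card (X \<union> Y) = card (X' \<union> Y') + card Y"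
        unfolding XY(1) by (rule card_Un_disjoint[OF finXY finY disj])
      moreover have "2 * card (X \<union> Y) \<le> n"
        using small[OF _ Suc.prems(2)] Suc.prems(1) by simp
      moreover have "0 < card (X' \<union> Y')"
      proof -
        have "0 < (2::nat) ^ i" by simp
        also have "\<dots> \<le> card Y'" by (rule IH(1))
        also have "card Y' \<le> card (X' \<union> Y')" using finXY by (intro card_mono) auto
        finally show ?thesis .
      qed
      ultimately show ?thesis using 2 by linarith
    qed
  qed
  moreover obtain X Y where XY: "layers n T (threshold n) u w (Suc M) = (X, Y)" by fastforce
  ultimately have "2 ^ M \<le> card Y" by blast
  also have "card Y \<le> card {..<n}"
    using layers_subset[OF u XY] by (intro card_mono) auto
  finally show False using M by simp
qed

section \<open>From explored layers to distances\<close>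

text \<open>Walks instead of paths, because the two halves of a connection may share vertices. The
  distance \<open>\<mu>\<close> bounds the cost of every walk from below, which leads back to
  shortest paths.\<close>

definition dist_le :: "nat \<Rightarrow> (nat \<times> nat \<Rightarrow> real) \<Rightarrow> real \<Rightarrow> nat \<Rightarrow> nat \<Rightarrow> bool" where
  "dist_le n w r u v \<longleftrightarrow> (\<exists>p. K.awalk n u p v \<and> K.awalk_cost w p \<le> r)"

lemma dist_le_trans: "dist_le n w r u v \<Longrightarrow> dist_le n w s v z \<Longrightarrow> dist_le n w (r + s) u z"
proof -
  assume "dist_le n w r u v" "dist_le n w s v z"
  then obtain p q where "K.awalk n u p v" "K.awalk_cost w p \<le> r" "K.awalk n v q z" "K.awalk_cost w q \<le> s"
    unfolding dist_le_def by blast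
  then have "K.awalk n u (p @ q) z \<and> K.awalk_cost w (p @ q) \<le> r + s"
    by (simp add: K.awalk_appendI add_mono del: K.awalk_append_iff)
  then show ?thesis unfolding dist_le_def by blast
qed

lemma dist_le_arc: "(u, v) \<in> arcs (complete_nat_digraph n) \<Longrightarrow> dist_le n w (w (u, v)) u v"
  unfolding dist_le_def by (intro exI[of _ "[(u, v)]"]) (auto simp: K.awalk_simps)

lemma dist_le_mono: "dist_le n w r u v \<Longrightarrow> r \<le> s \<Longrightarrow> dist_le n w s u v"
  unfolding dist_le_def by force

lemma threshold_nonneg: "0 \<le> threshold n i"
  by (cases "n = 0") (auto simp: threshold_def)

lemma layers_dist_le:
  assumes u: "u < n" and T: "T = id \<or> T = prod.swap"
    and "layers n T (threshold n) u w i = (X, Y)" "z \<in> X \<union> Y"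
  shows "if T = id then dist_le n w (\<Sum>j<i. threshold n j) u z else dist_le n w (\<Sum>j<i. threshold n j) z u"
  using assms(3,4)
proof (induction i arbitrary: X Y z)
  case 0
  then have "z = u" by auto
  then show ?case using u by (auto simp: dist_le_def K.awalk_simps intro!: exI[of _ "[]"])
next
  case (Suc i)
  obtain X' Y' where *: "layers n T (threshold n) u w i = (X', Y')" by fastforce
  with Suc.prems have XY: "X = X' \<union> Y'" "Y = light_nbrs n T (threshold n i) (X' \<union> Y') Y' w"
    by auto
  show ?case
  proof (cases "z \<in> X' \<union> Y'")
    case True
    have le: "(\<Sum>j<i. threshold n j) \<le> (\<Sum>j<Suc i. threshold n j)"
      using threshold_nonneg[of n i] by simp
    show ?thesis
      using Suc.IH[OF * True] dist_le_mono[OF _ le, of n w] by (auto split: if_split_asm)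
  next
    case False
    with Suc.prems XY have "z \<in> light_nbrs n T (threshold n i) (X' \<union> Y') Y' w" by auto
    then obtain y where y: "y \<in> Y'" "w (T (y, z)) \<le> threshold n i" "z < n"
      by (auto simp: light_nbrs_def)
    have yz: "y < n" "y \<noteq> z" using layers_subset[OF u *] y False by auto
    have "y \<in> X' \<union> Y'" using y by simp
    note IH = Suc.IH[OF * this]
    show ?thesis
    proof (cases "T = id")
      case True
      have "w (y, z) \<le> threshold n i" using y(2) True by simp
      moreover have "dist_le n w (w (y, z)) y z"
        using y yz by (intro dist_le_arc) simp
      ultimately have "dist_le n w (threshold n i) y z"
        using dist_le_mono by blast
      moreover have "dist_le n w (\<Sum>j<i. threshold n j) u y" using IH True by presburger
      ultimately have "dist_le n w (\<Sum>j<Suc i. threshold n j) u z"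
        using dist_le_trans by simp
      with True show ?thesis by presburger
    next
      case False
      with T have "w (z, y) \<le> threshold n i" using y(2) by auto
      moreover have "dist_le n w (w (z, y)) z y"
        using y yz by (intro dist_le_arc) simp
      ultimately have "dist_le n w (threshold n i) z y"
        using dist_le_mono by blast
      moreover have "dist_le n w (\<Sum>j<i. threshold n j) y u" using IH False by presburger
      ultimately have "dist_le n w (threshold n i + (\<Sum>j<i. threshold n j)) z u"
        by (rule dist_le_trans)
      then have "dist_le n w (\<Sum>j<Suc i. threshold n j) z u"
        by (simp add: add.commute)
      with False show ?thesis by presburger
    qed
  qed
qed

text \<open>Given by stalled explorations, for which measurability and a union bound are at hand; it
  contains the weights under which two vertices are further apart than
  \<open>4000 * ln (real n) / real n\<close>, once \<open>n\<close> is large.\<close>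

definition far_apart :: "nat \<Rightarrow> (nat \<times> nat \<Rightarrow> real) set" where
  "far_apart n = (\<Union>T\<in>{id, prod.swap}. \<Union>u\<in>{..<n}. \<Union>i\<in>{..nat \<lceil>2 * ln (real n)\<rceil>}. stalled n T u i)"

text \<open>More than half of the vertices are reached forwards from \<open>u\<close> and more than
  half backwards from \<open>v\<close>, so the two sets share a vertex, whatever the dependence
  between the explorations. Each side costs at most
  \<open>(800 * ln (real n) + 200 * real M) / real n\<close>, generously rounded to half of the
  claimed bound.\<close>

lemma dist_le_if_not_far_apart:
  assumes n: "n \<ge> 3" "800 * ln (real n) \<le> real n" and uv: "u < n" "v < n"
    and w: "w \<in> space (weight_space n)" "w \<notin> far_apart n"
  shows "dist_le n w (4000 * ln (real n) / real n) u v"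
proof -
  define M where "M = nat \<lceil>2 * ln (real n)\<rceil>"
  have "exp (1::real) \<le> real n"
    using exp_le n(1) by linarith
  then have ln1: "1 \<le> ln (real n)"
    using n(1) by (subst ln_ge_iff) auto
  have M: "2 * ln (real n) \<le> real M" "real M \<le> 2 * ln (real n) + 1"
    unfolding M_def using ln1 by linarith+
  \<comment> \<open>By \<open>ln 2 >= 2 / 3\<close> the product \<open>2 * ln 2\<close> exceeds 1,
    so \<open>M\<close> doublings pass \<open>n\<close>.\<close>
  have "ln (real n) < real M * ln 2"
  proof -
    have "ln (real n) < 2 * ln (real n) * (2 / 3)" using ln1 by simp
    also have "\<dots> \<le> real M * ln 2"
      using M ln1 ln2_ge_two_thirds by (intro mult_mono) auto
    finally show ?thesis .
  qed
  also have "real M * ln 2 = ln (2 ^ M)" by (simp add: ln_realpow)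
  finally have "real n < 2 ^ M" using n(1) by (subst (asm) ln_less_cancel_iff) auto
  then have pow: "n < 2 ^ M" by (metis of_nat_less_iff of_nat_numeral of_nat_power)
  have sum: "(\<Sum>j<i. threshold n j) \<le> 2000 * ln (real n) / real n" if "i \<le> Suc M" for i
  proof -
    have "(\<Sum>j<i. threshold n j) \<le> (\<Sum>j<Suc M. threshold n j)"
      using that threshold_nonneg by (intro sum_mono2) auto
    also have "\<dots> = threshold n 0 + (\<Sum>j<M. threshold n (Suc j))"
      by (rule sum.lessThan_Suc_shift)
    also have "\<dots> = (800 * ln (real n) + 200 * real M) / real n"
      by (simp add: threshold_def add_divide_distrib)
    also have "\<dots> \<le> 2000 * ln (real n) / real n"
      using M ln1 by (intro divide_right_mono) auto
    finally show ?thesis .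
  qed
  have out: "w \<notin> stalled n T z i" if "T = id \<or> T = prod.swap" "z < n" "i \<le> M" for T z i
    using w(2) that by (auto simp: far_apart_def M_def)
  obtain i X Y where 1: "i \<le> Suc M" "layers n id (threshold n) u w i = (X, Y)" "n < 2 * card (X \<union> Y)"
    using layers_exceed_half[OF n(1) uv(1) w(1) pow out[OF disjI1[OF refl] uv(1)]] by blast
  obtain j X' Y' where 2: "j \<le> Suc M" "layers n prod.swap (threshold n) v w j = (X', Y')" "n < 2 * card (X' \<union> Y')"
    using layers_exceed_half[OF n(1) uv(2) w(1) pow out[OF disjI2[OF refl] uv(2)]] by blast
  have sub: "X \<union> Y \<subseteq> {..<n}" "X' \<union> Y' \<subseteq> {..<n}"
    using layers_subset[OF uv(1) 1(2)] layers_subset[OF uv(2) 2(2)] by auto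
  have "(X \<union> Y) \<inter> (X' \<union> Y') \<noteq> {}"
  proof
    assume disj: "(X \<union> Y) \<inter> (X' \<union> Y') = {}"
    have "card (X \<union> Y) + card (X' \<union> Y') = card ((X \<union> Y) \<union> (X' \<union> Y'))"
      using finite_subset[OF sub(1)] finite_subset[OF sub(2)] disj
      by (intro card_Un_disjoint[symmetric]) auto
    also have "\<dots> \<le> card {..<n}" using sub by (intro card_mono) auto
    finally show False using 1(3) 2(3) by simp
  qed
  then obtain z where z: "z \<in> X \<union> Y" "z \<in> X' \<union> Y'" by blast
  have neq: "prod.swap \<noteq> (id :: nat \<times> nat \<Rightarrow> nat \<times> nat)"
    proof
    assume "prod.swap = (id :: nat \<times> nat \<Rightarrow> nat \<times> nat)"
    from fun_cong[OF this, of "(0, 1)"] show False by simp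
  qed
  have "dist_le n w (\<Sum>j<i. threshold n j) u z"
    using layers_dist_le[OF uv(1) disjI1[OF refl] 1(2) z(1)] by presburger
  moreover have "dist_le n w (\<Sum>k<j. threshold n k) z v"
    using layers_dist_le[OF uv(2) disjI2[OF refl] 2(2) z(2)] neq by presburger
  ultimately have "dist_le n w ((\<Sum>j<i. threshold n j) + (\<Sum>k<j. threshold n k)) u v"
    by (rule dist_le_trans)
  moreover have "(\<Sum>j<i. threshold n j) + (\<Sum>k<j. threshold n k) \<le> 4000 * ln (real n) / real n"
    using sum[OF 1(1)] sum[OF 2(1)] by simp
  ultimately show ?thesis by (rule dist_le_mono)
qed

text \<open>Union bound over at most two directions, \<open>n\<close> start vertices and at most n /
  2 rounds, each event of probability at most n^-8.\<close>

lemma emeasure_far_apart: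
  assumes n: "n \<ge> 3" "800 * ln (real n) \<le> real n"
  shows "far_apart n \<in> sets (weight_space n)"
    and "emeasure (weight_space n) (far_apart n) \<le> ennreal ((1 / real n) ^ 5)"
proof -
  let ?A = "arcs (complete_nat_digraph n)" and ?I = "{..nat \<lceil>2 * ln (real n)\<rceil>}"
  have T: "T ` ?A \<subseteq> ?A" "inj_on T ?A" if "T \<in> {id, prod.swap}" for T :: "nat \<times> nat \<Rightarrow> nat \<times> nat"
    using that by (auto simp: inj_on_def)
  note st = emeasure_stalled[OF n _ T]
  show "far_apart n \<in> sets (weight_space n)"
    unfolding far_apart_def by (intro sets.finite_UN st(1)) auto
  have "exp (1::real) \<le> real n"
    using exp_le n(1) by linarith
  then have ln1: "1 \<le> ln (real n)"
    using n(1) by (subst ln_ge_iff) auto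
  have "real (nat \<lceil>2 * ln (real n)\<rceil>) \<le> 2 * ln (real n) + 1" using ln1 by linarith
  moreover have "real (card ?I) = real (nat \<lceil>2 * ln (real n)\<rceil>) + 1" by simp
  ultimately have I: "2 * real (card ?I) \<le> real n" using ln1 n(2) by linarith
  have "emeasure (weight_space n) (far_apart n) \<le>
    (\<Sum>T\<in>{id, prod.swap}. emeasure (weight_space n) (\<Union>u\<in>{..<n}. \<Union>i\<in>?I. stalled n T u i))"
    unfolding far_apart_def
    by (intro emeasure_subadditive_finite image_subsetI sets.finite_UN st(1)) auto
  also have "\<dots> \<le> (\<Sum>T\<in>{id, prod.swap}. \<Sum>u<n. emeasure (weight_space n) (\<Union>i\<in>?I. stalled n T u i))"
    by (intro sum_mono emeasure_subadditive_finite image_subsetI sets.finite_UN st(1)) auto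
  also have "\<dots> \<le> (\<Sum>T\<in>{id, prod.swap}. \<Sum>u<n. \<Sum>i\<in>?I. emeasure (weight_space n) (stalled n T u i))"
    by (intro sum_mono emeasure_subadditive_finite image_subsetI st(1)) auto
  also have "\<dots> \<le> (\<Sum>T\<in>{id, prod.swap :: nat \<times> nat \<Rightarrow> _}. \<Sum>u<n. \<Sum>i\<in>?I. ennreal ((1 / real n) ^ 8))"
    by (intro sum_mono st(2)) auto
  also have "\<dots> = ennreal (real (card {id, prod.swap :: nat \<times> nat \<Rightarrow> _}) * (real n * (real (card ?I) * (1 / real n) ^ 8)))"
    unfolding sum_constant card_lessThan by (simp add: ennreal_mult ennreal_of_nat_eq_real_of_nat)
  also have "\<dots> \<le> ennreal ((1 / real n) ^ 5)"
  proof (rule ennreal_leI)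
    have "card {id, prod.swap :: nat \<times> nat \<Rightarrow> _} \<le> 2"
      by (rule order_trans[OF card_insert_le_m1]) auto
    then have "real (card {id, prod.swap :: nat \<times> nat \<Rightarrow> _}) * (real n * (real (card ?I) * (1 / real n) ^ 8))
      \<le> 2 * (real n * (real (card ?I) * (1 / real n) ^ 8))"
      by (intro mult_right_mono) auto
    also have "\<dots> = (2 * real (card ?I)) * (real n * (1 / real n) ^ 8)" by simp
    also have "\<dots> \<le> real n * (real n * (1 / real n) ^ 8)"
      using I by (intro mult_right_mono) auto
    also have "\<dots> = (1 / real n) ^ 6"
      using n(1) by (simp add: power_one_over eval_nat_numeral field_simps)
    also have "\<dots> \<le> (1 / real n) ^ 5"
      using n(1) by (intro power_decreasing) auto
    finally show "real (card {id, prod.swap :: nat \<times> nat \<Rightarrow> _}) * (real n * (real (card ?I) * (1 / real n) ^ 8))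
      \<le> (1 / real n) ^ 5" .
  qed
  finally show "emeasure (weight_space n) (far_apart n) \<le> ennreal ((1 / real n) ^ 5)" .
qed

section \<open>Paths, their arc sets and their costs\<close>

text \<open>A path without repeated vertices has only one arc leaving its start, so the arc set
  determines the first arc and, inductively, the rest. Hence different paths with the same ends
  differ in an arc whose weight enters only one of the two costs.\<close>

lemma (in wf_digraph) apath_eq_if_set_eq:
  assumes "apath u p v" "apath u q v" "set p = set q"
  shows "p = q"
  using assms
proof (induction p arbitrary: u q)
  case (Cons a p)
  then obtain b q' where q: "q = b # q'" by (cases q) auto
  have a: "tail G a = u" "tail G a \<notin> set (awalk_verts (head G a) p)"
    and p: "apath (head G a) p v"
    using Cons.prems(1) by (auto simp: apath_Cons_iff)
  have b: "tail G b = u" "tail G b \<notin> set (awalk_verts (head G b) q')"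
    and q': "apath (head G b) q' v"
    using Cons.prems(2) by (auto simp: q apath_Cons_iff)
  have "b \<notin> set p" using awalk_verts_arc1[of b p] a b(1) by auto
  then have ab: "a = b" using Cons.prems(3) q by auto
  have "a \<notin> set p" "a \<notin> set q'"
    using awalk_verts_arc1[of a p] awalk_verts_arc1[of b q'] a b ab by auto
  then have "set p = set q'" using Cons.prems(3) q ab by auto
  with Cons.IH[OF p, of q'] q' ab q show ?case by simp
qed simp

lemma apath_distinct_arcs:
  assumes "K.apath n u p v"
  shows "distinct p" "set p \<subseteq> arcs (complete_nat_digraph n)"
  using assms K.distinct_verts_imp_distinct by (auto simp only: K.apath_def K.awalk_def)

lemma awalk_cost_eq_sum:
  "distinct p \<Longrightarrow> K.awalk_cost w p = (\<Sum>a\<in>set p. w a)"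
  by (simp add: K.awalk_cost_def sum_list_distinct_conv_sum_set)

lemma borel_measurable_awalk_cost:
  assumes "set p \<subseteq> arcs (complete_nat_digraph n)"
  shows "(\<lambda>w. K.awalk_cost w p) \<in> borel_measurable (weight_space n)"
  using assms
proof (induction p)
  case (Cons a p)
  have "a \<in> arcs (complete_nat_digraph n)" using Cons.prems by (simp only: list.set insert_subset)
  note measurable_weight[OF this, measurable]
  have [measurable]: "(\<lambda>w. K.awalk_cost w p) \<in> borel_measurable (weight_space n)"
    using Cons by (simp only: list.set insert_subset)
  show ?case unfolding K.awalk_cost_Cons by measurable
qed simp

section \<open>Uniqueness of shortest paths\<close>

text \<open>Stronger than uniqueness of shortest paths, but free of minima: only finitely many
  equations between sums of weights are excluded.\<close>

definition distinct_costs :: "nat \<Rightarrow> (nat \<times> nat \<Rightarrow> real) \<Rightarrow> bool" where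
  "distinct_costs n w \<longleftrightarrow> (\<forall>u v p q. K.apath n u p v \<longrightarrow> K.apath n u q v \<longrightarrow>
     K.awalk_cost w p = K.awalk_cost w q \<longrightarrow> p = q)"

text \<open>Equality of the costs means \<open>w a = D w\<close>, where \<open>D\<close> does not
  read coordinate \<open>a\<close>. With all other weights fixed, only a single value of
  \<open>w a\<close> is excluded, which is a null set.\<close>

lemma AE_awalk_cost_neq:
  assumes p: "distinct p" "set p \<subseteq> arcs (complete_nat_digraph n)"
    and q: "distinct q" "set q \<subseteq> arcs (complete_nat_digraph n)"
    and a: "a \<in> set p" "a \<notin> set q"
  shows "AE w in weight_space n. K.awalk_cost w p \<noteq> K.awalk_cost w q"
proof -
  let ?M = "weight_space n"
  define B where "B = arcs (complete_nat_digraph n) - {a}"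
  have A: "arcs (complete_nat_digraph n) = insert a B" using a p by (auto simp only: B_def)
  have B: "finite B" "a \<notin> B" using K.finite_arcs by (auto simp only: B_def finite_Diff)
  define D where "D = (\<lambda>w. K.awalk_cost w q - (\<Sum>b\<in>set p - {a}. w b))"
  have cost: "K.awalk_cost w p = K.awalk_cost w q \<longleftrightarrow> w a = D w" for w
  proof -
    have "K.awalk_cost w p = w a + (\<Sum>b\<in>set p - {a}. w b)"
      using p(1) a(1) by (simp add: awalk_cost_eq_sum sum.remove)
    then show ?thesis by (auto simp: D_def)
  qed
  have D: "D (x(a := y)) = D (x(a := 0))" for x y
  proof -
    have "K.awalk_cost (x(a := y)) q = K.awalk_cost (x(a := 0)) q"
      unfolding awalk_cost_eq_sum[OF q(1)] using a(2) by (intro sum.cong) auto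
    moreover have "(\<Sum>b\<in>set p - {a}. (x(a := y)) b) = (\<Sum>b\<in>set p - {a}. (x(a := 0)) b)"
      by (intro sum.cong) auto
    ultimately show ?thesis by (simp only: D_def)
  qed
  have sets: "{w \<in> space ?M. K.awalk_cost w p = K.awalk_cost w q} \<in> sets ?M"
    using borel_measurable_awalk_cost[OF p(2)] borel_measurable_awalk_cost[OF q(2)] by measurable
  have "emeasure ?M {w \<in> space ?M. K.awalk_cost w p = K.awalk_cost w q} =
      (\<integral>\<^sup>+w. indicator {w \<in> space ?M. K.awalk_cost w p = K.awalk_cost w q} w \<partial>?M)"
    by (rule nn_integral_indicator[OF sets, symmetric])
  also have "\<dots> = (\<integral>\<^sup>+x. (\<integral>\<^sup>+y. indicator {w \<in> space ?M. K.awalk_cost w p = K.awalk_cost w q} (x(a := y))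
      \<partial>uniform01) \<partial>Pi\<^sub>M B (\<lambda>_. uniform01))"
    using sets unfolding weight_space_def A
    by (intro UP.product_nn_integral_insert[OF B] borel_measurable_indicator)
  also have "\<dots> \<le> (\<integral>\<^sup>+x. (\<integral>\<^sup>+y. indicator {D (x(a := 0))} y \<partial>uniform01) \<partial>Pi\<^sub>M B (\<lambda>_. uniform01))"
  proof (intro nn_integral_mono)
    fix x y
    show "indicator {w \<in> space ?M. K.awalk_cost w p = K.awalk_cost w q} (x(a := y)) \<le>
        (indicator {D (x(a := 0))} y :: ennreal)"
      using cost[of "x(a := y)"] D[of x y] by (auto simp: indicator_def)
  qed
  also have "\<dots> = 0"
    by (simp add: emeasure_uniform01_singleton)
  finally show ?thesis
    using sets by (intro AE_I[where N = "{w \<in> space ?M. K.awalk_cost w p = K.awalk_cost w q}"]) auto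
qed

lemma AE_distinct_costs: "AE w in weight_space n. distinct_costs n w"
proof -
  define P where "P = {p. \<exists>u v. K.apath n u p v}"
  define R where "R = {(p, q). p \<in> P \<and> q \<in> P \<and> (\<exists>u v. K.apath n u p v \<and> K.apath n u q v) \<and> p \<noteq> q}"
  have "finite P" unfolding P_def by (rule K.finite_apaths)
  have "finite R"
    by (rule finite_subset[of _ "P \<times> P"]) (auto simp: R_def \<open>finite P\<close>)
  have "AE w in weight_space n. \<forall>r\<in>R. K.awalk_cost w (fst r) \<noteq> K.awalk_cost w (snd r)"
  proof (subst AE_ball_countable[OF countable_finite[OF \<open>finite R\<close>]], intro ballI)
    fix r assume "r \<in> R"
    then obtain u v p q where r: "r = (p, q)" "K.apath n u p v" "K.apath n u q v" "p \<noteq> q"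
      by (auto simp: R_def)
    then have "set p \<noteq> set q" using K.apath_eq_if_set_eq by blast
    then consider a where "a \<in> set p" "a \<notin> set q" | a where "a \<in> set q" "a \<notin> set p" by blast
    then show "AE w in weight_space n. K.awalk_cost w (fst r) \<noteq> K.awalk_cost w (snd r)"
    proof cases
      case 1
      from AE_awalk_cost_neq[OF apath_distinct_arcs[OF r(2)] apath_distinct_arcs[OF r(3)] 1]
      show ?thesis by (simp add: r)
    next
      case 2
      from AE_awalk_cost_neq[OF apath_distinct_arcs[OF r(3)] apath_distinct_arcs[OF r(2)] 2]
      show ?thesis by (simp add: r eq_commute)
    qed
  qed
  then show ?thesis
  proof eventually_elim
    case (elim w)
    then show ?case by (fastforce simp: distinct_costs_def R_def P_def)
  qed
qed

section \<open>Long paths are expensive\<close>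

text \<open>Markov's inequality for the exponential of \<open>t * (c - K.awalk_cost w p)\<close>; as
  the arcs are distinct, its integral is a product over them.\<close>

lemma emeasure_awalk_cost_le:
  assumes p: "distinct p" "set p \<subseteq> arcs (complete_nat_digraph n)" and t: "t > 0"
  shows "emeasure (weight_space n) {w \<in> space (weight_space n). K.awalk_cost w p \<le> c} \<le>
    ennreal (exp (t * c) * (1 / t) ^ length p)"
proof -
  let ?M = "weight_space n" and ?A = "arcs (complete_nat_digraph n)"
  have sets: "{w \<in> space ?M. K.awalk_cost w p \<le> c} \<in> sets ?M"
    using borel_measurable_awalk_cost[OF p(2)] by measurable
  have "emeasure ?M {w \<in> space ?M. K.awalk_cost w p \<le> c} =
      (\<integral>\<^sup>+w. indicator {w \<in> space ?M. K.awalk_cost w p \<le> c} w \<partial>?M)"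
    by (rule nn_integral_indicator[OF sets, symmetric])
  also have "\<dots> \<le> (\<integral>\<^sup>+w. ennreal (exp (t * c)) * (\<Prod>a\<in>set p. ennreal (exp (- t * w a))) \<partial>?M)"
  proof (intro nn_integral_mono)
    fix w
    have "ennreal (exp (t * c)) * (\<Prod>a\<in>set p. ennreal (exp (- t * w a))) =
        ennreal (exp (t * c) * (\<Prod>a\<in>set p. exp (- t * w a)))"
      by (simp add: prod_ennreal ennreal_mult prod_nonneg)
    also have "exp (t * c) * (\<Prod>a\<in>set p. exp (- t * w a)) = exp (t * (c - K.awalk_cost w p))"
      unfolding awalk_cost_eq_sum[OF p(1)]
      by (simp add: exp_sum[symmetric] exp_add[symmetric] sum_negf sum_distrib_left algebra_simps)
    finally have eq: "ennreal (exp (t * c)) * (\<Prod>a\<in>set p. ennreal (exp (- t * w a))) =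
      ennreal (exp (t * (c - K.awalk_cost w p)))" .
    have "1 \<le> exp (t * (c - K.awalk_cost w p))" if "K.awalk_cost w p \<le> c"
      using that t by simp
    then show "indicator {w \<in> space ?M. K.awalk_cost w p \<le> c} w \<le>
        ennreal (exp (t * c)) * (\<Prod>a\<in>set p. ennreal (exp (- t * w a)))"
      unfolding eq by (auto simp: indicator_def simp flip: ennreal_1)
  qed
  also have "\<dots> = ennreal (exp (t * c)) * (\<Prod>a\<in>set p. \<integral>\<^sup>+y. ennreal (exp (- t * y)) \<partial>uniform01)"
    unfolding weight_space_def
    by (subst UP.nn_integral_PiM_mult_prod[where J = "set p" and A = ?A
        and h = "\<lambda>_. ennreal (exp (t * c))" and g = "\<lambda>_ y. ennreal (exp (- t * y))"])
      (use p K.finite_arcs W.emeasure_space_1[of n] in \<open>auto simp: weight_space_def\<close>)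
  also have "\<dots> \<le> ennreal (exp (t * c)) * (\<Prod>a\<in>set p. ennreal (1 / t))"
    by (intro mult_left_mono prod_mono_ennreal nn_integral_exp_uniform01_le[OF t]) (rule zero_le)
  also have "\<dots> = ennreal (exp (t * c) * (1 / t) ^ length p)"
    using t by (simp add: distinct_card[OF p(1)] ennreal_power ennreal_mult)
  finally show ?thesis .
qed

lemma zip_awalk_verts:
  "K.cas n u p v \<Longrightarrow>
    zip (K.awalk_verts n u p) (tl (K.awalk_verts n u p)) = p"
proof (induction p arbitrary: u)
  case (Cons a p)
  then have "K.awhd n (snd a) p = snd a" using K.awhd_if_cas[of n "snd a" p v] by simp
  then have "K.awalk_verts n (snd a) p = snd a # tl (K.awalk_verts n (snd a) p)"
    by (metis K.awalk_verts_non_Nil list.collapse)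
  with Cons show ?case
    by (cases a) (simp, metis zip_Cons_Cons)
qed simp

text \<open>Arcs are pairs of vertices, so a path is recovered from its \<open>Suc k\<close>
  vertices by zipping the vertex list with its tail.\<close>

lemma card_apaths_length:
  "card {p. (\<exists>u v. K.apath n u p v) \<and> length p = k} \<le> n ^ Suc k"
proof -
  let ?V = "{vs. set vs \<subseteq> {..<n} \<and> length vs = Suc k}"
  have "{p. (\<exists>u v. K.apath n u p v) \<and> length p = k} \<subseteq> (\<lambda>vs. zip vs (tl vs)) ` ?V"
  proof
    fix p assume "p \<in> {p. (\<exists>u v. K.apath n u p v) \<and> length p = k}"
    then obtain u v where p: "K.awalk n u p v" "length p = k"
      unfolding K.apath_def by blast
    have "set (K.awalk_verts n u p) \<subseteq> {..<n}"
      using K.awalk_conv[of n u p v] p(1) by simp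
    moreover have "length (K.awalk_verts n u p) = Suc k"
      using p(2) by (simp add: K.length_awalk_verts)
    moreover have "p = zip (K.awalk_verts n u p) (tl (K.awalk_verts n u p))"
      using zip_awalk_verts[of n u p v] p(1) by (simp add: K.awalk_def)
    ultimately show "p \<in> (\<lambda>vs. zip vs (tl vs)) ` ?V" by blast
  qed
  then have "card {p. (\<exists>u v. K.apath n u p v) \<and> length p = k} \<le> card ?V"
    by (intro surj_card_le) (auto intro: finite_lists_length_eq)
  then show ?thesis by (simp add: card_lists_length_eq)
qed

definition cheap_long :: "nat \<Rightarrow> (nat \<times> nat \<Rightarrow> real) set" where
  "cheap_long n = {w \<in> space (weight_space n). \<exists>p u v. K.apath n u p v \<and>
     12010 * ln (real n) \<le> real (length p) \<and> K.awalk_cost w p \<le> 4000 * ln (real n) / real n}"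

text \<open>A first moment bound with \<open>t = 3 * real n\<close>. The at most n^(k+1) paths of
  length \<open>k\<close> cancel against the powers of \<open>n\<close> in
  \<open>(1 / t) ^ k\<close> up to one factor \<open>n\<close>, and 3^-k is at most e^-k. The factor
  \<open>exp (t * c)\<close> is n^12000, so lengths from \<open>12010 * ln (real n)\<close> on leave
  n * n^-10, for each of fewer than \<open>n\<close> lengths.\<close>

lemma emeasure_cheap_long:
  assumes n: "n \<ge> 3"
  shows "cheap_long n \<in> sets (weight_space n)"
    and "emeasure (weight_space n) (cheap_long n) \<le> ennreal ((1 / real n) ^ 5)"
proof -
  let ?M = "weight_space n" and ?c = "4000 * ln (real n) / real n" and ?l = "12010 * ln (real n)"
  define P where "P = (\<lambda>k. {p. (\<exists>u v. K.apath n u p v) \<and> length p = k})"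
  define Ks where "Ks = {k. k < n \<and> ?l \<le> real k}"
  have finK: "finite Ks" by (simp add: Ks_def)
  have finP: "finite (P k)" for k
    by (rule finite_subset[OF _ K.finite_apaths[of n]]) (auto simp: P_def)
  have E: "{w \<in> space ?M. K.awalk_cost w p \<le> ?c} \<in> sets ?M" if pk: "p \<in> P k" for p k
  proof -
    obtain u v where "K.apath n u p v" using pk by (auto simp: P_def)
    note borel_measurable_awalk_cost[OF apath_distinct_arcs(2)[OF this], measurable]
    show ?thesis by measurable
  qed
  have eq: "cheap_long n = (\<Union>k\<in>Ks. \<Union>p\<in>P k. {w \<in> space ?M. K.awalk_cost w p \<le> ?c})"
  proof (intro equalityI subsetI)
    fix w assume "w \<in> cheap_long n"
    then obtain p u v where *: "w \<in> space ?M" "K.apath n u p v" "?l \<le> real (length p)" "K.awalk_cost w p \<le> ?c"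
      by (auto simp: cheap_long_def)
    have "length p \<in> Ks" using * K.length_apath_less[OF *(2)] by (simp add: Ks_def)
    moreover have "p \<in> P (length p)" using * by (auto simp: P_def)
    ultimately show "w \<in> (\<Union>k\<in>Ks. \<Union>p\<in>P k. {w \<in> space ?M. K.awalk_cost w p \<le> ?c})"
      using * by blast
  qed (auto simp: cheap_long_def Ks_def P_def)
  show "cheap_long n \<in> sets ?M"
    unfolding eq using finK finP E by (intro sets.finite_UN) auto
  have "emeasure ?M (cheap_long n) \<le> (\<Sum>k\<in>Ks. emeasure ?M (\<Union>p\<in>P k. {w \<in> space ?M. K.awalk_cost w p \<le> ?c}))"
    unfolding eq using finK finP E by (intro emeasure_subadditive_finite image_subsetI sets.finite_UN) auto
  also have "\<dots> \<le> (\<Sum>k\<in>Ks. \<Sum>p\<in>P k. emeasure ?M {w \<in> space ?M. K.awalk_cost w p \<le> ?c})"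
    using finP E by (intro sum_mono emeasure_subadditive_finite image_subsetI) auto
  also have "\<dots> \<le> (\<Sum>k\<in>Ks. \<Sum>p\<in>P k. ennreal (exp (3 * real n * ?c) * (1 / (3 * real n)) ^ k))"
  proof (intro sum_mono)
    fix k p assume "p \<in> P k"
    then obtain u v where p: "K.apath n u p v" "length p = k" by (auto simp: P_def)
    show "emeasure ?M {w \<in> space ?M. K.awalk_cost w p \<le> ?c} \<le>
        ennreal (exp (3 * real n * ?c) * (1 / (3 * real n)) ^ k)"
      using emeasure_awalk_cost_le[OF apath_distinct_arcs[OF p(1)], of "3 * real n" ?c] n
      unfolding p(2) by simp
  qed
  also have "\<dots> = ennreal (\<Sum>k\<in>Ks. real (card (P k)) * (exp (3 * real n * ?c) * (1 / (3 * real n)) ^ k))"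
    by (simp add: ennreal_of_nat_eq_real_of_nat ennreal_mult sum_nonneg flip: sum_ennreal)
  also have "\<dots> \<le> ennreal ((1 / real n) ^ 5)"
  proof (rule ennreal_leI)
    have "(\<Sum>k\<in>Ks. real (card (P k)) * (exp (3 * real n * ?c) * (1 / (3 * real n)) ^ k)) \<le>
        (\<Sum>k\<in>Ks. real n * exp (- 10 * ln (real n)))"
    proof (intro sum_mono)
      fix k assume k: "k \<in> Ks"
      have "(1 / 3 :: real) ^ k \<le> exp (-1) ^ k"
        using exp_le by (intro power_mono) (auto simp: exp_minus field_simps)
      also have "exp (-1 :: real) ^ k = exp (- real k)"
        by (simp add: exp_of_nat_mult[symmetric])
      also have "exp (- real k) \<le> exp (- ?l)" using k by (simp add: Ks_def)
      finally have third: "(1 / 3 :: real) ^ k \<le> exp (- ?l)" .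
      have "real (card (P k)) \<le> real n ^ Suc k"
        using card_apaths_length[of n k] unfolding P_def of_nat_power[symmetric] by (rule of_nat_mono)
      then have "real (card (P k)) * (exp (3 * real n * ?c) * (1 / (3 * real n)) ^ k) \<le>
          real n ^ Suc k * (exp (3 * real n * ?c) * (1 / (3 * real n)) ^ k)"
        by (intro mult_right_mono) auto
      also have "\<dots> = real n * exp (12000 * ln (real n)) * (1 / 3) ^ k"
        using n by (simp add: power_divide power_mult_distrib field_simps)
      also have "\<dots> \<le> real n * exp (12000 * ln (real n)) * exp (- ?l)"
        using third by (intro mult_left_mono) auto
      also have "\<dots> = real n * exp (- 10 * ln (real n))"
        by (simp add: mult.assoc exp_add[symmetric])
      finally show "real (card (P k)) * (exp (3 * real n * ?c) * (1 / (3 * real n)) ^ k) \<le>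
          real n * exp (- 10 * ln (real n))" .
    qed
    also have "\<dots> = real (card Ks) * (real n * exp (- 10 * ln (real n)))" by simp
    also have "\<dots> \<le> real n * (real n * exp (- 10 * ln (real n)))"
    proof (intro mult_right_mono of_nat_mono)
      have "card Ks \<le> card {..<n}" by (intro card_mono) (auto simp: Ks_def)
      then show "card Ks \<le> n" by simp
    qed auto
    also have "exp (- 10 * ln (real n)) = (1 / real n) ^ 10"
      using n exp_of_nat_mult[of 10 "- ln (real n)"] by (simp add: exp_minus field_simps)
    also have "real n * (real n * (1 / real n) ^ 10) = (1 / real n) ^ 8"
      using n by (simp add: power_one_over eval_nat_numeral field_simps)
    also have "\<dots> \<le> (1 / real n) ^ 5"
      using n by (intro power_decreasing) auto
    finally show "(\<Sum>k\<in>Ks. real (card (P k)) * (exp (3 * real n * ?c) * (1 / (3 * real n)) ^ k)) \<le>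
       (1 / real n) ^ 5" by (auto intro: mult_right_mono order_trans)
  qed
  finally show "emeasure ?M (cheap_long n) \<le> ennreal ((1 / real n) ^ 5)" .
qed

section \<open>Few light arcs at a vertex\<close>

definition light_ends :: "nat \<Rightarrow> (nat \<times> nat \<Rightarrow> nat \<times> nat) \<Rightarrow> (nat \<times> nat \<Rightarrow> real) \<Rightarrow> nat \<Rightarrow> nat set" where
  "light_ends n T w v = {z \<in> {..<n} - {v}. w (T (v, z)) \<le> 4000 * ln (real n) / real n}"

definition crowded :: "nat \<Rightarrow> (nat \<times> nat \<Rightarrow> nat \<times> nat) \<Rightarrow> nat \<Rightarrow> (nat \<times> nat \<Rightarrow> real) set" where
  "crowded n T v = {w \<in> space (weight_space n). 8010 * ln (real n) \<le> real (card (light_ends n T w v))}"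

text \<open>The exponential of the number of light arcs has expectation at most
  \<open>(1 + (exp 1 - 1) * c) ^ (n - 1)\<close> with
  \<open>c = 4000 * ln (real n) / real n\<close>. Since \<open>exp 1 - 1 <= 2\<close>, this is at
  most n^8000; the excess 10 in 8010 gives the probability.\<close>

lemma emeasure_crowded:
  assumes n: "n \<ge> 3" "4000 * ln (real n) \<le> real n" and v: "v < n"
    and T: "T ` arcs (complete_nat_digraph n) \<subseteq> arcs (complete_nat_digraph n)"
      "inj_on T (arcs (complete_nat_digraph n))"
  shows "crowded n T v \<in> sets (weight_space n)"
    and "emeasure (weight_space n) (crowded n T v) \<le> ennreal ((1 / real n) ^ 10)"
proof -
  let ?M = "weight_space n" and ?c = "4000 * ln (real n) / real n" and ?A = "arcs (complete_nat_digraph n)"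
  let ?Z = "{..<n} - {v}"
  have ends: "light_ends n T w v = light_nbrs n T ?c {v} {v} w" for w
    by (auto simp: light_ends_def light_nbrs_def)
  have "Measurable.pred ?M (\<lambda>w. 8010 * ln (real n) \<le> real (card (light_nbrs n T ?c {v} {v} w)))"
    using v by (intro pred_light_nbrs[OF T(1)]) auto
  then show sets: "crowded n T v \<in> sets ?M"
    unfolding crowded_def ends by (simp add: pred_def)
  have c: "0 \<le> ?c" "?c \<le> 1" using n by auto
  have arc: "(v, z) \<in> ?A" if "z \<in> ?Z" for z using that v by auto
  have inj: "inj_on (\<lambda>z. T (v, z)) ?Z"
    using inj_onD[OF T(2)] arc by (intro inj_onI) blast
  let ?g = "\<lambda>y. if y \<le> ?c then exp 1 else 1 :: real"
  have "emeasure ?M (crowded n T v) = (\<integral>\<^sup>+w. indicator (crowded n T v) w \<partial>?M)"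
    by (rule nn_integral_indicator[OF sets, symmetric])
  also have "\<dots> \<le> (\<integral>\<^sup>+w. ennreal (exp (- 8010 * ln (real n))) *
      (\<Prod>a\<in>(\<lambda>z. T (v, z)) ` ?Z. ennreal (?g (w a))) \<partial>?M)"
  proof (intro nn_integral_mono)
    fix w
    have "(\<Prod>a\<in>(\<lambda>z. T (v, z)) ` ?Z. ennreal (?g (w a))) = ennreal (\<Prod>z\<in>?Z. ?g (w (T (v, z))))"
      by (subst prod.reindex[OF inj]) (simp add: prod_ennreal)
    also have "(\<Prod>z\<in>?Z. ?g (w (T (v, z)))) = exp (real (card (light_ends n T w v)))"
      by (simp add: prod.If_cases light_ends_def Int_def exp_of_nat_mult[symmetric])
    finally have eq: "ennreal (exp (- 8010 * ln (real n))) * (\<Prod>a\<in>(\<lambda>z. T (v, z)) ` ?Z. ennreal (?g (w a))) =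
        ennreal (exp (real (card (light_ends n T w v)) - 8010 * ln (real n)))"
      by (simp add: ennreal_mult[symmetric] exp_add[symmetric])
    show "indicator (crowded n T v) w \<le> ennreal (exp (- 8010 * ln (real n))) *
        (\<Prod>a\<in>(\<lambda>z. T (v, z)) ` ?Z. ennreal (?g (w a)))"
      unfolding eq by (auto simp: indicator_def crowded_def simp flip: ennreal_1)
  qed
  also have "\<dots> = ennreal (exp (- 8010 * ln (real n))) *
      (\<Prod>a\<in>(\<lambda>z. T (v, z)) ` ?Z. \<integral>\<^sup>+y. ennreal (?g y) \<partial>uniform01)"
    unfolding weight_space_def
  proof (subst UP.nn_integral_PiM_mult_prod[where J = "(\<lambda>z. T (v, z)) ` ?Z" and A = ?A
        and h = "\<lambda>_. ennreal (exp (- 8010 * ln (real n)))" and g = "\<lambda>_ y. ennreal (?g y)"])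
    show "(\<lambda>z. T (v, z)) ` ?Z \<subseteq> ?A" using T(1) arc by blast
    show "(\<lambda>y. ennreal (?g y)) \<in> borel_measurable uniform01" by measurable
    show "finite ?A" by (rule K.finite_arcs)
  qed (use W.emeasure_space_1[of n] in \<open>auto simp: weight_space_def\<close>)
  also have "\<dots> \<le> ennreal (exp (- 8010 * ln (real n))) * (\<Prod>a\<in>(\<lambda>z. T (v, z)) ` ?Z. ennreal (exp (2 * ?c)))"
  proof (intro mult_left_mono prod_mono_ennreal)
    have "{0..1} \<inter> {..?c} = {0..?c}" using c by auto
    then have prob: "emeasure uniform01 {..?c} = ennreal ?c"
      using c by (simp add: U.emeasure_eq_measure measure_uniform_measure)
    have "(\<integral>\<^sup>+y. ennreal (?g y) \<partial>uniform01) =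
        (\<integral>\<^sup>+y. 1 + ennreal (exp 1 - 1) * indicator {..?c} y \<partial>uniform01)"
    proof (rule nn_integral_cong)
      fix y
      have "1 + ennreal (exp 1 - 1) = ennreal (exp 1)"
        by (simp flip: ennreal_1 ennreal_plus)
      then show "ennreal (?g y) = 1 + ennreal (exp 1 - 1) * indicator {..?c} y"
        by (simp add: indicator_def)
    qed
    also have "\<dots> = 1 + ennreal (exp 1 - 1) * ennreal ?c"
      using U.emeasure_space_1 by (subst nn_integral_add) (auto simp: nn_integral_cmult prob)
    also have "\<dots> = ennreal (1 + (exp 1 - 1) * ?c)"
    proof -
      have "0 \<le> (exp 1 - 1) * ?c" using c(1) by (intro mult_nonneg_nonneg) auto
      moreover have "ennreal ((exp 1 - 1) * ?c) = ennreal (exp 1 - 1) * ennreal ?c"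
        using c(1) by (intro ennreal_mult) auto
      ultimately show ?thesis by (metis ennreal_1 ennreal_plus zero_le_one)
    qed
    also have "\<dots> \<le> ennreal (exp (2 * ?c))"
    proof (rule ennreal_leI)
      have "(exp 1 - 1) * ?c \<le> 2 * ?c" using exp_le c by (intro mult_right_mono) auto
      then show "1 + (exp 1 - 1) * ?c \<le> exp (2 * ?c)"
        using exp_ge_add_one_self[of "2 * ?c"] by linarith
    qed
    finally show "(\<integral>\<^sup>+y. ennreal (?g y) \<partial>uniform01) \<le> ennreal (exp (2 * ?c))" .
  qed auto
  also have "\<dots> = ennreal (exp (- 8010 * ln (real n)) * exp (2 * ?c) ^ (n - 1))"
    using v by (simp add: card_image[OF inj] ennreal_mult ennreal_power)
  also have "\<dots> \<le> ennreal ((1 / real n) ^ 10)"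
  proof (rule ennreal_leI)
    have "exp (2 * ?c) ^ (n - 1) \<le> exp (2 * ?c) ^ n"
      using c by (intro power_increasing) auto
    also have "\<dots> = exp (8000 * ln (real n))"
      using n by (simp add: exp_of_nat_mult[symmetric])
    finally have "exp (- 8010 * ln (real n)) * exp (2 * ?c) ^ (n - 1) \<le>
        exp (- 8010 * ln (real n)) * exp (8000 * ln (real n))"
      by (intro mult_left_mono) auto
    also have "\<dots> = exp (- 10 * ln (real n))" by (simp add: exp_add[symmetric])
    also have "exp (- 10 * ln (real n)) = (1 / real n) ^ 10"
      using n exp_of_nat_mult[of 10 "- ln (real n)"] by (simp add: exp_minus field_simps)
    finally show "exp (- 8010 * ln (real n)) * exp (2 * ?c) ^ (n - 1) \<le> (1 / real n) ^ 10" .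
  qed
  finally show "emeasure ?M (crowded n T v) \<le> ennreal ((1 / real n) ^ 10)" .
qed

section \<open>Counting locally shortest paths\<close>

text \<open>Nonempty, so that \<open>path_ends\<close> can read the end points off the arc
  list.\<close>

definition proper_shortest :: "nat \<Rightarrow> (nat \<times> nat \<Rightarrow> real) \<Rightarrow> (nat \<times> nat) list set" where
  "proper_shortest n w = {p. p \<noteq> [] \<and> K.shortest_path n w p}"

definition path_ends :: "(nat \<times> nat) list \<Rightarrow> nat \<times> nat" where
  "path_ends p = (fst (hd p), snd (last p))"

lemma apath_path_ends:
  assumes "K.apath n u p v" "p \<noteq> []"
  shows "path_ends p = (u, v)" "(u, v) \<in> arcs (complete_nat_digraph n)"
proof -
  have walk: "K.awalk n u p v" using assms(1) by (simp only: K.apath_def)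
  have verts: "K.awalk_verts n u p = map fst p @ [snd (last p)]"
    using assms(2) by (simp add: K.awalk_verts_conv)
  have "hd (K.awalk_verts n u p) = u" "last (K.awalk_verts n u p) = v"
    using walk by blast+
  then show "path_ends p = (u, v)"
    using assms(2) unfolding verts by (simp add: path_ends_def hd_append hd_map)
  have "u \<in> verts (complete_nat_digraph n)" "v \<in> verts (complete_nat_digraph n)"
    using walk by blast+
  moreover have "u \<noteq> v" by (rule K.apath_nonempty_ends[OF assms])
  ultimately show "(u, v) \<in> arcs (complete_nat_digraph n)" by simp
qed

lemma shortest_path_apathE:
  assumes "K.shortest_path n w p"
  obtains u v where "K.apath n u p v" "\<And>q. K.apath n u q v \<Longrightarrow> K.awalk_cost w p \<le> K.awalk_cost w q"
  using assms unfolding K.shortest_path_def is_arg_min_linorder by blast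

lemma finite_proper_shortest: "finite (proper_shortest n w)"
proof (rule finite_subset[OF _ K.finite_apaths[of n]])
  show "proper_shortest n w \<subseteq> {p. \<exists>u v. K.apath n u p v}"
    unfolding proper_shortest_def by (blast elim: shortest_path_apathE)
qed

lemma path_ends_inj_on:
  assumes "distinct_costs n w"
  shows "inj_on path_ends (proper_shortest n w)"
proof (rule inj_onI)
  fix p q assume pq: "p \<in> proper_shortest n w" "q \<in> proper_shortest n w" "path_ends p = path_ends q"
  obtain u v where p: "K.apath n u p v" "\<And>q. K.apath n u q v \<Longrightarrow> K.awalk_cost w p \<le> K.awalk_cost w q"
    using pq(1) shortest_path_apathE unfolding proper_shortest_def by blast
  obtain u' v' where q: "K.apath n u' q v'" "\<And>p. K.apath n u' p v' \<Longrightarrow> K.awalk_cost w q \<le> K.awalk_cost w p"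
    using pq(2) shortest_path_apathE unfolding proper_shortest_def by blast
  have "(u, v) = (u', v')"
    using apath_path_ends(1)[OF p(1)] apath_path_ends(1)[OF q(1)] pq by (simp add: proper_shortest_def)
  then have "u' = u" "v' = v" by simp_all
  note q = q[unfolded this]
  have "K.awalk_cost w p = K.awalk_cost w q"
    using p(2)[OF q(1)] q(2)[OF p(1)] by simp
  with assms p(1) q(1) show "p = q" unfolding distinct_costs_def by blast
qed

text \<open>By uniqueness the ends determine the path, and ordered pairs of different vertices are
  precisely the arcs of the complete digraph.\<close>

lemma card_proper_shortest_le:
  assumes "distinct_costs n w"
  shows "card (proper_shortest n w) \<le> card (arcs (complete_nat_digraph n))"
proof (rule card_inj_on_le[OF path_ends_inj_on[OF assms] _ K.finite_arcs])
  show "path_ends ` proper_shortest n w \<subseteq> arcs (complete_nat_digraph n)"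
  proof
    fix e assume "e \<in> path_ends ` proper_shortest n w"
    then obtain p where p: "e = path_ends p" "p \<noteq> []" "K.shortest_path n w p"
      by (auto simp only: proper_shortest_def)
    from p(3) obtain u v where "K.apath n u p v" by (rule shortest_path_apathE)
    from apath_path_ends[OF this p(2)] p(1) show "e \<in> arcs (complete_nat_digraph n)" by (simp only:)
  qed
qed

text \<open>An extension is determined by the shorter path \<open>tl p\<close> and the new first
  vertex, because the first arc has to end where \<open>tl p\<close> starts.\<close>

lemma card_left_extensions_le:
  assumes X: "\<And>p. p \<in> X \<Longrightarrow> (\<exists>u v. K.apath n u p v) \<and> tl p \<noteq> [] \<and> tl p \<in> S \<and>
      fst (hd p) \<in> F (fst (hd (tl p)))"
    and S: "finite S" and F: "\<And>p. p \<in> S \<Longrightarrow> finite (F (fst (hd p))) \<and> real (card (F (fst (hd p)))) \<le> D"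
  shows "real (card X) \<le> real (card S) * D"
proof -
  have inj: "inj_on (\<lambda>p. (tl p, fst (hd p))) X"
  proof (rule inj_onI)
    have dec: "p = (fst (hd p), fst (hd (tl p))) # tl p" if p: "p \<in> X" for p
    proof -
      from X[OF p] obtain u v where *: "K.apath n u p v" "tl p \<noteq> []" by blast
      then obtain a b q where "p = a # b # q" by (metis list.collapse tl_Nil)
      with * show ?thesis by (cases a) (simp add: K.apath_Cons_iff)
    qed
    fix p q assume "p \<in> X" "q \<in> X" "(tl p, fst (hd p)) = (tl q, fst (hd q))"
    then show "p = q" using dec[of p] dec[of q] by (metis prod.inject)
  qed
  have "card X \<le> card (SIGMA p:S. F (fst (hd p)))"
    using S F X by (intro card_inj_on_le[OF inj]) auto
  also have "\<dots> = (\<Sum>p\<in>S. card (F (fst (hd p))))"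
    using S F by (intro card_SigmaI) auto
  finally have "real (card X) \<le> (\<Sum>p\<in>S. real (card (F (fst (hd p)))))"
    by (metis of_nat_mono of_nat_sum)
  also have "\<dots> \<le> (\<Sum>p\<in>S. D)" using F by (intro sum_mono) auto
  finally show ?thesis by simp
qed

text \<open>The mirror image: the new last arc starts where \<open>butlast p\<close> ends.\<close>

lemma card_right_extensions_le:
  assumes X: "\<And>p. p \<in> X \<Longrightarrow> (\<exists>u v. K.apath n u p v) \<and> butlast p \<noteq> [] \<and> butlast p \<in> S \<and>
      snd (last p) \<in> F (snd (last (butlast p)))"
    and S: "finite S" and F: "\<And>p. p \<in> S \<Longrightarrow> finite (F (snd (last p))) \<and> real (card (F (snd (last p)))) \<le> D"
  shows "real (card X) \<le> real (card S) * D"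
proof -
  have inj: "inj_on (\<lambda>p. (butlast p, snd (last p))) X"
  proof (rule inj_onI)
    have dec: "p = butlast p @ [(snd (last (butlast p)), snd (last p))]" if p: "p \<in> X" for p
    proof -
      from X[OF p] obtain u v where *: "K.apath n u p v" "butlast p \<noteq> []" by blast
      then obtain q a where q: "p = q @ [a]" by (metis append_butlast_last_id butlast.simps(1))
      with * have ap: "K.apath n u q (K.awlast n u q)" "K.apath n (K.awlast n u q) [a] v" "q \<noteq> []"
        by (simp_all add: K.apath_append_iff)
      have "snd (last q) = K.awlast n u q"
        using apath_path_ends(1)[OF ap(1,3)] by (simp add: path_ends_def)
      moreover have "fst a = K.awlast n u q"
        using ap(2) by (simp add: K.apath_Cons_iff)
      ultimately show ?thesis by (cases a) (simp add: q)
    qed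
    fix p q assume "p \<in> X" "q \<in> X" "(butlast p, snd (last p)) = (butlast q, snd (last q))"
    then show "p = q" using dec[of p] dec[of q] by (metis prod.inject)
  qed
  have "card X \<le> card (SIGMA p:S. F (snd (last p)))"
    using S F X by (intro card_inj_on_le[OF inj]) auto
  also have "\<dots> = (\<Sum>p\<in>S. card (F (snd (last p))))"
    using S F by (intro card_SigmaI) auto
  finally have "real (card X) \<le> (\<Sum>p\<in>S. real (card (F (snd (last p)))))"
    by (metis of_nat_mono of_nat_sum)
  also have "\<dots> \<le> (\<Sum>p\<in>S. D)" using F by (intro sum_mono) auto
  finally show ?thesis by simp
qed

lemma finite_locally_shortest: "finite (K.locally_shortest_paths n w)"
  by (rule finite_subset[OF _ K.finite_apaths[of n]]) (auto simp: K.locally_shortest_paths_def)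

lemma butlast_tl_apath:
  assumes "K.apath n u p v" "2 \<le> length p"
  shows "tl p \<noteq> []" "butlast p \<noteq> []" "hd p = (fst (hd p), fst (hd (tl p)))"
    "last p = (snd (last (butlast p)), snd (last p))" "hd p \<in> set (butlast p)" "last p \<in> set (tl p)"
    "hd p \<in> arcs (complete_nat_digraph n)" "last p \<in> arcs (complete_nat_digraph n)"
proof -
  obtain a b q where p: "p = a # b # q"
    using assms(2) by (metis One_nat_def Suc_1 Suc_le_length_iff)
  then show "tl p \<noteq> []" "butlast p \<noteq> []" "hd p \<in> set (butlast p)" "last p \<in> set (tl p)" by auto
  show "hd p = (fst (hd p), fst (hd (tl p)))"
    using assms(1) unfolding p by (cases a) (simp add: K.apath_Cons_iff)
  have arcs: "set p \<subseteq> arcs (complete_nat_digraph n)"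
    using assms(1) by (simp only: K.apath_def K.awalk_def)
  then show "hd p \<in> arcs (complete_nat_digraph n)" "last p \<in> arcs (complete_nat_digraph n)"
    unfolding p using last_in_set[of "a # b # q"] by auto
  obtain r c where r: "p = r @ [c]" by (metis p list.distinct(1) rev_exhaust)
  then have "r \<noteq> []" using p by auto
  have ap: "K.apath n u r (K.awlast n u r)" "K.apath n (K.awlast n u r) [c] v"
    using assms(1) by (simp_all add: r K.apath_append_iff)
  have "snd (last r) = K.awlast n u r"
    using apath_path_ends(1)[OF ap(1) \<open>r \<noteq> []\<close>] by (simp add: path_ends_def)
  moreover have "fst c = K.awlast n u r"
    using ap(2) by (simp add: K.apath_Cons_iff)
  ultimately show "last p = (snd (last (butlast p)), snd (last p))"
    by (cases c) (simp add: r)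
qed

text \<open>
  \<open>F False v\<close> contains the possible first vertices of a locally shortest path with second
  vertex \<open>v\<close>, and \<open>F True v\<close> the possible last vertices of one with last but one vertex \<open>v\<close>.
\<close>

definition extension_bound :: "nat \<Rightarrow> (nat \<times> nat \<Rightarrow> real) \<Rightarrow> (bool \<Rightarrow> nat \<Rightarrow> nat set) \<Rightarrow> real \<Rightarrow> bool" where
  "extension_bound n w F D \<longleftrightarrow>
     (\<forall>b. \<forall>v<n. finite (F b v) \<and> real (card (F b v)) \<le> D) \<and>
     (\<forall>p\<in>K.locally_shortest_paths n w. 2 \<le> length p \<longrightarrow>
        fst (hd p) \<in> F False (fst (hd (tl p))) \<and> snd (last p) \<in> F True (snd (last (butlast p))))"

lemma locally_shortest_pathE:
  assumes "p \<in> K.locally_shortest_paths n w" "2 \<le> length p"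
  obtains u v where "K.apath n u p v" "tl p \<in> proper_shortest n w" "butlast p \<in> proper_shortest n w"
  using assms butlast_tl_apath(1,2)[of n _ p]
  unfolding K.locally_shortest_paths_def proper_shortest_def by blast

lemma proper_shortest_ends:
  assumes "p \<in> proper_shortest n w"
  shows "fst (hd p) < n" "snd (last p) < n"
proof -
  obtain u v where "K.apath n u p v" "p \<noteq> []"
    using assms unfolding proper_shortest_def by (blast elim: shortest_path_apathE)
  from apath_path_ends[OF this] show "fst (hd p) < n" "snd (last p) < n"
    by (auto simp: path_ends_def)
qed

text \<open>Paths of length one are counted by their arcs. Every longer one is a left extension of
  the shortest path \<open>tl p\<close>, and there are no more shortest paths than arcs.\<close>

lemma card_locally_shortest_le:
  assumes w: "distinct_costs n w" and F: "extension_bound n w F D"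
  shows "real (card (K.locally_shortest_paths n w)) \<le> real (card (arcs (complete_nat_digraph n))) * (1 + D)"
proof (cases "n = 0")
  case True
  have "K.locally_shortest_paths n w = {}"
  proof (rule equals0I)
    fix p assume "p \<in> K.locally_shortest_paths n w"
    then obtain u v where "K.apath n u p v" "p \<noteq> []" unfolding K.locally_shortest_paths_def by blast
    from apath_path_ends(2)[OF this] True show False by simp
  qed
  moreover have "arcs (complete_nat_digraph n) = {}" using True by simp
  ultimately show ?thesis by (simp only: card.empty)
next
  case False
  let ?A = "arcs (complete_nat_digraph n)" and ?L = "K.locally_shortest_paths n w"
  \<comment> \<open>\<open>D\<close> bounds a cardinality at every vertex; to conclude that it is
    nonnegative a vertex has to exist, hence the separate case of no vertices.\<close>
  have D: "0 \<le> D"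
    using F False unfolding extension_bound_def by (meson neq0_conv of_nat_0_le_iff order_trans)
  have "?L \<subseteq> (\<lambda>a. [a]) ` ?A \<union> {p \<in> ?L. 2 \<le> length p}"
  proof
    fix p assume p: "p \<in> ?L"
    then obtain u v where ap: "K.apath n u p v" "p \<noteq> []" unfolding K.locally_shortest_paths_def by blast
    show "p \<in> (\<lambda>a. [a]) ` ?A \<union> {p \<in> ?L. 2 \<le> length p}"
    proof (cases "2 \<le> length p")
      case False
      moreover have "length p \<noteq> 0" using ap(2) by simp
      ultimately have "length p = 1" by linarith
      then obtain a where "p = [a]" by (auto simp: length_Suc_conv)
      moreover have "set p \<subseteq> ?A" using ap(1) by (simp only: K.apath_def K.awalk_def)
      ultimately have "p = [a]" "a \<in> ?A" by (simp_all only: list.set insert_subset)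
      then show ?thesis by blast
    qed (use p in blast)
  qed
  then have "card ?L \<le> card ((\<lambda>a. [a]) ` ?A \<union> {p \<in> ?L. 2 \<le> length p})"
    by (intro card_mono finite_UnI finite_imageI K.finite_arcs finite_subset[OF _ finite_locally_shortest[of n w]]) auto
  also have "\<dots> \<le> card ((\<lambda>a. [a]) ` ?A) + card {p \<in> ?L. 2 \<le> length p}"
    by (rule card_Un_le)
  also have "card ((\<lambda>a. [a]) ` ?A) \<le> card ?A" by (intro card_image_le K.finite_arcs)
  finally have "real (card ?L) \<le> real (card ?A) + real (card {p \<in> ?L. 2 \<le> length p})"
    by linarith
  also have "real (card {p \<in> ?L. 2 \<le> length p}) \<le> real (card (proper_shortest n w)) * D"
  proof (rule card_left_extensions_le[where n = n and F = "F False"])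
    fix p assume "p \<in> {p \<in> ?L. 2 \<le> length p}"
    then have p: "p \<in> ?L" "2 \<le> length p" by simp_all
    obtain u v where ap: "K.apath n u p v" "tl p \<in> proper_shortest n w"
      using p by (rule locally_shortest_pathE)
    show "(\<exists>u v. K.apath n u p v) \<and> tl p \<noteq> [] \<and> tl p \<in> proper_shortest n w \<and>
        fst (hd p) \<in> F False (fst (hd (tl p)))"
      using F p ap butlast_tl_apath(1)[OF ap(1) p(2)] unfolding extension_bound_def by blast
  next
    fix p assume "p \<in> proper_shortest n w"
    then have "fst (hd p) < n" by (rule proper_shortest_ends)
    then show "finite (F False (fst (hd p))) \<and> real (card (F False (fst (hd p)))) \<le> D"
      using F unfolding extension_bound_def by blast
  qed (rule finite_proper_shortest)
  also have "real (card (proper_shortest n w)) * D \<le> real (card ?A) * D"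
    using card_proper_shortest_le[OF w] D by (intro mult_right_mono) auto
  finally show ?thesis by (simp only: distrib_left mult_1_right)
qed

lemma awalk_cost_update:
  "e \<notin> set p \<Longrightarrow> K.awalk_cost (w(e := x)) p = K.awalk_cost w p"
  by (auto simp: K.awalk_cost_def intro!: arg_cong[where f = sum_list] map_cong)

text \<open>A shortest path avoiding \<open>e\<close> is destroyed only by a new shortest path through \<open>e\<close>.\<close>

lemma card_destroyed_shortest_le:
  assumes w: "distinct_costs n w"
  shows "card {p \<in> proper_shortest n w. e \<notin> set p \<and> \<not> K.shortest_path n (w(e := x)) p}
    \<le> card {p \<in> proper_shortest n (w(e := x)). e \<in> set p}" (is "card ?X \<le> card ?Y")
proof -
  have "path_ends ` ?X \<subseteq> path_ends ` ?Y"
  proof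
    fix r assume "r \<in> path_ends ` ?X"
    then obtain p where r: "r = path_ends p" and p: "p \<in> proper_shortest n w" "e \<notin> set p"
      "\<not> K.shortest_path n (w(e := x)) p" by blast
    obtain u v where ap: "K.apath n u p v" "\<And>q. K.apath n u q v \<Longrightarrow> K.awalk_cost w p \<le> K.awalk_cost w q"
      using p(1) shortest_path_apathE unfolding proper_shortest_def by blast
    have "finite {q. K.apath n u q v}" by (rule K.apaths_finite)
    moreover have "{q. K.apath n u q v} \<noteq> {}" using ap(1) by blast
    ultimately obtain q where q: "is_arg_min (K.awalk_cost (w(e := x))) (\<lambda>q. q \<in> {q. K.apath n u q v}) q"
      using ex_is_arg_min_if_finite by blast
    then have apq: "K.apath n u q v" and q_min: "\<And>r. K.apath n u r v \<Longrightarrow> K.awalk_cost (w(e := x)) q \<le> K.awalk_cost (w(e := x)) r"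
      unfolding is_arg_min_linorder by simp_all
    have short: "K.shortest_path n (w(e := x)) q"
      using q unfolding K.shortest_path_def mem_Collect_eq by blast
    have "p \<noteq> []" using p(1) by (simp add: proper_shortest_def)
    then have "q \<noteq> []" using apq K.apath_ends[OF ap(1) ap(1)] K.apath_nonempty_ends[OF ap(1)]
      by (auto simp: K.apath_Nil_iff)
    \<comment> \<open>Otherwise neither cost has changed and \<open>p\<close> would still be
      shortest.\<close>
    have "e \<in> set q"
    proof (rule ccontr)
      assume "e \<notin> set q"
      have "is_arg_min (K.awalk_cost (w(e := x))) (\<lambda>q. K.apath n u q v) p"
        unfolding is_arg_min_linorder
      proof (intro conjI allI impI ap(1))
        fix r assume "K.apath n u r v"
        have "K.awalk_cost (w(e := x)) p = K.awalk_cost w p" by (rule awalk_cost_update[OF p(2)])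
        also have "\<dots> \<le> K.awalk_cost w q" by (rule ap(2)[OF apq])
        also have "\<dots> = K.awalk_cost (w(e := x)) q" by (rule awalk_cost_update[OF \<open>e \<notin> set q\<close>, symmetric])
        also have "\<dots> \<le> K.awalk_cost (w(e := x)) r" by (rule q_min) fact
        finally show "K.awalk_cost (w(e := x)) p \<le> K.awalk_cost (w(e := x)) r" .
      qed
      then have "K.shortest_path n (w(e := x)) p" unfolding K.shortest_path_def by blast
      with p(3) show False ..
    qed
    moreover have "path_ends q = r"
      using apath_path_ends(1)[OF apq \<open>q \<noteq> []\<close>] apath_path_ends(1)[OF ap(1) \<open>p \<noteq> []\<close>] r by (simp only:)
    ultimately show "r \<in> path_ends ` ?Y"
      using short \<open>q \<noteq> []\<close> unfolding proper_shortest_def by blast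
  qed
  have fin: "finite ?Y" by (rule finite_subset[OF _ finite_proper_shortest]) auto
  \<comment> \<open>Uniqueness is applied under the old weights \<open>w\<close>; under the updated
    weights it is enough that an image is no larger than the set.\<close>
  have "inj_on path_ends ?X"
    by (rule inj_on_subset[OF path_ends_inj_on[OF w]]) auto
  then have "card ?X = card (path_ends ` ?X)" by (rule card_image[symmetric])
  also have "\<dots> \<le> card (path_ends ` ?Y)" using \<open>path_ends ` ?X \<subseteq> _\<close> fin by (intro card_mono finite_imageI)
  also have "\<dots> \<le> card ?Y" by (rule card_image_le[OF fin])
  finally show ?thesis .
qed

text \<open>A destroyed path that avoids \<open>e\<close> loses the minimality of
  \<open>tl p\<close> or of \<open>butlast p\<close>. It is thus a left or right extension of a
  destroyed shortest path that avoids \<open>e\<close>, which gives the factor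
  \<open>2 * D\<close>.\<close>

lemma card_destroyed_le:
  assumes w: "distinct_costs n w" and F: "extension_bound n w F D" and "0 \<le> D"
  shows "real (card (K.locally_shortest_paths n w - K.locally_shortest_paths n (w(e := x)) -
      K.locally_shortest_paths_through n w e))
    \<le> 2 * D * real (card {p \<in> proper_shortest n (w(e := x)). e \<in> set p})"
proof -
  let ?X = "K.locally_shortest_paths n w - K.locally_shortest_paths n (w(e := x)) -
      K.locally_shortest_paths_through n w e"
  let ?S = "{p \<in> proper_shortest n w. e \<notin> set p \<and> \<not> K.shortest_path n (w(e := x)) p}"
  let ?Xl = "{p \<in> ?X. tl p \<in> ?S}" and ?Xr = "{p \<in> ?X. butlast p \<in> ?S}"
  have finX: "finite ?X" using finite_locally_shortest[of n w] by (intro finite_Diff)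
  have finS: "finite ?S" by (rule finite_subset[OF _ finite_proper_shortest[of n w]]) auto
  \<comment> \<open>Empty paths are shortest for all weights, so a path with one arc is always
    locally shortest and cannot be destroyed.\<close>
  have nil: "K.shortest_path n w' p" if "p = []" "n \<noteq> 0" for w' p
  proof -
    have "K.apath n 0 [] 0" using that(2) by (simp add: K.apath_Nil_iff)
    moreover have "q = []" if "K.apath n 0 q 0" for q
      using K.apath_nonempty_ends[OF that] by blast
    ultimately have "is_arg_min (K.awalk_cost w') (\<lambda>q. K.apath n 0 q 0) p"
      unfolding is_arg_min_linorder that(1) by (metis order_refl)
    then show ?thesis unfolding K.shortest_path_def by blast
  qed
  have long: "2 \<le> length p \<and> (tl p \<in> ?S \<or> butlast p \<in> ?S)" if p: "p \<in> ?X" for p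
  proof -
    have e: "e \<notin> set p" using p unfolding K.locally_shortest_paths_through_def by blast
    obtain u v where ap: "p \<noteq> []" "K.apath n u p v" "K.shortest_path n w (tl p)" "K.shortest_path n w (butlast p)"
      using p unfolding K.locally_shortest_paths_def by blast
    have not: "\<not> (K.shortest_path n (w(e := x)) (tl p) \<and> K.shortest_path n (w(e := x)) (butlast p))"
      using p ap unfolding K.locally_shortest_paths_def by blast
    have n: "n \<noteq> 0" using apath_path_ends(2)[OF ap(2,1)] by auto
    have "2 \<le> length p"
    proof (rule ccontr)
      assume "\<not> 2 \<le> length p"
      then have "tl p = []" "butlast p = []" using ap(1) by (cases p; cases "tl p"; auto)+
      with nil[OF _ n] not show False by blast
    qed
    moreover have "tl p \<noteq> []" "butlast p \<noteq> []"
      using butlast_tl_apath(1,2)[OF ap(2) calculation] by auto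
    moreover have "e \<notin> set (tl p)" "e \<notin> set (butlast p)"
      using e by (auto dest: in_set_butlastD list.set_sel(2)[OF ap(1)])
    ultimately show ?thesis using ap not unfolding proper_shortest_def by blast
  qed
  have Fb: "finite (F b v) \<and> real (card (F b v)) \<le> D" if "v < n" for b v
    using F that unfolding extension_bound_def by blast
  have ext: "fst (hd p) \<in> F False (fst (hd (tl p)))" "snd (last p) \<in> F True (snd (last (butlast p)))"
    "\<exists>u v. K.apath n u p v" "tl p \<noteq> []" "butlast p \<noteq> []"
    if p: "p \<in> ?X" for p
  proof -
    have pl: "p \<in> K.locally_shortest_paths n w" using p by blast
    have l: "2 \<le> length p" using long[OF p] by blast
    show "fst (hd p) \<in> F False (fst (hd (tl p)))" "snd (last p) \<in> F True (snd (last (butlast p)))"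
      using F pl l unfolding extension_bound_def by blast+
    from pl l obtain u v where ap: "K.apath n u p v" by (rule locally_shortest_pathE)
    then show "\<exists>u v. K.apath n u p v" by blast
    show "tl p \<noteq> []" "butlast p \<noteq> []" using butlast_tl_apath(1,2)[OF ap l] by auto
  qed
  have "real (card ?Xl) \<le> real (card ?S) * D"
    by (rule card_left_extensions_le[where n = n and F = "F False"])
      (use ext finS Fb proper_shortest_ends in auto)
  moreover have "real (card ?Xr) \<le> real (card ?S) * D"
    by (rule card_right_extensions_le[where n = n and F = "F True"])
      (use ext finS Fb proper_shortest_ends in auto)
  moreover have "card ?X \<le> card ?Xl + card ?Xr"
  proof -
    have "?X \<subseteq> ?Xl \<union> ?Xr" using long by blast
    then have "card ?X \<le> card (?Xl \<union> ?Xr)"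
      by (intro card_mono finite_UnI finite_subset[OF _ finX]) auto
    also have "\<dots> \<le> card ?Xl + card ?Xr" by (rule card_Un_le)
    finally show ?thesis .
  qed
  ultimately have "real (card ?X) \<le> 2 * D * real (card ?S)"
    by (simp add: algebra_simps)
  also have "\<dots> \<le> 2 * D * real (card {p \<in> proper_shortest n (w(e := x)). e \<in> set p})"
    using card_destroyed_shortest_le[OF w, of e x] \<open>0 \<le> D\<close> by (intro mult_left_mono) auto
  finally show ?thesis .
qed

text \<open>Double counting of the incidences between arcs and paths.\<close>

lemma sum_card_through:
  fixes X :: "'a list set"
  assumes "finite X" "finite A" "\<And>p. p \<in> X \<Longrightarrow> real (length p) \<le> l"
  shows "(\<Sum>e\<in>A. real (card {p \<in> X. e \<in> set p})) \<le> real (card X) * l"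
proof -
  have "(\<Sum>e\<in>A. real (card {p \<in> X. e \<in> set p})) = (\<Sum>e\<in>A. \<Sum>p\<in>X. if e \<in> set p then 1 else 0)"
    using assms(1) by (simp add: sum.If_cases Int_def)
  also have "\<dots> = (\<Sum>p\<in>X. \<Sum>e\<in>A. if e \<in> set p then 1 else 0)"
    by (rule sum.swap)
  also have "\<dots> \<le> (\<Sum>p\<in>X. l)"
  proof (rule sum_mono)
    fix p assume p: "p \<in> X"
    have "(\<Sum>e\<in>A. if e \<in> set p then 1 else (0::real)) = real (card (A \<inter> set p))"
      using assms(2) by (simp add: sum.If_cases Int_def)
    also have "\<dots> \<le> real (length p)"
      using card_mono[of "set p" "A \<inter> set p"] card_length[of p] by simp
    also have "\<dots> \<le> l" by (rule assms(3)[OF p])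
    finally show "(\<Sum>e\<in>A. if e \<in> set p then 1 else (0::real)) \<le> l" .
  qed
  finally show ?thesis by simp
qed

section \<open>Typical weights\<close>

definition atypical :: "nat \<Rightarrow> (nat \<times> nat \<Rightarrow> real) set" where
  "atypical n = far_apart n \<union> cheap_long n \<union> (\<Union>T\<in>{id, prod.swap}. \<Union>v\<in>{..<n}. crowded n T v)"

lemma emeasure_atypical:
  assumes n: "n \<ge> 3" "4000 * ln (real n) \<le> real n"
  shows "atypical n \<in> sets (weight_space n)"
    and "emeasure (weight_space n) (atypical n) \<le> ennreal ((1 / real n) ^ 4)"
proof -
  let ?A = "arcs (complete_nat_digraph n)" and ?M = "weight_space n"
  let ?C = "\<Union>T\<in>{id, prod.swap}. \<Union>v\<in>{..<n}. crowded n T v"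
  have "0 \<le> ln (real n)" using n(1) by simp
  then have n': "800 * ln (real n) \<le> real n" using n(2) by linarith
  have T: "T ` ?A \<subseteq> ?A" "inj_on T ?A" if "T \<in> {id, prod.swap}" for T :: "nat \<times> nat \<Rightarrow> nat \<times> nat"
    using that by (auto simp: inj_on_def)
  note cr = emeasure_crowded[OF n _ T]
  have C: "?C \<in> sets ?M" by (intro sets.finite_UN cr(1)) auto
  note F = emeasure_far_apart[OF n(1) n'] and L = emeasure_cheap_long[OF n(1)]
  show "atypical n \<in> sets ?M"
    unfolding atypical_def using F(1) L(1) C by (intro sets.Un)
  have "emeasure ?M ?C \<le> (\<Sum>T\<in>{id, prod.swap}. emeasure ?M (\<Union>v\<in>{..<n}. crowded n T v))"
    by (intro emeasure_subadditive_finite image_subsetI sets.finite_UN cr(1)) auto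
  also have "\<dots> \<le> (\<Sum>T\<in>{id, prod.swap}. \<Sum>v<n. emeasure ?M (crowded n T v))"
    by (intro sum_mono emeasure_subadditive_finite image_subsetI cr(1)) auto
  also have "\<dots> \<le> (\<Sum>T\<in>{id, prod.swap :: nat \<times> nat \<Rightarrow> _}. \<Sum>v<n. ennreal ((1 / real n) ^ 10))"
    by (intro sum_mono cr(2)) auto
  also have "\<dots> = ennreal (real (card {id, prod.swap :: nat \<times> nat \<Rightarrow> _}) * (real n * (1 / real n) ^ 10))"
    unfolding sum_constant card_lessThan by (simp add: ennreal_mult ennreal_of_nat_eq_real_of_nat)
  also have "\<dots> \<le> ennreal ((1 / real n) ^ 5)"
  proof (rule ennreal_leI)
    have "card {id, prod.swap :: nat \<times> nat \<Rightarrow> _} \<le> 2"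
      by (rule order_trans[OF card_insert_le_m1]) auto
    then have "real (card {id, prod.swap :: nat \<times> nat \<Rightarrow> _}) * (real n * (1 / real n) ^ 10)
      \<le> real n * (real n * (1 / real n) ^ 10)"
      using n(1) by (intro mult_right_mono) auto
    also have "\<dots> = (1 / real n) ^ 8"
      using n(1) by (simp add: power_one_over eval_nat_numeral field_simps)
    also have "\<dots> \<le> (1 / real n) ^ 5"
      using n(1) by (intro power_decreasing) auto
    finally show "real (card {id, prod.swap :: nat \<times> nat \<Rightarrow> _}) * (real n * (1 / real n) ^ 10) \<le> (1 / real n) ^ 5" .
  qed
  finally have C_le: "emeasure ?M ?C \<le> ennreal ((1 / real n) ^ 5)" .
  have "emeasure ?M (atypical n) \<le> emeasure ?M (far_apart n \<union> cheap_long n) + emeasure ?M ?C"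
    unfolding atypical_def using F(1) L(1) C by (intro emeasure_subadditive sets.Un)
  also have "\<dots> \<le> (emeasure ?M (far_apart n) + emeasure ?M (cheap_long n)) + emeasure ?M ?C"
    using F(1) L(1) by (intro add_right_mono emeasure_subadditive)
  also have "\<dots> \<le> (ennreal ((1 / real n) ^ 5) + ennreal ((1 / real n) ^ 5)) + ennreal ((1 / real n) ^ 5)"
    by (intro add_mono F(2) L(2) C_le)
  also have "\<dots> = ennreal (3 * (1 / real n) ^ 5)"
    by (simp flip: ennreal_plus)
  also have "\<dots> \<le> ennreal (real n * (1 / real n) ^ 5)"
    using n(1) by (intro ennreal_leI mult_right_mono) auto
  also have "real n * (1 / real n) ^ 5 = (1 / real n) ^ 4"
    using n(1) by (simp add: power_one_over eval_nat_numeral field_simps)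
  finally show "emeasure ?M (atypical n) \<le> ennreal ((1 / real n) ^ 4)" .
qed

lemma proper_shortest_length_less:
  assumes "p \<in> proper_shortest n w"
  shows "length p < n"
proof -
  from assms obtain u v where "K.apath n u p v"
    unfolding proper_shortest_def by (blast elim: shortest_path_apathE)
  from K.length_apath_less[OF this] show ?thesis by simp
qed

text \<open>The cost of a shortest path is a distance and thus at most
  \<open>4000 * ln (real n) / real n\<close>. A long path of this cost would put \<open>w\<close>
  into \<open>cheap_long\<close>, and with nonnegative weights a single arc weighs no more than the
  whole path.\<close>

lemma typical_shortest:
  assumes n: "n \<ge> 3" "4000 * ln (real n) \<le> real n"
    and w: "w \<in> space (weight_space n)" "w \<notin> atypical n"
      "\<And>a. a \<in> arcs (complete_nat_digraph n) \<Longrightarrow> 0 \<le> w a"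
    and p: "p \<in> proper_shortest n w"
  shows "real (length p) \<le> 12010 * ln (real n)"
    and "a \<in> set p \<Longrightarrow> w a \<le> 4000 * ln (real n) / real n"
proof -
  let ?c = "4000 * ln (real n) / real n"
  have "0 \<le> ln (real n)" using n(1) by simp
  then have n': "800 * ln (real n) \<le> real n" using n(2) by linarith
  from p have ne: "p \<noteq> []" and sp: "K.shortest_path n w p" by (simp_all add: proper_shortest_def)
  from sp obtain u v where ap: "K.apath n u p v"
    and mu: "ereal (K.awalk_cost w p) = K.\<mu> n w u v"
    using K.shortest_path_iff_\<mu>[THEN iffD1, OF w(3) sp] by blast
  have uv: "u < n" "v < n" using apath_path_ends(2)[OF ap ne] by auto
  have "dist_le n w ?c u v"
    using w(1,2) by (intro dist_le_if_not_far_apart n(1) n' uv) (auto simp: atypical_def)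
  then obtain q where "K.awalk n u q v" "K.awalk_cost w q \<le> ?c" unfolding dist_le_def by blast
  with K.min_cost_le_walk_cost[of n u q v w] mu have cost: "K.awalk_cost w p \<le> ?c"
    by (metis ereal_less_eq(3) order_trans)
  show "real (length p) \<le> 12010 * ln (real n)"
  proof (rule ccontr)
    assume "\<not> real (length p) \<le> 12010 * ln (real n)"
    then have "12010 * ln (real n) \<le> real (length p)" by simp
    with ap cost w(1) have "w \<in> cheap_long n" unfolding cheap_long_def by blast
    with w(2) show False by (simp add: atypical_def)
  qed
  show "w a \<le> ?c" if a: "a \<in> set p"
  proof -
    have nonneg: "0 \<le> w b" if "b \<in> set p" for b
      using apath_distinct_arcs(2)[OF ap] that w(3) by blast
    have "w a \<le> (\<Sum>b\<in>set p. w b)"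
      using nonneg a by (intro member_le_sum) auto
    also have "\<dots> = K.awalk_cost w p"
      using apath_distinct_arcs(1)[OF ap] by (rule awalk_cost_eq_sum[symmetric])
    finally show ?thesis using cost by simp
  qed
qed

text \<open>The fallback on atypical weights, where the factor \<open>n\<close> is paid for by the
  small probability.\<close>

lemma extension_bound_trivial: "extension_bound n w (\<lambda>_ _. {..<n}) (real n)"
  unfolding extension_bound_def
proof (intro conjI allI impI ballI)
  fix p assume p: "p \<in> K.locally_shortest_paths n w" "2 \<le> length p"
  then obtain u v where ap: "K.apath n u p v" by (rule locally_shortest_pathE)
  then have "set p \<subseteq> arcs (complete_nat_digraph n)" by (rule apath_distinct_arcs)
  moreover have "p \<noteq> []" using p(2) by auto
  then have "hd p \<in> set p" "last p \<in> set p" by simp_all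
  ultimately have "hd p \<in> arcs (complete_nat_digraph n)" "last p \<in> arcs (complete_nat_digraph n)" by blast+
  then show "fst (hd p) \<in> {..<n}" "snd (last p) \<in> {..<n}" by auto
qed auto

text \<open>The first arc lies on the shortest path \<open>butlast p\<close> and the last one on the
  shortest path \<open>tl p\<close>, so both are light. The first arc enters the second vertex,
  therefore \<open>prod.swap\<close> selects the incoming arcs there.\<close>

lemma typical_extension_bound:
  assumes n: "n \<ge> 3" "4000 * ln (real n) \<le> real n"
    and w: "w \<in> space (weight_space n)" "w \<notin> atypical n"
      "\<And>a. a \<in> arcs (complete_nat_digraph n) \<Longrightarrow> 0 \<le> w a"
  shows "extension_bound n w (\<lambda>b. light_ends n (if b then id else prod.swap) w) (8010 * ln (real n))"
  unfolding extension_bound_def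
proof (intro conjI allI impI ballI)
  fix b v assume v: "v < n"
  let ?T = "if b then id else prod.swap :: nat \<times> nat \<Rightarrow> nat \<times> nat"
  have "w \<notin> crowded n ?T v"
    using w(2) v by (auto simp: atypical_def)
  then show "real (card (light_ends n ?T w v)) \<le> 8010 * ln (real n)"
    using w(1) by (simp add: crowded_def)
  show "finite (light_ends n ?T w v)" by (simp add: light_ends_def)
next
  fix p assume p: "p \<in> K.locally_shortest_paths n w" "2 \<le> length p"
  then obtain u v where ap: "K.apath n u p v"
    and sp: "tl p \<in> proper_shortest n w" "butlast p \<in> proper_shortest n w"
    by (rule locally_shortest_pathE)
  note d = butlast_tl_apath[OF ap p(2)]
  obtain z v where h: "hd p = (z, v)" by (cases "hd p")
  have "(z, v) \<in> arcs (complete_nat_digraph n)" using d(7) unfolding h .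
  moreover have "w (z, v) \<le> 4000 * ln (real n) / real n"
    using typical_shortest(2)[OF n w sp(2), of "hd p"] d(5) unfolding h by blast
  moreover have "fst (hd (tl p)) = v" using d(3) unfolding h by simp
  ultimately show "fst (hd p) \<in> light_ends n (if False then id else prod.swap) w (fst (hd (tl p)))"
    unfolding h by (simp add: light_ends_def)
  obtain v' z' where l: "last p = (v', z')" by (cases "last p")
  have "(v', z') \<in> arcs (complete_nat_digraph n)" using d(8) unfolding l .
  moreover have "w (v', z') \<le> 4000 * ln (real n) / real n"
    using typical_shortest(2)[OF n w sp(1), of "last p"] d(6) unfolding l by blast
  moreover have "snd (last (butlast p)) = v'" using d(4) unfolding l by simp
  ultimately show "snd (last p) \<in> light_ends n (if True then id else prod.swap) w (snd (last (butlast p)))"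
    unfolding l by (simp add: light_ends_def)
qed

text \<open>A locally shortest path has at most one arc more than a shortest path, hence the factor
  \<open>1 + l\<close> in the first sum.\<close>

lemma sum_card_through_le:
  assumes w: "distinct_costs n w" and F: "extension_bound n w F D" and D: "0 \<le> D"
    and l: "0 \<le> l" "\<And>p. p \<in> proper_shortest n w \<Longrightarrow> real (length p) \<le> l"
  shows "(\<Sum>e\<in>arcs (complete_nat_digraph n). real (card (K.locally_shortest_paths_through n w e)))
    \<le> real (card (arcs (complete_nat_digraph n))) * (1 + D) * (1 + l)"
    and "(\<Sum>e\<in>arcs (complete_nat_digraph n). real (card {p \<in> proper_shortest n w. e \<in> set p}))
    \<le> real (card (arcs (complete_nat_digraph n))) * l"
proof -
  let ?A = "arcs (complete_nat_digraph n)"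
  have "real (length p) \<le> 1 + l" if p: "p \<in> K.locally_shortest_paths n w" for p
  proof (cases "2 \<le> length p")
    case True
    with p obtain u v where "tl p \<in> proper_shortest n w" by (rule locally_shortest_pathE)
    from l(2)[OF this] show ?thesis by simp
  qed (use l(1) in linarith)
  then have "(\<Sum>e\<in>?A. real (card {p \<in> K.locally_shortest_paths n w. e \<in> set p})) \<le>
      real (card (K.locally_shortest_paths n w)) * (1 + l)"
    by (rule sum_card_through[OF finite_locally_shortest K.finite_arcs])
  also have "\<dots> \<le> (real (card ?A) * (1 + D)) * (1 + l)"
    using card_locally_shortest_le[OF w F] l(1) by (intro mult_right_mono) auto
  finally show "(\<Sum>e\<in>?A. real (card (K.locally_shortest_paths_through n w e))) \<le> real (card ?A) * (1 + D) * (1 + l)"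
    unfolding K.locally_shortest_paths_through_def .
  have "(\<Sum>e\<in>?A. real (card {p \<in> proper_shortest n w. e \<in> set p})) \<le> real (card (proper_shortest n w)) * l"
    by (rule sum_card_through[OF finite_proper_shortest K.finite_arcs l(2)])
  also have "\<dots> \<le> real (card ?A) * l"
    using card_proper_shortest_le[OF w] l(1) by (intro mult_right_mono of_nat_mono)
  finally show "(\<Sum>e\<in>?A. real (card {p \<in> proper_shortest n w. e \<in> set p})) \<le> real (card ?A) * l" .
qed

section \<open>Exchanging the old and the new weight\<close>

text \<open>Writing the random edge as a finite average allows the weights to be exchanged for one
  fixed edge at a time.\<close>

lemma nn_integral_update_space:
  assumes n: "n \<ge> 2" and f: "f \<in> borel_measurable (update_space n)"
  shows "(\<integral>\<^sup>+\<omega>. f \<omega> \<partial>update_space n) = ennreal (1 / real (card (arcs (complete_nat_digraph n)))) *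
    (\<Sum>e\<in>arcs (complete_nat_digraph n). \<integral>\<^sup>+w. \<integral>\<^sup>+x. f (w, e, x) \<partial>uniform01 \<partial>weight_space n)"
proof -
  let ?A = "arcs (complete_nat_digraph n)" and ?M = "weight_space n"
  let ?\<kappa> = "ennreal (1 / real (card ?A))"
  let ?E = "uniform_count_measure ?A"
  have "(0, 1) \<in> ?A" using n by simp
  then interpret E: prob_space ?E
    by (intro prob_space_uniform_count_measure K.finite_arcs) blast
  interpret EU: pair_sigma_finite ?E uniform01 ..
  have f': "f \<in> borel_measurable (?M \<Otimes>\<^sub>M (?E \<Otimes>\<^sub>M uniform01))"
    using f unfolding update_space_def weight_space_def .
  have sec: "(\<lambda>(w, x). f (w, e, x)) \<in> borel_measurable (?M \<Otimes>\<^sub>M uniform01)" if e: "e \<in> ?A" for e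
  proof -
    have "(\<lambda>q. (fst q, e, snd q)) \<in> ?M \<Otimes>\<^sub>M uniform01 \<rightarrow>\<^sub>M ?M \<Otimes>\<^sub>M (?E \<Otimes>\<^sub>M uniform01)"
      using e by (intro measurable_Pair measurable_fst measurable_snd measurable_const)
        (simp only: space_uniform_count_measure)
    from measurable_compose[OF this f'] show ?thesis by (simp add: case_prod_unfold)
  qed
  have inner: "(\<lambda>w. \<integral>\<^sup>+x. f (w, e, x) \<partial>uniform01) \<in> borel_measurable ?M" if "e \<in> ?A" for e
    using U.borel_measurable_nn_integral[OF sec[OF that]] .
  have "(\<integral>\<^sup>+\<omega>. f \<omega> \<partial>update_space n) = (\<integral>\<^sup>+w. \<integral>\<^sup>+r. f (w, r) \<partial>(?E \<Otimes>\<^sub>M uniform01) \<partial>?M)"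
    using EU.nn_integral_fst[OF f'] unfolding update_space_def weight_space_def by simp
  also have "\<dots> = (\<integral>\<^sup>+w. (\<Sum>e\<in>?A. ?\<kappa> * (\<integral>\<^sup>+x. f (w, e, x) \<partial>uniform01)) \<partial>?M)"
  proof (rule nn_integral_cong)
    fix w assume w: "w \<in> space ?M"
    have "(\<lambda>r. f (w, r)) \<in> borel_measurable (?E \<Otimes>\<^sub>M uniform01)"
      using f' w by (rule measurable_Pair2)
    from U.nn_integral_fst[OF this]
    have "(\<integral>\<^sup>+r. f (w, r) \<partial>(?E \<Otimes>\<^sub>M uniform01)) = (\<integral>\<^sup>+e. \<integral>\<^sup>+x. f (w, e, x) \<partial>uniform01 \<partial>?E)"
      by simp
    also have "\<dots> = (\<Sum>e\<in>?A. ?\<kappa> * (\<integral>\<^sup>+x. f (w, e, x) \<partial>uniform01))"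
      unfolding uniform_count_measure_def by (rule nn_integral_point_measure_finite[OF K.finite_arcs])
    finally show "(\<integral>\<^sup>+r. f (w, r) \<partial>(?E \<Otimes>\<^sub>M uniform01)) = (\<Sum>e\<in>?A. ?\<kappa> * (\<integral>\<^sup>+x. f (w, e, x) \<partial>uniform01))" .
  qed
  also have "\<dots> = (\<Sum>e\<in>?A. \<integral>\<^sup>+w. ?\<kappa> * (\<integral>\<^sup>+x. f (w, e, x) \<partial>uniform01) \<partial>?M)"
    by (intro nn_integral_sum borel_measurable_times_ennreal inner) simp_all
  also have "\<dots> = (\<Sum>e\<in>?A. ?\<kappa> * (\<integral>\<^sup>+w. \<integral>\<^sup>+x. f (w, e, x) \<partial>uniform01 \<partial>?M))"
    by (intro sum.cong refl nn_integral_cmult inner)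
  finally show ?thesis unfolding sum_distrib_left .
qed

text \<open>With coordinate \<open>e\<close> split off, the old weight \<open>y\<close> and the new
  weight \<open>x\<close> are two independent variables with the same distribution, and Fubini swaps
  them.\<close>

lemma nn_integral_exchange_weight:
  assumes e: "e \<in> arcs (complete_nat_digraph n)"
    and f: "f \<in> borel_measurable (weight_space n \<Otimes>\<^sub>M uniform01)"
  shows "(\<integral>\<^sup>+w. \<integral>\<^sup>+x. f (w(e := x), w e) \<partial>uniform01 \<partial>weight_space n) =
    (\<integral>\<^sup>+w. \<integral>\<^sup>+x. f (w, x) \<partial>uniform01 \<partial>weight_space n)"
proof -
  let ?M = "weight_space n" and ?A = "arcs (complete_nat_digraph n)"
  define B where "B = ?A - {e}"
  have A: "?A = insert e B" using e by (auto simp only: B_def)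
  have B: "finite B" "e \<notin> B" using K.finite_arcs by (auto simp only: B_def finite_Diff)
  let ?N = "Pi\<^sub>M B (\<lambda>_. uniform01)"
  have split: "(\<integral>\<^sup>+w. g w \<partial>?M) = (\<integral>\<^sup>+z. \<integral>\<^sup>+y. g (z(e := y)) \<partial>uniform01 \<partial>?N)"
    if "g \<in> borel_measurable ?M" for g
    using that unfolding weight_space_def A by (rule UP.product_nn_integral_insert[OF B])
  have upd: "(\<lambda>q. ((fst q)(e := snd q), fst q e)) \<in> ?M \<Otimes>\<^sub>M uniform01 \<rightarrow>\<^sub>M ?M \<Otimes>\<^sub>M uniform01"
    unfolding weight_space_def
  proof (intro measurable_Pair measurable_fun_upd[where J = ?A] measurable_fst measurable_snd)
    show "?A = ?A \<union> {e}" using e by blast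
    show "(\<lambda>q. fst q e) \<in> Pi\<^sub>M ?A (\<lambda>_. uniform01) \<Otimes>\<^sub>M uniform01 \<rightarrow>\<^sub>M uniform01"
      by (rule measurable_compose[OF measurable_fst measurable_component_singleton[OF e]])
  qed
  have m1: "(\<lambda>w. \<integral>\<^sup>+x. f (w(e := x), w e) \<partial>uniform01) \<in> borel_measurable ?M"
    using measurable_compose[OF upd f]
    by (intro U.borel_measurable_nn_integral) (simp add: case_prod_unfold)
  have m2: "(\<lambda>w. \<integral>\<^sup>+x. f (w, x) \<partial>uniform01) \<in> borel_measurable ?M"
    using f by (intro U.borel_measurable_nn_integral) (simp add: case_prod_unfold)
  interpret UU: pair_sigma_finite uniform01 uniform01 ..
  have "(\<integral>\<^sup>+w. \<integral>\<^sup>+x. f (w(e := x), w e) \<partial>uniform01 \<partial>?M) =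
      (\<integral>\<^sup>+z. \<integral>\<^sup>+y. \<integral>\<^sup>+x. f (z(e := x), y) \<partial>uniform01 \<partial>uniform01 \<partial>?N)"
    using split[OF m1] by (simp only: fun_upd_upd fun_upd_same)
  also have "\<dots> = (\<integral>\<^sup>+z. \<integral>\<^sup>+x. \<integral>\<^sup>+y. f (z(e := x), y) \<partial>uniform01 \<partial>uniform01 \<partial>?N)"
  proof (rule nn_integral_cong)
    fix z assume z: "z \<in> space ?N"
    have "(\<lambda>q. (z(e := fst q), snd q)) \<in> uniform01 \<Otimes>\<^sub>M uniform01 \<rightarrow>\<^sub>M ?M \<Otimes>\<^sub>M uniform01"
      unfolding weight_space_def
    proof (intro measurable_Pair measurable_fun_upd[where J = B] measurable_fst measurable_snd measurable_const z)
      show "?A = B \<union> {e}" using A by blast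
    qed
    from measurable_compose[OF this f]
    have "case_prod (\<lambda>x y. f (z(e := x), y)) \<in> borel_measurable (uniform01 \<Otimes>\<^sub>M uniform01)"
      by (simp add: case_prod_unfold)
    from UU.Fubini'[OF this]
    show "(\<integral>\<^sup>+y. \<integral>\<^sup>+x. f (z(e := x), y) \<partial>uniform01 \<partial>uniform01) =
        (\<integral>\<^sup>+x. \<integral>\<^sup>+y. f (z(e := x), y) \<partial>uniform01 \<partial>uniform01)" .
  qed
  also have "\<dots> = (\<integral>\<^sup>+w. \<integral>\<^sup>+x. f (w, x) \<partial>uniform01 \<partial>?M)"
    by (rule split[OF m2, symmetric])
  finally show ?thesis .
qed

text \<open>The reverse update restores \<open>w\<close>, so what one update creates the other
  destroys.\<close>

lemma lsp_plus_eq_lsp_minus: "K.lsp_plus n w e x = K.lsp_minus n (w(e := x)) e (w e)"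
  by (simp add: K.lsp_plus_def K.lsp_minus_def)

lemma borel_measurable_update_section:
  assumes f: "f \<in> borel_measurable (update_space n)" and e: "e \<in> arcs (complete_nat_digraph n)"
  shows "(\<lambda>(w, x). f (w, e, x)) \<in> borel_measurable (weight_space n \<Otimes>\<^sub>M uniform01)"
proof -
  let ?E = "uniform_count_measure (arcs (complete_nat_digraph n))"
  have f': "f \<in> borel_measurable (weight_space n \<Otimes>\<^sub>M (?E \<Otimes>\<^sub>M uniform01))"
    using f unfolding update_space_def weight_space_def .
  have "(\<lambda>q. (fst q, e, snd q)) \<in> weight_space n \<Otimes>\<^sub>M uniform01 \<rightarrow>\<^sub>M weight_space n \<Otimes>\<^sub>M (?E \<Otimes>\<^sub>M uniform01)"
    using e by (intro measurable_Pair measurable_fst measurable_snd measurable_const)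
      (simp only: space_uniform_count_measure)
  from measurable_compose[OF this f'] show ?thesis by (simp add: case_prod_unfold)
qed

lemma borel_measurable_card_lsp_minus:
  assumes "n \<ge> 2"
  shows "(\<lambda>(w, e, x). ennreal (real (card (K.lsp_minus n w e x)))) \<in> borel_measurable (update_space n)"
proof -
  have "(\<lambda>(w, e, x). real (card (K.lsp_minus n w e x))) \<in> borel_measurable (update_space n)"
    using integrable_lsp_minus[OF assms] by (rule borel_measurable_integrable)
  from measurable_compose[OF this measurable_ennreal] show ?thesis by (simp add: case_prod_unfold)
qed

lemma borel_measurable_card_lsp_plus:
  assumes "n \<ge> 2"
  shows "(\<lambda>(w, e, x). ennreal (real (card (K.lsp_plus n w e x)))) \<in> borel_measurable (update_space n)"
proof -
  have "(\<lambda>(w, e, x). real (card (K.lsp_plus n w e x))) \<in> borel_measurable (update_space n)"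
    using integrable_lsp_plus[OF assms] by (rule borel_measurable_integrable)
  from measurable_compose[OF this measurable_ennreal] show ?thesis by (simp add: case_prod_unfold)
qed

text \<open>For nonnegative integrals Fubini and the exchange need measurability only.\<close>

lemma integral_eq_enn2real:
  assumes "integrable M (\<lambda>(w, e, x). real (g w e x))"
  shows "(\<integral>(w, e, x). real (g w e x) \<partial>M) = enn2real (\<integral>\<^sup>+(w, e, x). ennreal (real (g w e x)) \<partial>M)"
proof -
  have "(\<integral>(w, e, x). real (g w e x) \<partial>M) = enn2real (\<integral>\<^sup>+\<omega>. ennreal (case \<omega> of (w, e, x) \<Rightarrow> real (g w e x)) \<partial>M)"
    using assms by (intro integral_eq_nn_integral) (auto simp: case_prod_unfold)
  then show ?thesis by (simp add: case_prod_unfold)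
qed

lemma expectation_lsp_minus_eq_lsp_plus:
  assumes n: "n \<ge> 2"
  shows "(\<integral>(w, e, x). real (card (K.lsp_minus n w e x)) \<partial>update_space n) =
    (\<integral>(w, e, x). real (card (K.lsp_plus n w e x)) \<partial>update_space n)"
proof -
  let ?A = "arcs (complete_nat_digraph n)"
  have "(\<integral>\<^sup>+w. \<integral>\<^sup>+x. ennreal (real (card (K.lsp_plus n w e x))) \<partial>uniform01 \<partial>weight_space n) =
      (\<integral>\<^sup>+w. \<integral>\<^sup>+x. ennreal (real (card (K.lsp_minus n w e x))) \<partial>uniform01 \<partial>weight_space n)"
    if e: "e \<in> ?A" for e
    using nn_integral_exchange_weight[OF e
        borel_measurable_update_section[OF borel_measurable_card_lsp_minus[OF n] e]]
    by (simp only: prod.case lsp_plus_eq_lsp_minus)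
  then have "(\<integral>\<^sup>+(w, e, x). ennreal (real (card (K.lsp_plus n w e x))) \<partial>update_space n) =
      (\<integral>\<^sup>+(w, e, x). ennreal (real (card (K.lsp_minus n w e x))) \<partial>update_space n)"
    unfolding nn_integral_update_space[OF n borel_measurable_card_lsp_plus[OF n]]
      nn_integral_update_space[OF n borel_measurable_card_lsp_minus[OF n]] prod.case
    by (intro arg_cong2[where f = "(*)"] refl sum.cong) simp_all
  then show ?thesis
    unfolding integral_eq_enn2real[OF integrable_lsp_minus[OF n]]
      integral_eq_enn2real[OF integrable_lsp_plus[OF n]] by (simp only:)
qed

lemma borel_measurable_card_through:
  "(\<lambda>w. real (card (K.locally_shortest_paths_through n w e))) \<in> borel_measurable (weight_space n)"
proof (rule borel_measurable_integrable[OF W.integrable_card[OF K.finite_apaths[of n]]])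
  show "K.locally_shortest_paths_through n w e \<subseteq> {p. \<exists>u v. K.apath n u p v}" for w
    by (auto simp: K.locally_shortest_paths_through_def K.locally_shortest_paths_def)
  have "Measurable.pred (weight_space n) (\<lambda>w. p \<in> K.locally_shortest_paths n w)" for p
    by (intro K.pred_locally_shortest measurable_weight)
  then show "Measurable.pred (weight_space n) (\<lambda>w. p \<in> K.locally_shortest_paths_through n w e)" for p
    unfolding K.locally_shortest_paths_through_def mem_Collect_eq by (cases "e \<in> set p") simp_all
qed

lemma borel_measurable_card_shortest_through:
  "(\<lambda>w. real (card {p \<in> proper_shortest n w. e \<in> set p})) \<in> borel_measurable (weight_space n)"
proof (rule borel_measurable_integrable[OF W.integrable_card[OF K.finite_apaths[of n]]])
  show "{p \<in> proper_shortest n w. e \<in> set p} \<subseteq> {p. \<exists>u v. K.apath n u p v}" for w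
    unfolding proper_shortest_def by (blast elim: shortest_path_apathE)
  have "Measurable.pred (weight_space n) (\<lambda>w. K.shortest_path n w p)" for p
    by (intro K.pred_shortest_path measurable_weight)
  then show "Measurable.pred (weight_space n) (\<lambda>w. p \<in> {p \<in> proper_shortest n w. e \<in> set p})" for p
    unfolding proper_shortest_def mem_Collect_eq by (cases "e \<in> set p"; cases "p = []") simp_all
qed

text \<open>Splits an expectation into a bound \<open>b\<close> for typical weights and a surcharge
  \<open>c\<close> on the exceptional event \<open>B\<close>.\<close>

lemma nn_integral_weight_space_le:
  assumes B: "B \<in> sets (weight_space n)" "emeasure (weight_space n) B \<le> ennreal P"
    and c: "0 \<le> b" "0 \<le> c" "0 \<le> P"
    and f: "AE w in weight_space n. f w \<le> b + c * indicator B w"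
  shows "(\<integral>\<^sup>+w. ennreal (f w) \<partial>weight_space n) \<le> ennreal (b + c * P)"
proof -
  have "(\<integral>\<^sup>+w. ennreal (f w) \<partial>weight_space n) \<le>
      (\<integral>\<^sup>+w. ennreal b + ennreal c * indicator B w \<partial>weight_space n)"
  proof (rule nn_integral_mono_AE)
    show "AE w in weight_space n. ennreal (f w) \<le> ennreal b + ennreal c * indicator B w"
      using f
    proof eventually_elim
      case (elim w)
      then have "ennreal (f w) \<le> ennreal (b + c * indicator B w)" by (rule ennreal_leI)
      also have "\<dots> = ennreal b + ennreal c * indicator B w"
        using c by (auto simp: indicator_def ennreal_plus)
      finally show ?case .
    qed
  qed
  also have "\<dots> = ennreal b + ennreal c * emeasure (weight_space n) B"
    using B(1) by (subst nn_integral_add) (auto simp: nn_integral_cmult_indicator W.emeasure_space_1)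
  also have "\<dots> \<le> ennreal b + ennreal c * ennreal P"
    by (intro add_left_mono mult_left_mono B(2)) simp
  also have "\<dots> = ennreal (b + c * P)"
    using c by (simp add: ennreal_mult ennreal_plus)
  finally show ?thesis .
qed

section \<open>The bound for the expectation\<close>

text \<open>For a fixed edge, the paths through it and the other destroyed paths are bounded
  separately; summation over the edges then leads to incidence counts. The event \<open>B\<close>
  refers to the initial weights, and the count \<open>R\<close> of new shortest paths is moved to
  the initial weights by the exchange.\<close>

lemma expectation_lsp_minus_le:
  assumes n: "n \<ge> 3" "4000 * ln (real n) \<le> real n"
  shows "(\<integral>(w, e, x). real (card (K.lsp_minus n w e x)) \<partial>update_space n) \<le> 10 ^ 10 * (ln (real n))\<^sup>2"
proof -
  let ?M = "weight_space n" and ?A = "arcs (complete_nat_digraph n)"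
  define B where "B = atypical n"
  define P where "P = (1 / real n) ^ 4"
  define D where "D = 8010 * ln (real n)"
  define l where "l = 12010 * ln (real n)"
  define a where "a = real (card ?A)"
  define Q where "Q = (\<lambda>e w. real (card (K.locally_shortest_paths_through n w e)))"
  define R where "R = (\<lambda>e w. real (card {p \<in> proper_shortest n w. e \<in> set p}))"
  have "exp (1::real) \<le> real n"
    using exp_le n(1) by linarith
  then have ln1: "1 \<le> ln (real n)"
    using n(1) by (subst ln_ge_iff) auto
  have n2: "n \<ge> 2" using n(1) by simp
  have D0: "0 \<le> D" and l0: "0 \<le> l" and P0: "0 \<le> P" and a0: "0 \<le> a"
    using ln1 by (simp_all add: D_def l_def P_def a_def)
  have B: "B \<in> sets ?M" "emeasure ?M B \<le> ennreal P"
    unfolding B_def P_def by (rule emeasure_atypical[OF n])+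
  have typical: "AE w in ?M. w \<in> space ?M \<and> (\<forall>a\<in>?A. 0 \<le> w a) \<and> distinct_costs n w"
    using AE_weight_space[of n] AE_distinct_costs[of n] AE_space[of ?M]
    by eventually_elim blast
  have measQ: "Q e \<in> borel_measurable ?M" and measR: "R e \<in> borel_measurable ?M" for e
    unfolding Q_def R_def by (rule borel_measurable_card_through borel_measurable_card_shortest_through)+
  have single: "(\<integral>\<^sup>+w. \<integral>\<^sup>+x. ennreal (real (card (K.lsp_minus n w e x))) \<partial>uniform01 \<partial>?M) \<le>
      (\<integral>\<^sup>+w. ennreal (Q e w) \<partial>?M) + ennreal (2 * D) * (\<integral>\<^sup>+w. ennreal (R e w) \<partial>?M) +
        ennreal (a * (1 + real n) * P)"
    if e: "e \<in> ?A" for e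
  proof -
    have measR2: "(\<lambda>(w, x). ennreal (R e w)) \<in> borel_measurable (?M \<Otimes>\<^sub>M uniform01)"
      using measurable_compose[OF measurable_fst measurable_compose[OF measR[of e] measurable_ennreal]]
      by (simp add: case_prod_unfold)
    have upd: "(\<lambda>q. (fst q)(e := snd q)) \<in> ?M \<Otimes>\<^sub>M uniform01 \<rightarrow>\<^sub>M ?M"
      unfolding weight_space_def
      by (rule measurable_fun_upd[where J = ?A]) (use e in \<open>auto simp only: measurable_fst measurable_snd\<close>)
    from measurable_compose[OF upd measurable_compose[OF measR[of e] measurable_ennreal]]
    have measR3: "(\<lambda>(w, x). ennreal (R e (w(e := x)))) \<in> borel_measurable (?M \<Otimes>\<^sub>M uniform01)"
      by (simp add: case_prod_unfold)
    have measR4: "(\<lambda>x. ennreal (R e (w(e := x)))) \<in> borel_measurable uniform01" if "w \<in> space ?M" for w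
      using measurable_Pair2[OF measR3 that] by simp
    have measR5: "(\<lambda>w. \<integral>\<^sup>+x. ennreal (R e (w(e := x))) \<partial>uniform01) \<in> borel_measurable ?M"
      using measR3 by (rule U.borel_measurable_nn_integral)
    have "(\<integral>\<^sup>+w. \<integral>\<^sup>+x. ennreal (real (card (K.lsp_minus n w e x))) \<partial>uniform01 \<partial>?M) \<le>
      (\<integral>\<^sup>+w. (ennreal (Q e w) + ennreal (2 * D) * (\<integral>\<^sup>+x. ennreal (R e (w(e := x))) \<partial>uniform01)) +
        ennreal (a * (1 + real n)) * indicator B w \<partial>?M)"
    proof (rule nn_integral_mono_AE)
      show "AE w in ?M. (\<integral>\<^sup>+x. ennreal (real (card (K.lsp_minus n w e x))) \<partial>uniform01) \<le>
        (ennreal (Q e w) + ennreal (2 * D) * (\<integral>\<^sup>+x. ennreal (R e (w(e := x))) \<partial>uniform01)) +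
        ennreal (a * (1 + real n)) * indicator B w"
        using typical
      proof eventually_elim
        case (elim w)
        then have w: "w \<in> space ?M" "\<And>a. a \<in> ?A \<Longrightarrow> 0 \<le> w a" "distinct_costs n w" by blast+
        \<comment> \<open>\<open>Q\<close> counts the paths that contained \<open>e\<close>. The
          other destroyed paths are charged to new shortest paths through \<open>e\<close> or, if
          \<open>w\<close> is atypical, crudely to all locally shortest paths.\<close>
        have pw: "real (card (K.lsp_minus n w e x)) \<le> Q e w + 2 * D * R e (w(e := x)) +
            a * (1 + real n) * indicator B w" for x
        proof -
          let ?X = "K.locally_shortest_paths n w - K.locally_shortest_paths n (w(e := x)) -
            K.locally_shortest_paths_through n w e"
          have "card (K.lsp_minus n w e x) \<le> card (K.locally_shortest_paths_through n w e \<union> ?X)"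
          proof (rule card_mono)
            show "finite (K.locally_shortest_paths_through n w e \<union> ?X)"
              unfolding K.locally_shortest_paths_through_def
              by (rule finite_subset[OF _ finite_locally_shortest[of n w]]) blast
          qed (unfold K.lsp_minus_def, blast)
          also have "\<dots> \<le> card (K.locally_shortest_paths_through n w e) + card ?X"
            by (rule card_Un_le)
          finally have le: "real (card (K.lsp_minus n w e x)) \<le> Q e w + real (card ?X)"
            unfolding Q_def by linarith
          have R0: "0 \<le> 2 * D * R e (w(e := x))" using D0 by (simp add: R_def)
          show ?thesis
          proof (cases "w \<in> B")
            case True
            have "real (card ?X) \<le> real (card (K.locally_shortest_paths n w))"
              by (intro of_nat_mono card_mono finite_locally_shortest) blast
            also have "\<dots> \<le> a * (1 + real n)"
              unfolding a_def by (rule card_locally_shortest_le[OF w(3) extension_bound_trivial])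
            finally show ?thesis using le R0 True by simp
          next
            case False
            have "extension_bound n w (\<lambda>b. light_ends n (if b then id else prod.swap) w) D"
              unfolding D_def using w False n by (intro typical_extension_bound) (auto simp only: B_def)
            from card_destroyed_le[OF w(3) this D0, of e x]
            have "real (card ?X) \<le> 2 * D * R e (w(e := x))" by (simp only: R_def)
            then show ?thesis using le False by simp
          qed
        qed
        have "(\<integral>\<^sup>+x. ennreal (real (card (K.lsp_minus n w e x))) \<partial>uniform01) \<le>
          (\<integral>\<^sup>+x. ennreal (Q e w) + ennreal (2 * D) * ennreal (R e (w(e := x))) +
            ennreal (a * (1 + real n)) * indicator B w \<partial>uniform01)"
        proof (rule nn_integral_mono)
          fix x
          have "ennreal (real (card (K.lsp_minus n w e x))) \<le>
              ennreal (Q e w + 2 * D * R e (w(e := x)) + a * (1 + real n) * indicator B w)"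
            by (rule ennreal_leI[OF pw])
          also have "\<dots> = ennreal (Q e w) + ennreal (2 * D) * ennreal (R e (w(e := x))) +
            ennreal (a * (1 + real n)) * indicator B w"
          proof -
            have "0 \<le> 2 * D * R e (w(e := x))" "0 \<le> Q e w" "0 \<le> R e (w(e := x))"
              using D0 by (simp_all add: R_def Q_def)
            moreover have "ennreal (a * (1 + real n) * indicator B w) = ennreal (a * (1 + real n)) * indicator B w"
              by (simp add: indicator_def)
            moreover have "0 \<le> a * (1 + real n) * indicator B w" using a0 by simp
            ultimately show ?thesis using D0 by (simp only: ennreal_plus ennreal_mult add_nonneg_nonneg mult_nonneg_nonneg)
          qed
          finally show "ennreal (real (card (K.lsp_minus n w e x))) \<le>
            ennreal (Q e w) + ennreal (2 * D) * ennreal (R e (w(e := x))) +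
            ennreal (a * (1 + real n)) * indicator B w" .
        qed
        also have "\<dots> = (ennreal (Q e w) + ennreal (2 * D) * (\<integral>\<^sup>+x. ennreal (R e (w(e := x))) \<partial>uniform01)) +
          ennreal (a * (1 + real n)) * indicator B w"
          using measR4[OF w(1)] U.emeasure_space_1
          by (simp add: nn_integral_add nn_integral_cmult)
        finally show ?case .
      qed
    qed
    also have "\<dots> = ((\<integral>\<^sup>+w. ennreal (Q e w) \<partial>?M) +
        ennreal (2 * D) * (\<integral>\<^sup>+w. \<integral>\<^sup>+x. ennreal (R e (w(e := x))) \<partial>uniform01 \<partial>?M)) +
        ennreal (a * (1 + real n)) * emeasure ?M B"
      using measQ[of e] measR5 B(1)
      by (simp add: nn_integral_add nn_integral_cmult nn_integral_cmult_indicator)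
    \<comment> \<open>Here the count under the updated weights becomes the count under the initial
      ones.\<close>
    also have "(\<integral>\<^sup>+w. \<integral>\<^sup>+x. ennreal (R e (w(e := x))) \<partial>uniform01 \<partial>?M) =
        (\<integral>\<^sup>+w. \<integral>\<^sup>+x. ennreal (R e w) \<partial>uniform01 \<partial>?M)"
      using nn_integral_exchange_weight[OF e measR2] by (simp only: prod.case)
    also have "\<dots> = (\<integral>\<^sup>+w. ennreal (R e w) \<partial>?M)"
      using U.emeasure_space_1 by simp
    also have "ennreal (a * (1 + real n)) * emeasure ?M B \<le> ennreal (a * (1 + real n)) * ennreal P"
      by (intro mult_left_mono B(2)) simp
    also have "\<dots> = ennreal (a * (1 + real n) * P)"
      using P0 by (simp add: ennreal_mult'')
    finally show ?thesis by (simp add: add_left_mono)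
  qed
  have sums: "AE w in ?M. (\<Sum>e\<in>?A. Q e w) \<le> a * (1 + D) * (1 + l) + a * (1 + real n) * (1 + real n) * indicator B w"
    "AE w in ?M. (\<Sum>e\<in>?A. R e w) \<le> a * l + a * real n * indicator B w"
  proof -
    have "AE w in ?M. (\<Sum>e\<in>?A. Q e w) \<le> a * (1 + D) * (1 + l) + a * (1 + real n) * (1 + real n) * indicator B w \<and>
      (\<Sum>e\<in>?A. R e w) \<le> a * l + a * real n * indicator B w"
      using typical
    proof eventually_elim
      case (elim w)
      then have w: "w \<in> space ?M" "\<And>a. a \<in> ?A \<Longrightarrow> 0 \<le> w a" "distinct_costs n w" by blast+
      show ?case
      proof (cases "w \<in> B")
        case True
        have "real (length p) \<le> real n" if "p \<in> proper_shortest n w" for p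
          using proper_shortest_length_less[OF that] by simp
        note s = sum_card_through_le[OF w(3) extension_bound_trivial _ _ this]
        have "(\<Sum>e\<in>?A. Q e w) \<le> a * (1 + real n) * (1 + real n)" "(\<Sum>e\<in>?A. R e w) \<le> a * real n"
          unfolding Q_def R_def a_def by (rule s; simp)+
        moreover have "0 \<le> a * (1 + D) * (1 + l)" "0 \<le> a * l" using a0 D0 l0 by simp_all
        ultimately show ?thesis using True by simp
      next
        case False
        have "extension_bound n w (\<lambda>b. light_ends n (if b then id else prod.swap) w) D"
          unfolding D_def using w False n by (intro typical_extension_bound) (auto simp only: B_def)
        moreover have "real (length p) \<le> l" if "p \<in> proper_shortest n w" for p
          unfolding l_def using w False n that by (intro typical_shortest(1)) (auto simp only: B_def)
        ultimately have "(\<Sum>e\<in>?A. Q e w) \<le> a * (1 + D) * (1 + l)" "(\<Sum>e\<in>?A. R e w) \<le> a * l"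
          unfolding Q_def R_def a_def using sum_card_through_le[OF w(3) _ D0 l0] by blast+
        then show ?thesis using False by simp
      qed
    qed
    then show "AE w in ?M. (\<Sum>e\<in>?A. Q e w) \<le> a * (1 + D) * (1 + l) + a * (1 + real n) * (1 + real n) * indicator B w"
      "AE w in ?M. (\<Sum>e\<in>?A. R e w) \<le> a * l + a * real n * indicator B w"
      by auto
  qed
  have "(\<Sum>e\<in>?A. \<integral>\<^sup>+w. ennreal (Q e w) \<partial>?M) = (\<integral>\<^sup>+w. (\<Sum>e\<in>?A. ennreal (Q e w)) \<partial>?M)"
    using measQ by (intro nn_integral_sum[symmetric]) simp
  also have "\<dots> = (\<integral>\<^sup>+w. ennreal (\<Sum>e\<in>?A. Q e w) \<partial>?M)"
    by (intro nn_integral_cong sum_ennreal) (simp add: Q_def)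
  also have "\<dots> \<le> ennreal (a * (1 + D) * (1 + l) + a * (1 + real n) * (1 + real n) * P)"
    using a0 D0 l0 P0 by (intro nn_integral_weight_space_le[OF B _ _ _ sums(1)]) auto
  finally have sumQ: "(\<Sum>e\<in>?A. \<integral>\<^sup>+w. ennreal (Q e w) \<partial>?M) \<le>
      ennreal (a * (1 + D) * (1 + l) + a * (1 + real n) * (1 + real n) * P)" .
  have "(\<Sum>e\<in>?A. \<integral>\<^sup>+w. ennreal (R e w) \<partial>?M) = (\<integral>\<^sup>+w. (\<Sum>e\<in>?A. ennreal (R e w)) \<partial>?M)"
    using measR by (intro nn_integral_sum[symmetric]) simp
  also have "\<dots> = (\<integral>\<^sup>+w. ennreal (\<Sum>e\<in>?A. R e w) \<partial>?M)"
    by (intro nn_integral_cong sum_ennreal) (simp add: R_def)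
  also have "\<dots> \<le> ennreal (a * l + a * real n * P)"
    using a0 D0 l0 P0 by (intro nn_integral_weight_space_le[OF B _ _ _ sums(2)]) auto
  finally have sumR: "(\<Sum>e\<in>?A. \<integral>\<^sup>+w. ennreal (R e w) \<partial>?M) \<le> ennreal (a * l + a * real n * P)" .
  have "(\<Sum>e\<in>?A. \<integral>\<^sup>+w. \<integral>\<^sup>+x. ennreal (real (card (K.lsp_minus n w e x))) \<partial>uniform01 \<partial>?M) \<le>
    (\<Sum>e\<in>?A. (\<integral>\<^sup>+w. ennreal (Q e w) \<partial>?M) + ennreal (2 * D) * (\<integral>\<^sup>+w. ennreal (R e w) \<partial>?M) +
        ennreal (a * (1 + real n) * P))"
    by (rule sum_mono[OF single])
  also have "\<dots> = (\<Sum>e\<in>?A. \<integral>\<^sup>+w. ennreal (Q e w) \<partial>?M) + ennreal (2 * D) * (\<Sum>e\<in>?A. \<integral>\<^sup>+w. ennreal (R e w) \<partial>?M) +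
      (\<Sum>e\<in>?A. ennreal (a * (1 + real n) * P))"
    by (simp only: sum.distrib sum_distrib_left)
  also have "(\<Sum>e\<in>?A. ennreal (a * (1 + real n) * P)) = ennreal (a * (a * (1 + real n) * P))"
    unfolding sum_constant a_def by (simp only: ennreal_of_nat_eq_real_of_nat ennreal_mult' of_nat_0_le_iff)
  also have "(\<Sum>e\<in>?A. \<integral>\<^sup>+w. ennreal (Q e w) \<partial>?M) + ennreal (2 * D) * (\<Sum>e\<in>?A. \<integral>\<^sup>+w. ennreal (R e w) \<partial>?M) +
      ennreal (a * (a * (1 + real n) * P)) \<le>
    ennreal (a * (1 + D) * (1 + l) + a * (1 + real n) * (1 + real n) * P) + ennreal (2 * D) * ennreal (a * l + a * real n * P) +
      ennreal (a * (a * (1 + real n) * P))"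
    by (intro add_mono mult_left_mono sumQ sumR order_refl) simp
  also have "\<dots> = ennreal (a * ((1 + D) * (1 + l) + (1 + real n) * (1 + real n) * P + 2 * D * (l + real n * P) + a * (1 + real n) * P))"
  proof -
    have "0 \<le> a * (1 + D) * (1 + l) + a * (1 + real n) * (1 + real n) * P" "0 \<le> a * l + a * real n * P"
      "0 \<le> 2 * D" "0 \<le> a * (a * (1 + real n) * P)"
      using a0 D0 l0 P0 by simp_all
    moreover have "a * ((1 + D) * (1 + l) + (1 + real n) * (1 + real n) * P + 2 * D * (l + real n * P) + a * (1 + real n) * P) =
      (a * (1 + D) * (1 + l) + a * (1 + real n) * (1 + real n) * P) + 2 * D * (a * l + a * real n * P) +
      a * (a * (1 + real n) * P)"
      by (simp add: algebra_simps)
    ultimately show ?thesis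
      by (simp only: ennreal_plus ennreal_mult add_nonneg_nonneg mult_nonneg_nonneg)
  qed
  finally have total: "(\<Sum>e\<in>?A. \<integral>\<^sup>+w. \<integral>\<^sup>+x. ennreal (real (card (K.lsp_minus n w e x))) \<partial>uniform01 \<partial>?M) \<le>
    ennreal (a * ((1 + D) * (1 + l) + (1 + real n) * (1 + real n) * P + 2 * D * (l + real n * P) + a * (1 + real n) * P))" .
  have a_pos: "0 < a" and a_le: "a \<le> real n * real n"
  proof -
    have "card ?A = n * (n - 1)" by (rule card_arcs_complete_nat_digraph)
    then show "0 < a" "a \<le> real n * real n"
      unfolding a_def using n(1) by (simp_all flip: of_nat_mult)
  qed
  have "(1 + D) * (1 + l) + (1 + real n) * (1 + real n) * P + 2 * D * (l + real n * P) + a * (1 + real n) * P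
    \<le> 10 ^ 10 * (ln (real n))\<^sup>2" (is "?T \<le> _")
  proof -
    have n1: "1 \<le> real n" using n(1) by simp
    \<comment> \<open>\<open>P\<close> is n^-4, while the polynomial factors of \<open>P\<close> in
      \<open>?T\<close> have degree at most 3 in \<open>n\<close>, as \<open>a\<close> has degree 2;
      their contributions stay bounded.\<close>
    have p4: "real n * real n * real n * real n * P = 1"
      using n(1) by (simp add: P_def power_one_over eval_nat_numeral)
    have m1: "(1 + real n) * (1 + real n) \<le> 4 * (real n * real n * real n * real n)"
    proof -
      have "(1 + real n) * (1 + real n) \<le> (2 * real n) * (2 * real n)"
        using n1 by (intro mult_mono) auto
      also have "\<dots> = 4 * (real n * real n * 1 * 1)" by simp
      also have "\<dots> \<le> 4 * (real n * real n * real n * real n)"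
        using n1 by (intro mult_mono) auto
      finally show ?thesis .
    qed
    have m2: "real n \<le> real n * real n * real n * real n"
    proof -
      have "real n * 1 * 1 * 1 \<le> real n * real n * real n * real n"
        using n1 by (intro mult_mono) auto
      then show ?thesis by simp
    qed
    have m3: "a * (1 + real n) \<le> 2 * (real n * real n * real n * real n)"
    proof -
      have "a * (1 + real n) \<le> (real n * real n) * (2 * real n)"
        using n1 a_le by (intro mult_mono) auto
      also have "\<dots> = 2 * (real n * real n * real n * 1)" by simp
      also have "\<dots> \<le> 2 * (real n * real n * real n * real n)"
        using n1 by (intro mult_left_mono mult_mono) auto
      finally show ?thesis .
    qed
    have "(1 + real n) * (1 + real n) * P \<le> 4" "real n * P \<le> 1" "a * (1 + real n) * P \<le> 2"
      using mult_right_mono[OF m1 P0] mult_right_mono[OF m2 P0] mult_right_mono[OF m3 P0] p4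
      by (simp_all add: mult.assoc)
    moreover have "2 * D * (l + real n * P) \<le> 2 * D * (l + 1)"
      using \<open>real n * P \<le> 1\<close> D0 by (intro mult_left_mono) auto
    ultimately have "?T \<le> (1 + D) * (1 + l) + 4 + 2 * D * (l + 1) + 2" by linarith
    also have "\<dots> \<le> (8011 * ln (real n)) * (12011 * ln (real n)) + 4 * (ln (real n) * ln (real n)) +
        2 * (8010 * ln (real n)) * (12011 * ln (real n)) + 2 * (ln (real n) * ln (real n))"
    proof -
      have "1 \<le> ln (real n) * ln (real n)" using mult_mono[OF ln1 ln1] ln1 by simp
      moreover have "(1 + D) * (1 + l) \<le> (8011 * ln (real n)) * (12011 * ln (real n))"
        using ln1 D0 l0 by (intro mult_mono) (auto simp: D_def l_def)
      moreover have "2 * D * (l + 1) \<le> 2 * (8010 * ln (real n)) * (12011 * ln (real n))"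
        using ln1 D0 l0 by (intro mult_mono) (auto simp: D_def l_def)
      ultimately show ?thesis by linarith
    qed
    \<comment> \<open>The coefficients add up to less than 3 * 10^8.\<close>
    also have "\<dots> \<le> 10 ^ 10 * (ln (real n))\<^sup>2"
      by (simp add: power2_eq_square)
    finally show ?thesis .
  qed
  then have "(\<integral>\<^sup>+(w, e, x). ennreal (real (card (K.lsp_minus n w e x))) \<partial>update_space n) \<le>
      ennreal (10 ^ 10 * (ln (real n))\<^sup>2)"
  proof -
    assume le: "?T \<le> 10 ^ 10 * (ln (real n))\<^sup>2"
    have "(\<integral>\<^sup>+(w, e, x). ennreal (real (card (K.lsp_minus n w e x))) \<partial>update_space n) \<le> ennreal (1 / a) * ennreal (a * ?T)"
      unfolding nn_integral_update_space[OF n2 borel_measurable_card_lsp_minus[OF n2]] prod.case a_def[symmetric]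
      by (intro mult_left_mono total) simp
    also have "\<dots> = ennreal ?T"
      using a_pos by (subst ennreal_mult'[symmetric]) simp_all
    also have "\<dots> \<le> ennreal (10 ^ 10 * (ln (real n))\<^sup>2)" by (rule ennreal_leI[OF le])
    finally show ?thesis .
  qed
  then show ?thesis
    unfolding integral_eq_enn2real[OF integrable_lsp_minus[OF n2]]
    by (intro enn2real_leI) auto
qed

theorem theorem35:
  shows "(\<forall>n\<ge>2. (\<integral>(w, e, x). real (card (K.lsp_minus n w e x)) \<partial>update_space n) =
                 (\<integral>(w, e, x). real (card (K.lsp_plus n w e x)) \<partial>update_space n)) \<and>
         (\<lambda>n. \<integral>(w, e, x). real (card (K.lsp_minus n w e x)) \<partial>update_space n)
           \<in> O(\<lambda>n. (ln (real n))\<^sup>2)"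
proof (intro conjI allI impI)
  show "(\<integral>(w, e, x). real (card (K.lsp_minus n w e x)) \<partial>update_space n) =
      (\<integral>(w, e, x). real (card (K.lsp_plus n w e x)) \<partial>update_space n)" if "n \<ge> 2" for n
    by (rule expectation_lsp_minus_eq_lsp_plus[OF that])
  \<comment> \<open>This keeps the bound for light arcs within the unit interval, where the uniform
    distribution function is the identity.\<close>
  have "eventually (\<lambda>n. 4000 * ln (real n) \<le> real n) sequentially"
    by real_asymp
  then have ev: "eventually (\<lambda>n. n \<ge> 3 \<and> 4000 * ln (real n) \<le> real n) sequentially"
    using eventually_ge_at_top[of 3] by eventually_elim simp
  show "(\<lambda>n. \<integral>(w, e, x). real (card (K.lsp_minus n w e x)) \<partial>update_space n) \<in> O(\<lambda>n. (ln (real n))\<^sup>2)"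
  proof (rule bigoI[where c = "10 ^ 10"])
    show "\<forall>\<^sub>F n in sequentially. norm (\<integral>(w, e, x). real (card (K.lsp_minus n w e x)) \<partial>update_space n) \<le>
        10 ^ 10 * norm ((ln (real n))\<^sup>2)"
      using ev
    proof eventually_elim
      case (elim n)
      have "0 \<le> (\<integral>(w, e, x). real (card (K.lsp_minus n w e x)) \<partial>update_space n)"
        by (rule Bochner_Integration.integral_nonneg) auto
      with expectation_lsp_minus_le[of n] elim show ?case by simp
    qed
  qed
qed

end
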